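(* Suppose that $X$ and $Y$ are finitely generated operator systems. Then $X$ and $Y$ are completely order isomorphic if and only if $\varphi^X=\varphi^Y$ for every universal $\mathcal{L}_{OSy}$-sentence $\varphi$. In particular, the relation of complete order isomorphism for finitely generated operator systems is smooth.
   Context: An operator system is a closed unital self-adjoint subspace of a unital C*-algebra; it is finitely generated exactly when it is finite-dimensional. A complete order isomorphism is a bijective unital linear map $u:X\to Y$ such that $u$ and $u^{-1}$ are completely positive (all amplifications $[x_{ij}]\mapsto[u(x_{ij})]$ on $M_n$ preserve positivity). The language $\mathcal{L}_{OSy}$ (continuous logic for metric structures, several sorts). An operator system $X$ is regarded as a structure with one sort for each $n\ge1$, interpreted as $M_n(X)$ with metric $d(x,y)=\|x-y\|$; domains of quantification $D_{n,k}$ ($k\ge1$) interpreted as the closed ball of radius $k$ in $M_n(X)$; function symbols for addition, multiplication by scalars in $\mathbb{Q}(i)$ and the adjoint on each $M_n(X)$; function symbols $x\mapsto axb$ from $M_k(X)$ to $M_n(X)$ for $a\in M_{n,k}(\mathbb{Q}(i))$, $b\in M_{k,n}(\mathbb{Q}(i))$; a constant for the unit $1\in X$; and for each $n$ a relation symbol for the distance to the cone of positive elements of $M_n(X)$. Formulas are built from atomic formulas using continuous functions $\mathbb{R}^m\to\mathbb{R}$ as connectives and quantifiers $\sup_{x\in D_{n,k}}$, $\inf_{x\in D_{n,k}}$; a sentence is a formula without free variables, $\varphi^X\in\mathbb{R}$ is its value in $X$; a formula is universal if it only uses the quantifier $\sup$. Smoothness. Let $H$ be the separable infinite-dimensional Hilbert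 space, with $B(H)$ carrying the standard Borel structure in which $A$ is Borel iff its intersection with each ball $\{\|x\|\le n\}$ is Borel for the weak operator topology. Finitely generated operator systems are parametrized by the Borel set of $\gamma\in B(H)^{\mathbb{N}}$ such that the norm-closed linear span $\mathcal{OS}y(\gamma)$ of $\{I\}\cup\{\gamma_n,\gamma_n^*:n\in\mathbb{N}\}$ is finite-dimensional. An equivalence relation $E$ on a standard Borel space $Z$ is smooth if there are a Polish space $P$ and a Borel map $f:Z\to P$ with $z\,E\,z'\iff f(z)=f(z')$. *)

theory Defs
  imports "HOL-Analysis.Analysis" "Jordan_Normal_Form.Matrix"
begin

section \<open>Complex vector spaces and unital C*-algebras\<close>

class complex_vector = real_vector +
  fixes scaleC :: "complex \<Rightarrow> 'a \<Rightarrow> 'a"  (infixr \<open>*\<^sub>C\<close> 75)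
  assumes scaleR_scaleC: "scaleR r x = complex_of_real r *\<^sub>C x"
    and scaleC_add_right: "c *\<^sub>C (x + y) = c *\<^sub>C x + c *\<^sub>C y"
    and scaleC_add_left: "(c + d) *\<^sub>C x = c *\<^sub>C x + d *\<^sub>C x"
    and scaleC_scaleC: "c *\<^sub>C (d *\<^sub>C x) = (c * d) *\<^sub>C x"
    and scaleC_one: "1 *\<^sub>C x = x"

interpretation complex_vector: vector_space "scaleC :: complex \<Rightarrow> 'a \<Rightarrow> 'a::complex_vector"
  by unfold_locales (simp_all add: scaleC_add_right scaleC_add_left scaleC_scaleC scaleC_one)

class complex_normed_vector = complex_vector + real_normed_vector +
  assumes norm_scaleC: "norm (c *\<^sub>C x) = cmod c * norm x"

text \<open>The superclass \<^class>\<open>real_normed_algebra_1\<close> provides submultiplicativity and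
  \<open>norm 1 = 1\<close>; in particular the zero algebra is excluded.\<close>

class cstar_algebra = complex_normed_vector + real_normed_algebra_1 + banach +
  fixes star :: "'a \<Rightarrow> 'a"
  assumes mult_scaleC_left: "(c *\<^sub>C x) * y = c *\<^sub>C (x * y)"
    and mult_scaleC_right: "x * (c *\<^sub>C y) = c *\<^sub>C (x * y)"
    and star_star: "star (star x) = x"
    and star_add: "star (x + y) = star x + star y"
    and star_scaleC: "star (c *\<^sub>C x) = cnj c *\<^sub>C star x"
    and star_mult: "star (x * y) = star y * star x"
    and cstar_identity: "norm (star x * x) = (norm x)\<^sup>2"


section \<open>Matrices over a C*-algebra\<close>

definition mat_star :: "'a::cstar_algebra mat \<Rightarrow> 'a mat" where
  "mat_star a = Matrix.mat (dim_col a) (dim_row a) (\<lambda>(i, j). star (a $$ (j, i)))"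

definition mat_scaleC :: "complex \<Rightarrow> 'a::cstar_algebra mat \<Rightarrow> 'a mat" where
  "mat_scaleC c = map_mat (scaleC c)"

definition scalar_mat :: "complex mat \<Rightarrow> 'a::cstar_algebra mat" where
  "scalar_mat = map_mat (\<lambda>c. c *\<^sub>C 1)"

text \<open>The norm of the Hilbert module \<open>A\<^sup>n\<close>, that is \<open>\<parallel>\<langle>x, x\<rangle>\<parallel>\<^sup>1\<^sup>/\<^sup>2\<close> for the \<open>A\<close>-valued inner product
  \<open>\<langle>x, y\<rangle> = \<Sum>\<^sub>i x\<^sub>i\<^sup>* y\<^sub>i\<close>.\<close>

definition column_norm :: "'a::cstar_algebra Matrix.vec \<Rightarrow> real" where
  "column_norm x = sqrt (norm (\<Sum>i<dim_vec x. star (vec_index x i) * vec_index x i))"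

text \<open>The (unique) C*-norm of \<open>M\<^sub>n(A)\<close>: \<open>M\<^sub>n(A)\<close> is faithfully represented, by multiplication of columns
  from the left, as a *-algebra of adjointable operators on the Hilbert module \<open>A\<^sup>n\<close>, and this is
  the operator norm there.\<close>

definition mat_norm :: "'a::cstar_algebra mat \<Rightarrow> real" where
  "mat_norm a = (SUP x \<in> {x \<in> carrier_vec (dim_col a). column_norm x \<le> 1}. column_norm (a *\<^sub>v x))"

definition mat_positive :: "nat \<Rightarrow> 'a::cstar_algebra mat \<Rightarrow> bool" where
  "mat_positive n a \<longleftrightarrow> (\<exists>b \<in> carrier_mat n n. a = mat_star b * b)"


section \<open>Operator systems\<close>

definition operator_system :: "'a::cstar_algebra set \<Rightarrow> bool" where
  "operator_system X \<longleftrightarrow>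
     complex_vector.subspace X \<and> closed X \<and> 1 \<in> X \<and> (\<forall>x\<in>X. star x \<in> X)"

definition OSy :: "'a::cstar_algebra set \<Rightarrow> 'a set" where
  "OSy S = closure (complex_vector.span ({1} \<union> S \<union> star ` S))"

definition finitely_generated :: "'a::cstar_algebra set \<Rightarrow> bool" where
  "finitely_generated X \<longleftrightarrow> (\<exists>F. finite F \<and> X = OSy F)"

definition finite_dimensional :: "'a::cstar_algebra set \<Rightarrow> bool" where
  "finite_dimensional X \<longleftrightarrow> (\<exists>B. finite B \<and> X = complex_vector.span B)"

definition mats :: "nat \<Rightarrow> 'a::cstar_algebra set \<Rightarrow> 'a mat set" where
  "mats n X = {x \<in> carrier_mat n n. elements_mat x \<subseteq> X}"

definition positive_cone :: "nat \<Rightarrow> 'a::cstar_algebra set \<Rightarrow> 'a mat set" where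
  "positive_cone n X = {x \<in> mats n X. mat_positive n x}"

definition completely_positive ::
  "'a::cstar_algebra set \<Rightarrow> 'b::cstar_algebra set \<Rightarrow> ('a \<Rightarrow> 'b) \<Rightarrow> bool" where
  "completely_positive X Y u \<longleftrightarrow>
     (\<forall>n\<ge>1. \<forall>x \<in> positive_cone n X. map_mat u x \<in> positive_cone n Y)"

definition complete_order_isomorphism ::
  "'a::cstar_algebra set \<Rightarrow> 'b::cstar_algebra set \<Rightarrow> ('a \<Rightarrow> 'b) \<Rightarrow> bool" where
  "complete_order_isomorphism X Y u \<longleftrightarrow>
     bij_betw u X Y \<and> u 1 = 1 \<and>
     (\<forall>x\<in>X. \<forall>y\<in>X. u (x + y) = u x + u y) \<and>
     (\<forall>c. \<forall>x\<in>X. u (c *\<^sub>C x) = c *\<^sub>C u x) \<and>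
     completely_positive X Y u \<and> completely_positive Y X (inv_into X u)"

definition completely_order_isomorphic ::
  "'a::cstar_algebra set \<Rightarrow> 'b::cstar_algebra set \<Rightarrow> bool" where
  "completely_order_isomorphic X Y \<longleftrightarrow> (\<exists>u. complete_order_isomorphism X Y u)"


section \<open>The language of operator systems\<close>

definition gaussian_rationals :: "complex set" where
  "gaussian_rationals = {c. Re c \<in> \<rat> \<and> Im c \<in> \<rat>}"

text \<open>\<open>Variable n i\<close> is the \<open>i\<close>-th variable of sort \<open>n\<close>, and \<open>Sandwich a t b\<close> stands for \<open>a t b\<close>.
  The raw syntax is unsorted; \<open>has_sort\<close> and \<open>wf_formula\<close> below single out the legal expressions.\<close>

datatype osy_term =
    Variable nat nat
  | One
  | Add osy_term osy_term
  | Scale complex osy_term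
  | Adjoint osy_term
  | Sandwich "complex mat" osy_term "complex mat"

text \<open>\<open>SupD n k i \<phi>\<close> and \<open>InfD n k i \<phi>\<close> quantify the variable \<open>Variable n i\<close> over \<open>D\<^sub>n\<^sub>,\<^sub>k\<close>. In
  \<open>Connective f \<phi>s\<close>, a function \<open>\<real>\<^sup>m \<rightarrow> \<real>\<close> with \<open>m = length \<phi>s\<close> is represented as a function on
  the extensional functions on \<open>{..<m}\<close>.\<close>

datatype osy_formula =
    Dist osy_term osy_term
  | DistCone osy_term
  | Connective "(nat \<Rightarrow> real) \<Rightarrow> real" "osy_formula list"
  | SupD nat nat nat osy_formula
  | InfD nat nat nat osy_formula

primrec has_sort :: "osy_term \<Rightarrow> nat \<Rightarrow> bool" where
  "has_sort (Variable m i) n \<longleftrightarrow> m \<ge> 1 \<and> n = m"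
| "has_sort One n \<longleftrightarrow> n = 1"
| "has_sort (Add s t) n \<longleftrightarrow> has_sort s n \<and> has_sort t n"
| "has_sort (Scale c t) n \<longleftrightarrow> c \<in> gaussian_rationals \<and> has_sort t n"
| "has_sort (Adjoint t) n \<longleftrightarrow> has_sort t n"
| "has_sort (Sandwich a t b) n \<longleftrightarrow> n \<ge> 1 \<and>
     (\<exists>k\<ge>1. a \<in> carrier_mat n k \<and> b \<in> carrier_mat k n \<and>
       elements_mat a \<subseteq> gaussian_rationals \<and> elements_mat b \<subseteq> gaussian_rationals \<and> has_sort t k)"

fun wf_formula :: "osy_formula \<Rightarrow> bool" where
  "wf_formula (Dist s t) \<longleftrightarrow> (\<exists>n\<ge>1. has_sort s n \<and> has_sort t n)"
| "wf_formula (DistCone t) \<longleftrightarrow> (\<exists>n\<ge>1. has_sort t n)"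
| "wf_formula (Connective f \<phi>s) \<longleftrightarrow>
     continuous_map (product_topology (\<lambda>_. euclideanreal) {..<length \<phi>s}) euclideanreal f \<and>
     (\<forall>\<phi> \<in> set \<phi>s. wf_formula \<phi>)"
| "wf_formula (SupD n k i \<phi>) \<longleftrightarrow> n \<ge> 1 \<and> k \<ge> 1 \<and> wf_formula \<phi>"
| "wf_formula (InfD n k i \<phi>) \<longleftrightarrow> n \<ge> 1 \<and> k \<ge> 1 \<and> wf_formula \<phi>"

primrec term_vars :: "osy_term \<Rightarrow> (nat \<times> nat) set" where
  "term_vars (Variable n i) = {(n, i)}"
| "term_vars One = {}"
| "term_vars (Add s t) = term_vars s \<union> term_vars t"
| "term_vars (Scale c t) = term_vars t"
| "term_vars (Adjoint t) = term_vars t"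
| "term_vars (Sandwich a t b) = term_vars t"

fun free_vars :: "osy_formula \<Rightarrow> (nat \<times> nat) set" where
  "free_vars (Dist s t) = term_vars s \<union> term_vars t"
| "free_vars (DistCone t) = term_vars t"
| "free_vars (Connective f \<phi>s) = (\<Union>\<phi> \<in> set \<phi>s. free_vars \<phi>)"
| "free_vars (SupD n k i \<phi>) = free_vars \<phi> - {(n, i)}"
| "free_vars (InfD n k i \<phi>) = free_vars \<phi> - {(n, i)}"

definition sentence :: "osy_formula \<Rightarrow> bool" where
  "sentence \<phi> \<longleftrightarrow> wf_formula \<phi> \<and> free_vars \<phi> = {}"

fun universal :: "osy_formula \<Rightarrow> bool" where
  "universal (Dist s t) \<longleftrightarrow> True"
| "universal (DistCone t) \<longleftrightarrow> True"
| "universal (Connective f \<phi>s) \<longleftrightarrow> (\<forall>\<phi> \<in> set \<phi>s. universal \<phi>)"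
| "universal (SupD n k i \<phi>) \<longleftrightarrow> universal \<phi>"
| "universal (InfD n k i \<phi>) \<longleftrightarrow> False"

text \<open>The language has no restriction to monotone connectives, so \<open>universal\<close> allows, for
  instance, \<open>t \<mapsto> -t\<close> to be applied to a supremum. The following is the narrower prenex
  notion: a block of suprema in front of a quantifier-free formula.\<close>

fun quantifier_free :: "osy_formula \<Rightarrow> bool" where
  "quantifier_free (Dist s t) \<longleftrightarrow> True"
| "quantifier_free (DistCone t) \<longleftrightarrow> True"
| "quantifier_free (Connective f \<phi>s) \<longleftrightarrow> (\<forall>\<phi> \<in> set \<phi>s. quantifier_free \<phi>)"
| "quantifier_free (SupD n k i \<phi>) \<longleftrightarrow> False"
| "quantifier_free (InfD n k i \<phi>) \<longleftrightarrow> False"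

inductive prenex_universal :: "osy_formula \<Rightarrow> bool" where
  "quantifier_free \<phi> \<Longrightarrow> prenex_universal \<phi>"
| "prenex_universal \<phi> \<Longrightarrow> prenex_universal (SupD n k i \<phi>)"

text \<open>An assignment \<open>e\<close> gives \<open>Variable n i\<close> the value \<open>e n i\<close>.\<close>

primrec term_value :: "(nat \<Rightarrow> nat \<Rightarrow> 'a::cstar_algebra mat) \<Rightarrow> osy_term \<Rightarrow> 'a mat" where
  "term_value e (Variable n i) = e n i"
| "term_value e One = 1\<^sub>m 1"
| "term_value e (Add s t) = term_value e s + term_value e t"
| "term_value e (Scale c t) = mat_scaleC c (term_value e t)"
| "term_value e (Adjoint t) = mat_star (term_value e t)"
| "term_value e (Sandwich a t b) = scalar_mat a * term_value e t * scalar_mat b"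

definition mat_ball :: "nat \<Rightarrow> nat \<Rightarrow> 'a::cstar_algebra set \<Rightarrow> 'a mat set" where
  "mat_ball n k X = {x \<in> mats n X. mat_norm x \<le> real k}"

definition dist_cone :: "'a::cstar_algebra set \<Rightarrow> 'a mat \<Rightarrow> real" where
  "dist_cone X x = (INF p \<in> positive_cone (dim_row x) X. mat_norm (x - p))"

fun formula_value ::
  "'a::cstar_algebra set \<Rightarrow> (nat \<Rightarrow> nat \<Rightarrow> 'a mat) \<Rightarrow> osy_formula \<Rightarrow> real" where
  "formula_value X e (Dist s t) = mat_norm (term_value e s - term_value e t)"
| "formula_value X e (DistCone t) = dist_cone X (term_value e t)"
| "formula_value X e (Connective f \<phi>s) =
     f (\<lambda>j\<in>{..<length \<phi>s}. map (formula_value X e) \<phi>s ! j)"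
| "formula_value X e (SupD n k i \<phi>) =
     (SUP x \<in> mat_ball n k X. formula_value X (e(n := (e n)(i := x))) \<phi>)"
| "formula_value X e (InfD n k i \<phi>) =
     (INF x \<in> mat_ball n k X. formula_value X (e(n := (e n)(i := x))) \<phi>)"

text \<open>The value of a sentence does not depend on the assignment, which is taken to be zero.\<close>

definition sentence_value :: "'a::cstar_algebra set \<Rightarrow> osy_formula \<Rightarrow> real" where
  "sentence_value X \<phi> = formula_value X (\<lambda>n i. 0\<^sub>m n n) \<phi>"


section \<open>Standard Borel spaces and smooth equivalence relations\<close>

definition borel_of :: "'a topology \<Rightarrow> 'a measure" where
  "borel_of T = sigma (topspace T) {U. openin T U}"

definition polish_space :: "'a topology \<Rightarrow> bool" where
  "polish_space T \<longleftrightarrow> completely_metrizable_space T \<and> separable_space T"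

text \<open>Every Polish space is homeomorphic to a subspace of \<open>\<real>\<^sup>\<nat>\<close>, so that quantifying over the Polish
  topologies with points in \<^typ>\<open>nat \<Rightarrow> real\<close> quantifies over all Polish spaces. A standard Borel
  space is one that is isomorphic to a Borel subset of a Polish space.\<close>

definition standard_borel :: "'a measure \<Rightarrow> bool" where
  "standard_borel M \<longleftrightarrow>
     (\<exists>(P :: (nat \<Rightarrow> real) topology) B f g.
        polish_space P \<and> B \<in> sets (borel_of P) \<and>
        f \<in> measurable M (restrict_space (borel_of P) B) \<and>
        g \<in> measurable (restrict_space (borel_of P) B) M \<and>
        (\<forall>z \<in> space M. g (f z) = z) \<and> (\<forall>p \<in> B. f (g p) = p))"

definition smooth_equivalence :: "'a measure \<Rightarrow> ('a \<times> 'a) set \<Rightarrow> bool" where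
  "smooth_equivalence M E \<longleftrightarrow>
     standard_borel M \<and> equiv (space M) E \<and>
     (\<exists>(P :: (nat \<Rightarrow> real) topology) f.
        polish_space P \<and> f \<in> measurable M (borel_of P) \<and>
        (\<forall>z \<in> space M. \<forall>z' \<in> space M. (z, z') \<in> E \<longleftrightarrow> f z = f z'))"


section \<open>Bounded operators on a separable infinite-dimensional Hilbert space\<close>

class complex_hilbert_space = complex_normed_vector + complete_space +
  fixes cinner :: "'a \<Rightarrow> 'a \<Rightarrow> complex"
  assumes cinner_commute: "cinner x y = cnj (cinner y x)"
    and cinner_add_right: "cinner x (y + z) = cinner x y + cinner x z"
    and cinner_scaleC_right: "cinner x (c *\<^sub>C y) = c * cinner x y"
    and cinner_self: "cinner x x = complex_of_real ((norm x)\<^sup>2)"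

text \<open>For metric spaces, separability is the same as second countability.\<close>

class separable_hilbert_space = complex_hilbert_space + second_countable_topology +
  assumes infinite_dimensional:
    "\<not> (\<exists>B. finite B \<and> (\<forall>x. \<exists>c. x = (\<Sum>b\<in>B. c b *\<^sub>C b)))"

subclass (in complex_hilbert_space) banach ..

lemma cinner_add_left: "cinner (x + y) z = cinner x z + cinner y z"
  for x y z :: "'a::complex_hilbert_space"
  by (metis cinner_add_right cinner_commute complex_cnj_add)

lemma cinner_scaleC_left: "cinner (c *\<^sub>C x) y = cnj c * cinner x y"
  for x y :: "'a::complex_hilbert_space"
  by (metis cinner_commute cinner_scaleC_right complex_cnj_mult)

lemma cinner_minus_right: "cinner x (- y) = - cinner x y"
  for x y :: "'a::complex_hilbert_space"
  by (metis cinner_scaleC_right complex_vector.scale_minus_left mult_minus1 scaleC_one)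

lemma cinner_diff_right: "cinner x (y - z) = cinner x y - cinner x z"
  for x y z :: "'a::complex_hilbert_space"
  by (metis cinner_add_right cinner_minus_right diff_conv_add_uminus)

lemma cinner_diff_left: "cinner (x - y) z = cinner x z - cinner y z"
  for x y z :: "'a::complex_hilbert_space"
  by (metis cinner_diff_right cinner_commute complex_cnj_diff)

lemma cinner_scaleR_right: "cinner x (r *\<^sub>R y) = of_real r * cinner x y"
  for x y :: "'a::complex_hilbert_space"
  by (simp add: scaleR_scaleC cinner_scaleC_right)

lemma cinner_scaleR_left: "cinner (r *\<^sub>R x) y = of_real r * cinner x y"
  for x y :: "'a::complex_hilbert_space"
  by (simp add: scaleR_scaleC cinner_scaleC_left)

lemma norm_power2_cinner: "(norm x)\<^sup>2 = Re (cinner x x)"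
  for x :: "'a::complex_hilbert_space"
  by (simp add: cinner_self)

lemma norm_add_power2:
  "(norm (x + y))\<^sup>2 = (norm x)\<^sup>2 + 2 * Re (cinner x y) + (norm y)\<^sup>2"
  for x y :: "'a::complex_hilbert_space"
proof -
  have "Re (cinner y x) = Re (cinner x y)"
    by (metis cinner_commute complex_cnj(1) complex_surj complex.sel(1))
  then show ?thesis
    unfolding norm_power2_cinner by (simp add: cinner_add_left cinner_add_right)
qed

lemma cinner_eqI: "(\<And>z. cinner z x = cinner z y) \<Longrightarrow> x = y"
  for x y :: "'a::complex_hilbert_space"
proof -
  assume "\<And>z. cinner z x = cinner z y"
  then have "cinner (x - y) (x - y) = 0"
    by (simp add: cinner_diff_right)
  then show "x = y"
    by (simp add: cinner_self)
qed

lemma Re_cinner_le: "Re (cinner x y) \<le> norm x * norm y"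
  for x y :: "'a::complex_hilbert_space"
proof -
  have "(norm (x + y))\<^sup>2 \<le> (norm x + norm y)\<^sup>2"
    by (simp add: norm_triangle_ineq power_mono)
  then show ?thesis
    unfolding norm_add_power2 by (simp add: power2_sum)
qed

lemma cmod_cinner_le: "cmod (cinner x y) \<le> norm x * norm y"
  for x y :: "'a::complex_hilbert_space"
proof (cases "cinner x y = 0")
  case False
  define c where "c = cnj (sgn (cinner x y))"
  have "cmod c = 1"
    using False by (simp add: c_def norm_sgn)
  have "c * cinner x y = cnj (cinner x y) * cinner x y / of_real (cmod (cinner x y))"
    by (simp add: c_def sgn_eq)
  also have "\<dots> = of_real (cmod (cinner x y))"
    using False by (simp add: mult.commute[of "cnj _"] power2_eq_square flip: complex_norm_square)
  finally have "c * cinner x y = of_real (cmod (cinner x y))" .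
  then have "cmod (cinner x y) = Re (cinner x (c *\<^sub>C y))"
    by (metis Re_complex_of_real cinner_scaleC_right)
  also have "\<dots> \<le> norm x * norm (c *\<^sub>C y)"
    by (rule Re_cinner_le)
  finally show ?thesis
    using \<open>cmod c = 1\<close> by (simp add: norm_scaleC)
qed simp

lemma parallelogram:
  "(norm (x + y))\<^sup>2 + (norm (x - y))\<^sup>2 = 2 * (norm x)\<^sup>2 + 2 * (norm y)\<^sup>2"
  for x y :: "'a::complex_hilbert_space"
  using norm_add_power2[of x y] norm_add_power2[of x "- y"] by (simp add: cinner_minus_right)

lemma riesz_Re:
  fixes g :: "'a::complex_hilbert_space \<Rightarrow> real"
  assumes "bounded_linear g"
  shows "\<exists>v. \<forall>x. g x = Re (cinner v x)"
proof -
  interpret g: bounded_linear g by fact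
  obtain K where K: "\<And>x. norm (g x) \<le> norm x * K" and "K > 0"
    using g.pos_bounded by blast
  define J where "J x = (norm x)\<^sup>2 - 2 * g x" for x
  have J_ge: "J x \<ge> - K\<^sup>2" for x
  proof -
    have "g x \<le> norm x * K" using K[of x] by simp
    moreover have "(norm x - K)\<^sup>2 \<ge> 0" by simp
    ultimately show ?thesis unfolding J_def by (simp add: power2_diff)
  qed
  define d where "d = (INF x. J x)"
  have bdd: "bdd_below (range J)" using J_ge by (intro bdd_belowI2)
  have d_le: "d \<le> J x" for x unfolding d_def using bdd by (rule cINF_lower) simp
  have "\<exists>x. J x < d + inverse (real (Suc n))" for n
  proof (rule ccontr)
    assume "\<not> ?thesis"
    then have "d + inverse (real (Suc n)) \<le> d"
      unfolding d_def by (intro cINF_greatest) (auto simp: not_less)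
    then show False by simp
  qed
  then obtain X where X: "\<And>n. J (X n) < d + inverse (real (Suc n))" by metis
  have mid: "(norm (x - y))\<^sup>2 \<le> 2 * (J x - d) + 2 * (J y - d)" for x y
  proof -
    have half: "4 * (\<bar>1/2\<bar>\<^sup>2 * A - 2 * ((1/2) * B)) = A - 4 * B" for A B :: real
      by (simp add: power2_eq_square)
    have "4 * J ((1/2) *\<^sub>R (x + y)) = (norm (x + y))\<^sup>2 - 4 * (g x + g y)"
      unfolding J_def norm_scaleR power_mult_distrib g.scaleR real_scaleR_def half g.add ..
    moreover have "4 * d \<le> 4 * J ((1/2) *\<^sub>R (x + y))" using d_le by simp
    ultimately show ?thesis using parallelogram[of x y] unfolding J_def by simp
  qed
  have "Cauchy X"
  proof (rule metric_CauchyI)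
    fix e :: real assume "e > 0"
    then obtain N where N: "inverse (real (Suc N)) < e\<^sup>2 / 4"
      using reals_Archimedean[of "e\<^sup>2 / 4"] by auto
    show "\<exists>M. \<forall>m\<ge>M. \<forall>n\<ge>M. dist (X m) (X n) < e"
    proof (intro exI[of _ N] allI impI)
      fix m n assume "m \<ge> N" "n \<ge> N"
      then have "inverse (real (Suc m)) \<le> inverse (real (Suc N))"
        "inverse (real (Suc n)) \<le> inverse (real (Suc N))" by (simp_all add: le_imp_inverse_le)
      then have "J (X m) - d < e\<^sup>2 / 4" "J (X n) - d < e\<^sup>2 / 4"
        using X[of m] X[of n] N by linarith+
      then have "2 * (J (X m) - d) + 2 * (J (X n) - d) < 2 * (e\<^sup>2 / 4) + 2 * (e\<^sup>2 / 4)"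
        by (intro add_strict_mono mult_strict_left_mono) simp_all
      also have "\<dots> = e\<^sup>2" by simp
      finally have "(norm (X m - X n))\<^sup>2 < e\<^sup>2"
        using mid[of "X m" "X n"] by (rule le_less_trans[rotated])
      then show "dist (X m) (X n) < e"
        unfolding dist_norm using \<open>e > 0\<close> by (simp add: power_less_imp_less_base)
    qed
  qed
  then obtain v where v: "X \<longlonglongrightarrow> v" using Cauchy_convergent convergent_def by blast
  have "(\<lambda>n. J (X n)) \<longlonglongrightarrow> J v"
    unfolding J_def by (intro tendsto_intros v g.tendsto)
  moreover have "(\<lambda>n. d + inverse (real (Suc n))) \<longlonglongrightarrow> d + 0"
    by (intro tendsto_intros LIMSEQ_inverse_real_of_nat)
  ultimately have "J v \<le> d + 0"
    by (rule LIMSEQ_le) (intro exI[of _ 0] allI impI less_imp_le X)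
  then have min: "J v \<le> J x" for x using d_le[of x] by simp
  have "g x = Re (cinner v x)" for x
  proof -
    define b where "b = Re (cinner v x) - g x"
    have quad: "0 \<le> 2 * t * b + t\<^sup>2 * (norm x)\<^sup>2" for t :: real
      using min[of "v + t *\<^sub>R x"] norm_add_power2[of v "t *\<^sub>R x"]
      unfolding J_def b_def
      by (simp add: cinner_scaleR_right g.add g.scaleR power_mult_distrib algebra_simps)
    have "b = 0"
    proof (cases "x = 0")
      case True
      then show ?thesis using quad[of 1] quad[of "-1"] by simp
    next
      case False
      then have "0 \<le> 2 * (- b / (norm x)\<^sup>2) * b + (- b / (norm x)\<^sup>2)\<^sup>2 * (norm x)\<^sup>2"
        using quad by blast
      also have "\<dots> = - (b\<^sup>2 / (norm x)\<^sup>2)"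
        using False by (simp add: power2_eq_square field_simps)
      finally show ?thesis using False by (simp add: divide_le_0_iff)
    qed
    then show ?thesis by (simp add: b_def)
  qed
  then show ?thesis by blast
qed

lemma riesz:
  fixes f :: "'a::complex_hilbert_space \<Rightarrow> complex"
  assumes "bounded_linear f" and "\<And>c x. f (c *\<^sub>C x) = c * f x"
  shows "\<exists>v. \<forall>x. f x = cinner v x"
proof -
  obtain v where v: "\<And>x. Re (f x) = Re (cinner v x)"
    using riesz_Re[OF bounded_linear_compose[OF bounded_linear_Re assms(1)]] by auto
  have "Im (f x) = Im (cinner v x)" for x
    using v[of "\<i> *\<^sub>C x"] by (simp add: assms(2) cinner_scaleC_right)
  then have "f x = cinner v x" for x using v by (simp add: complex_eq_iff)
  then show ?thesis by blast
qed

text \<open>\<open>B(H)\<close>, as the complex-linear elements of the library's type of bounded real-linear maps.\<close>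

typedef (overloaded) 'h bounded_op =
  "{T :: 'h::complex_hilbert_space \<Rightarrow>\<^sub>L 'h. \<forall>c x. blinfun_apply T (c *\<^sub>C x) = c *\<^sub>C blinfun_apply T x}"
  morphisms blinfun_of_op Op
  by (rule exI[of _ 0]) simp

setup_lifting type_definition_bounded_op

lift_definition op_apply :: "'h::complex_hilbert_space bounded_op \<Rightarrow> 'h \<Rightarrow> 'h"
  is blinfun_apply .

lemma op_eqI: "(\<And>x. op_apply S x = op_apply T x) \<Longrightarrow> S = T"
  by transfer (auto intro: blinfun_eqI)

instantiation bounded_op :: (complex_hilbert_space) complex_normed_vector
begin

lift_definition zero_bounded_op :: "'a bounded_op" is 0 by simp
lift_definition plus_bounded_op :: "'a bounded_op \<Rightarrow> 'a bounded_op \<Rightarrow> 'a bounded_op" is "(+)"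
  by (simp add: blinfun.add_left scaleC_add_right)
lift_definition minus_bounded_op :: "'a bounded_op \<Rightarrow> 'a bounded_op \<Rightarrow> 'a bounded_op" is "(-)"
  by (simp add: blinfun.diff_left complex_vector.scale_right_diff_distrib)
lift_definition uminus_bounded_op :: "'a bounded_op \<Rightarrow> 'a bounded_op" is uminus
  by (simp add: blinfun.minus_left)
lift_definition scaleR_bounded_op :: "real \<Rightarrow> 'a bounded_op \<Rightarrow> 'a bounded_op" is scaleR
  by (simp add: blinfun.scaleR_left scaleR_scaleC scaleC_scaleC mult.commute)
lift_definition norm_bounded_op :: "'a bounded_op \<Rightarrow> real" is norm .

lemma bounded_linear_scaleC: "bounded_linear (\<lambda>x::'a. c *\<^sub>C x)"
  by (rule bounded_linear_intro[of _ "cmod c"])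
    (simp_all add: scaleC_add_right scaleR_scaleC scaleC_scaleC norm_scaleC mult.commute)

lift_definition scaleC_bounded_op :: "complex \<Rightarrow> 'a bounded_op \<Rightarrow> 'a bounded_op"
  is "\<lambda>c T. Blinfun (\<lambda>x. c *\<^sub>C blinfun_apply T x)"
  by (simp add: bounded_linear_Blinfun_apply
      bounded_linear_compose[OF bounded_linear_scaleC blinfun.bounded_linear_right]
      scaleC_scaleC mult.commute)

definition dist_bounded_op :: "'a bounded_op \<Rightarrow> 'a bounded_op \<Rightarrow> real" where
  "dist_bounded_op S T = norm (S - T)"
definition sgn_bounded_op :: "'a bounded_op \<Rightarrow> 'a bounded_op" where
  "sgn_bounded_op T = inverse (norm T) *\<^sub>R T"
definition uniformity_bounded_op :: "('a bounded_op \<times> 'a bounded_op) filter" where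
  "uniformity_bounded_op = (INF e\<in>{0<..}. principal {(S, T). dist S T < e})"
definition open_bounded_op :: "'a bounded_op set \<Rightarrow> bool" where
  "open_bounded_op U \<longleftrightarrow> (\<forall>S\<in>U. \<forall>\<^sub>F (S', T) in uniformity. S' = S \<longrightarrow> T \<in> U)"

lemma op_apply_scaleC: "op_apply (c *\<^sub>C T) x = c *\<^sub>C op_apply T x"
  for T :: "'a bounded_op"
  by transfer (simp add: bounded_linear_Blinfun_apply
      bounded_linear_compose[OF bounded_linear_scaleC blinfun.bounded_linear_right])

lemma op_apply_add: "op_apply (S + T) x = op_apply S x + op_apply T x"
  for S T :: "'a bounded_op"
  by transfer (simp add: blinfun.add_left)

lemma op_apply_scaleR: "op_apply (r *\<^sub>R T) x = r *\<^sub>R op_apply T x"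
  for T :: "'a bounded_op"
  by transfer (simp add: blinfun.scaleR_left)

lemma norm_op_apply: "norm (op_apply T x) \<le> norm T * norm x"
  for T :: "'a bounded_op"
  by transfer (rule norm_blinfun)

lemma norm_op_bound: "0 \<le> b \<Longrightarrow> (\<And>x. norm (op_apply T x) \<le> b * norm x) \<Longrightarrow> norm T \<le> b"
  for T :: "'a bounded_op"
  by transfer (rule norm_blinfun_bound)

instance
proof
  fix S T U :: "'a bounded_op" and r s :: real and c d :: complex
  show "S + T + U = S + (T + U)" by transfer (rule add.assoc)
  show "S + T = T + S" by transfer (rule add.commute)
  show "0 + S = S" by transfer simp
  show "- S + S = 0" by transfer simp
  show "S - T = S + - T" by transfer simp
  show "r *\<^sub>R (S + T) = r *\<^sub>R S + r *\<^sub>R T" by transfer (rule scaleR_add_right)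
  show "(r + s) *\<^sub>R S = r *\<^sub>R S + s *\<^sub>R S" by transfer (rule scaleR_add_left)
  show "r *\<^sub>R s *\<^sub>R S = (r * s) *\<^sub>R S" by transfer simp
  show "1 *\<^sub>R S = S" by transfer simp
  show "r *\<^sub>R S = complex_of_real r *\<^sub>C S"
    by (rule op_eqI) (simp add: op_apply_scaleC op_apply_scaleR scaleR_scaleC)
  show "c *\<^sub>C (S + T) = c *\<^sub>C S + c *\<^sub>C T"
    by (rule op_eqI) (simp add: op_apply_scaleC op_apply_add scaleC_add_right)
  show "(c + d) *\<^sub>C S = c *\<^sub>C S + d *\<^sub>C S"
    by (rule op_eqI) (simp add: op_apply_scaleC op_apply_add scaleC_add_left)
  show "c *\<^sub>C d *\<^sub>C S = (c * d) *\<^sub>C S"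
    by (rule op_eqI) (simp add: op_apply_scaleC scaleC_scaleC)
  show "1 *\<^sub>C S = S"
    by (rule op_eqI) (simp add: op_apply_scaleC scaleC_one)
  show "dist S T = norm (S - T)" by (simp add: dist_bounded_op_def)
  show "sgn S = inverse (norm S) *\<^sub>R S" by (simp add: sgn_bounded_op_def)
  show "uniformity = (INF e\<in>{0<..}. principal {(S :: 'a bounded_op, T). dist S T < e})"
    by (simp add: uniformity_bounded_op_def)
  show "open U \<longleftrightarrow> (\<forall>S\<in>U. \<forall>\<^sub>F (S', T) in uniformity. S' = S \<longrightarrow> T \<in> U)"
    for U :: "'a bounded_op set"
    by (simp add: open_bounded_op_def)
  show "norm S = 0 \<longleftrightarrow> S = 0" by transfer simp
  show "norm (S + T) \<le> norm S + norm T" by transfer (rule norm_triangle_ineq)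
  show "norm (r *\<^sub>R S) = \<bar>r\<bar> * norm S" by transfer simp
  have le: "norm (c *\<^sub>C S) \<le> cmod c * norm S" for c and S :: "'a bounded_op"
  proof (rule norm_op_bound)
    show "norm (op_apply (c *\<^sub>C S) x) \<le> cmod c * norm S * norm x" for x
      using mult_left_mono[OF norm_op_apply[of S x], of "cmod c"]
      by (simp add: op_apply_scaleC norm_scaleC mult.assoc)
    show "0 \<le> cmod c * norm S"
      by (intro mult_nonneg_nonneg) (simp_all add: norm_bounded_op.rep_eq)
  qed
  show "norm (c *\<^sub>C S) = cmod c * norm S"
  proof (cases "c = 0")
    case True
    then show ?thesis using le[of 0 S] by (simp add: norm_bounded_op.rep_eq)
  next
    case False
    have "inverse c *\<^sub>C c *\<^sub>C S = S"
      using False by (intro op_eqI) (simp add: op_apply_scaleC scaleC_scaleC scaleC_one)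
    then have "norm S \<le> cmod (inverse c) * norm (c *\<^sub>C S)" using le by metis
    then have "norm S \<le> norm (c *\<^sub>C S) / cmod c"
      by (simp add: norm_inverse divide_inverse mult.commute)
    then have "cmod c * norm S \<le> norm (c *\<^sub>C S)"
      using False by (simp add: pos_le_divide_eq mult.commute)
    then show ?thesis using le by (intro antisym)
  qed
qed

end

lemma op_apply_minus: "op_apply (S - T) x = op_apply S x - op_apply T x"
  by transfer (simp add: blinfun.diff_left)

lemma op_apply_lin:
  "op_apply T (x + y) = op_apply T x + op_apply T y"
  "op_apply T (c *\<^sub>C x) = c *\<^sub>C op_apply T x"
  by (transfer, simp add: blinfun.add_right)+

lemma bounded_linear_op_apply: "bounded_linear (op_apply T)"
  by transfer (rule blinfun.bounded_linear_right)

lemma op_apply_Op: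
  assumes "bounded_linear f" and "\<And>c x. f (c *\<^sub>C x) = c *\<^sub>C f x"
  shows "op_apply (Op (Blinfun f)) = f"
  using assms by (simp add: op_apply.rep_eq Op_inverse bounded_linear_Blinfun_apply)

instance bounded_op :: (complex_hilbert_space) banach
proof
  fix X :: "nat \<Rightarrow> 'a bounded_op"
  assume X: "Cauchy X"
  have dist_eq: "dist (blinfun_of_op S) (blinfun_of_op T) = dist S T" for S T :: "'a bounded_op"
    by (simp add: dist_norm norm_bounded_op.rep_eq minus_bounded_op.rep_eq)
  have "Cauchy (\<lambda>n. blinfun_of_op (X n))"
    using X by (simp add: Cauchy_def dist_eq)
  then obtain L where L: "(\<lambda>n. blinfun_of_op (X n)) \<longlonglongrightarrow> L"
    using Cauchy_convergent convergent_def by blast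
  have lim: "(\<lambda>n. blinfun_of_op (X n) x) \<longlonglongrightarrow> L x" for x
    using L by (intro blinfun.tendsto tendsto_const)
  have "L (c *\<^sub>C x) = c *\<^sub>C L x" for c x
  proof (rule LIMSEQ_unique[OF lim])
    have "(\<lambda>n. c *\<^sub>C blinfun_of_op (X n) x) \<longlonglongrightarrow> c *\<^sub>C L x"
      using bounded_linear.tendsto[OF bounded_linear_scaleC lim] .
    moreover have "blinfun_of_op (X n) (c *\<^sub>C x) = c *\<^sub>C blinfun_of_op (X n) x" for n
      using blinfun_of_op by blast
    ultimately show "(\<lambda>n. blinfun_of_op (X n) (c *\<^sub>C x)) \<longlonglongrightarrow> c *\<^sub>C L x"
      by simp
  qed
  then have "blinfun_of_op (Op L) = L" by (simp add: Op_inverse)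
  then have "X \<longlonglongrightarrow> Op L"
    using L unfolding tendsto_iff by (metis (mono_tags, lifting) dist_eq eventually_mono)
  then show "convergent X" by (auto simp: convergent_def)
qed

text \<open>The adjoint exists by the Riesz representation theorem.\<close>

definition op_adjoint :: "'h::complex_hilbert_space bounded_op \<Rightarrow> 'h bounded_op" where
  "op_adjoint T = (THE S. \<forall>x y. cinner (op_apply S x) y = cinner x (op_apply T y))"

lemma op_adjoint: "cinner (op_apply (op_adjoint T) x) y = cinner x (op_apply T y)"
proof -
  have "\<exists>v. \<forall>y. cinner x (op_apply T y) = cinner v y" for x
  proof (rule riesz)
    show "bounded_linear (\<lambda>y. cinner x (op_apply T y))"
    proof (rule bounded_linear_intro[of _ "norm x * norm T"])
      show "norm (cinner x (op_apply T y)) \<le> norm y * (norm x * norm T)" for y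
        using order_trans[OF cmod_cinner_le mult_left_mono[OF norm_op_apply norm_ge_zero]]
        by (simp add: mult_ac)
    qed (simp_all add: op_apply_lin cinner_add_right scaleR_scaleC cinner_scaleC_right
        scaleR_conv_of_real)
  qed (simp add: op_apply_lin cinner_scaleC_right)
  then obtain s where s: "\<And>x y. cinner x (op_apply T y) = cinner (s x) y" by metis
  have s': "cinner y (s x) = cinner (op_apply T y) x" for x y
    by (metis s cinner_commute)
  have sC: "s (c *\<^sub>C x) = c *\<^sub>C s x" for c x
    by (rule cinner_eqI) (simp add: s' cinner_scaleC_right)
  have "bounded_linear s"
  proof (rule bounded_linear_intro[of _ "norm T"])
    show "s (x + y) = s x + s y" for x y
      by (rule cinner_eqI) (simp add: s' cinner_add_right)
    show "s (r *\<^sub>R x) = r *\<^sub>R s x" for r x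
      by (simp add: scaleR_scaleC sC)
    show "norm (s x) \<le> norm x * norm T" for x
    proof -
      have "norm (s x) * norm (s x) = Re (cinner x (op_apply T (s x)))"
        by (simp add: s flip: norm_power2_cinner power2_eq_square)
      also have "\<dots> \<le> norm x * (norm T * norm (s x))"
        using order_trans[OF Re_cinner_le mult_left_mono[OF norm_op_apply norm_ge_zero]] .
      finally show ?thesis
        by (cases "s x = 0") (simp_all flip: mult.assoc)
    qed
  qed
  then have S: "cinner (op_apply (Op (Blinfun s)) x) y = cinner x (op_apply T y)" for x y
    by (simp add: op_apply_Op sC s)
  have "\<forall>x y. cinner (op_apply (op_adjoint T) x) y = cinner x (op_apply T y)"
    unfolding op_adjoint_def
  proof (rule theI)
    show "\<forall>x y. cinner (op_apply (Op (Blinfun s)) x) y = cinner x (op_apply T y)"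
      using S by blast
    fix R assume R: "\<forall>x y. cinner (op_apply R x) y = cinner x (op_apply T y)"
    show "R = Op (Blinfun s)"
      by (intro op_eqI cinner_eqI) (metis R S cinner_commute)
  qed
  then show ?thesis by blast
qed

lemma op_adjoint_right: "cinner x (op_apply (op_adjoint T) y) = cinner (op_apply T x) y"
  by (metis op_adjoint cinner_commute)

lemma separable_hilbert_space_nonzero: "\<exists>x::'a::separable_hilbert_space. x \<noteq> 0"
proof (rule ccontr)
  assume "\<not> ?thesis"
  then have "\<forall>x::'a. \<exists>c. x = (\<Sum>b\<in>{}. c b *\<^sub>C b)" by simp
  then show False using infinite_dimensional by blast
qed

instantiation bounded_op :: (separable_hilbert_space) cstar_algebra
begin

lift_definition one_bounded_op :: "'a bounded_op" is id_blinfun by simp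
lift_definition times_bounded_op :: "'a bounded_op \<Rightarrow> 'a bounded_op \<Rightarrow> 'a bounded_op"
  is "(o\<^sub>L)" by simp
definition star_bounded_op :: "'a bounded_op \<Rightarrow> 'a bounded_op" where
  "star_bounded_op = op_adjoint"

lemma op_apply_one: "op_apply 1 x = (x::'a)"
  by transfer simp

lemma op_apply_mult: "op_apply (S * T) x = op_apply S (op_apply T x)"
  for S T :: "'a bounded_op"
  by transfer simp

instance
proof
  fix S T U :: "'a bounded_op" and r :: real and c :: complex
  show "S * T * U = S * (T * U)" by (rule op_eqI) (simp add: op_apply_mult)
  show "(S + T) * U = S * U + T * U" by (rule op_eqI) (simp add: op_apply_mult op_apply_add)
  show "S * (T + U) = S * T + S * U"
    by (rule op_eqI) (simp add: op_apply_mult op_apply_add op_apply_lin)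
  show "r *\<^sub>R S * T = r *\<^sub>R (S * T)"
    by (rule op_eqI) (simp add: op_apply_mult op_apply_scaleR)
  show "S * r *\<^sub>R T = r *\<^sub>R (S * T)"
    by (rule op_eqI) (simp add: op_apply_mult op_apply_scaleR linear_simps(5)[OF bounded_linear_op_apply])
  show "1 * S = S" "S * 1 = S" by (rule op_eqI; simp add: op_apply_mult op_apply_one)+
  obtain x :: 'a where "x \<noteq> 0" using separable_hilbert_space_nonzero by blast
  then have "1 \<le> norm (1 :: 'a bounded_op)"
    using norm_op_apply[of "1 :: 'a bounded_op" x] by (simp add: op_apply_one)
  moreover have "norm (1 :: 'a bounded_op) \<le> 1"
    by (rule norm_op_bound) (simp_all add: op_apply_one)
  ultimately show one: "norm (1 :: 'a bounded_op) = 1" by simp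
  then show "(0 :: 'a bounded_op) \<noteq> 1" by (metis norm_zero zero_neq_one)
  show sub: "norm (S * T) \<le> norm S * norm T" for S T :: "'a bounded_op"
    by transfer (rule norm_blinfun_compose)
  show "c *\<^sub>C S * T = c *\<^sub>C (S * T)"
    by (rule op_eqI) (simp add: op_apply_mult op_apply_scaleC)
  show "S * c *\<^sub>C T = c *\<^sub>C (S * T)"
    by (rule op_eqI) (simp add: op_apply_mult op_apply_scaleC op_apply_lin)
  show "star (star S) = S"
    unfolding star_bounded_op_def
    by (intro op_eqI cinner_eqI) (simp add: op_adjoint_right op_adjoint)
  show "star (S + T) = star S + star T"
    unfolding star_bounded_op_def
    by (intro op_eqI cinner_eqI)
      (simp add: op_adjoint_right op_apply_add cinner_add_left cinner_add_right)
  show "star (c *\<^sub>C S) = cnj c *\<^sub>C star S"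
    unfolding star_bounded_op_def
    by (intro op_eqI cinner_eqI)
      (simp add: op_adjoint_right op_apply_scaleC cinner_scaleC_left cinner_scaleC_right)
  show "star (S * T) = star T * star S"
    unfolding star_bounded_op_def
    by (intro op_eqI cinner_eqI) (simp add: op_adjoint_right op_apply_mult)
  have sq: "(norm (op_apply S x))\<^sup>2 \<le> norm (star S * S) * (norm x)\<^sup>2"
    for x and S :: "'a bounded_op"
  proof -
    have "(norm (op_apply S x))\<^sup>2 = Re (cinner x (op_apply (star S * S) x))"
      by (simp add: star_bounded_op_def op_apply_mult op_adjoint_right norm_power2_cinner)
    also have "\<dots> \<le> norm x * (norm (star S * S) * norm x)"
      using order_trans[OF Re_cinner_le mult_left_mono[OF norm_op_apply norm_ge_zero]] .
    finally show ?thesis by (simp add: power2_eq_square mult_ac)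
  qed
  have lower: "(norm S)\<^sup>2 \<le> norm (star S * S)" for S :: "'a bounded_op"
  proof -
    have "norm (op_apply S x) \<le> sqrt (norm (star S * S)) * norm x" for x
      by (rule power2_le_imp_le) (use sq[of S x] in \<open>simp_all add: power_mult_distrib\<close>)
    then have "norm S \<le> sqrt (norm (star S * S))" by (intro norm_op_bound) simp_all
    then show ?thesis using power_mono[of "norm S" _ 2] by fastforce
  qed
  have star_le: "norm S \<le> norm (star S)" for S :: "'a bounded_op"
  proof (cases "S = 0")
    case False
    have "norm S * norm S \<le> norm (star S) * norm S"
      using order_trans[OF lower sub] by (simp add: power2_eq_square)
    then show ?thesis using False by simp
  qed simp
  have "norm (star S) \<le> norm S"
    using star_le[of "star S"] \<open>star (star S) = S\<close> by simp
  then have "norm (star S * S) \<le> (norm S)\<^sup>2"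
    using order_trans[OF sub mult_right_mono[OF _ norm_ge_zero]]
    unfolding power2_eq_square by blast
  then show "norm (star S * S) = (norm S)\<^sup>2" using lower by (intro antisym)
qed

end


section \<open>The space of finite-dimensional operator systems in \<open>B(H)\<close>\<close>

definition weak_operator_topology :: "'h::separable_hilbert_space bounded_op topology" where
  "weak_operator_topology =
     pullback_topology UNIV (\<lambda>T (x, y). cinner x (op_apply T y)) euclidean"

text \<open>The sets below already form a \<open>\<sigma>\<close>-algebra.\<close>

definition borel_bounded_op :: "'h::separable_hilbert_space bounded_op measure" where
  "borel_bounded_op = sigma UNIV
     {A. \<forall>n::nat. A \<inter> cball 0 (real n) \<in>
           sets (borel_of (subtopology weak_operator_topology (cball 0 (real n))))}"

definition OSy_parameters :: "(nat \<Rightarrow> 'h::separable_hilbert_space bounded_op) measure" where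
  "OSy_parameters = restrict_space (PiM UNIV (\<lambda>_. borel_bounded_op))
     {\<gamma>. finite_dimensional (OSy (range \<gamma>))}"

definition OSy_isomorphism_relation ::
  "((nat \<Rightarrow> 'h::separable_hilbert_space bounded_op) \<times> (nat \<Rightarrow> 'h bounded_op)) set" where
  "OSy_isomorphism_relation =
     {(\<gamma>, \<gamma>'). \<gamma> \<in> space OSy_parameters \<and> \<gamma>' \<in> space OSy_parameters \<and>
        completely_order_isomorphic (OSy (range \<gamma>)) (OSy (range \<gamma>'))}"

end

theory Submission
  imports Defs "HOL-Real_Asymp.Real_Asymp"
begin

text \<open>Since \<open>\<parallel>x\<parallel> \<le> 1\<close> if and only if the matrix with rows \<open>1, x\<close> and \<open>x\<^sup>*, 1\<close> is positive, and a self-adjoint \<open>x\<close>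
  is positive if and only if \<open>\<parallel>t - x\<parallel> \<le> t\<close> for some \<open>t\<close>, the complete order isomorphisms are the unital
  *-preserving complete isometries that are onto; they preserve the values of all sentences.

  Conversely, let the sequence \<open>e\<close> in the unit ball of \<open>X\<close> generate \<open>X\<close>. Universal sentences measure how closely the
  norms of finitely many matrices over \<open>\<rat>(\<i>)\<close>-combinations of \<open>1, y\<^sub>i, y\<^sub>i\<^sup>*\<close> can be brought to prescribed values by \<open>y\<close>
  in the unit ball. If these sentences agree on \<open>X\<close> and \<open>Y\<close>, compactness of the unit ball of \<open>Y\<close> yields \<open>y\<close> in \<open>Y\<close> with
  exactly the matrix norms of \<open>e\<close>, hence a complete isometry from \<open>X\<close> into \<open>Y\<close>. There is also one from \<open>Y\<close> into \<open>X\<close>, and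
  both are onto because an isometry of a compact ball into itself is.

  The countably many conditions used in this argument have Borel truth values: matrix norms over \<open>B(H)\<close> are
  suprema over a dense sequence of \<open>H\<close>, and realizability can be tested on rational combinations. So their truth values
  form a complete Borel invariant. The parameter space is standard Borel because balls of \<open>B(H)\<close> are weakly compact.\<close>

section \<open>Positive elements of a unital C*-algebra\<close>

text \<open>The C*-algebras are abstract, and the only analytic input about them is completeness:
  square roots are limits of an iteration, and commuting roots do the work of spectra and functional
  calculus. The criterion norm (t - a) <= t is the pivot because it turns closure of the positive
  elements under sums into the triangle inequality. Matrices over the algebra get the same
  treatment, with convergence taken entry by entry.

  Realizability is an existential statement, yet universal sentences express it, since the infimum
  of a defect is minus the supremum of its negative. It comes in two versions: the quantifier
  domains are closed balls, while only strict inequalities survive the passage to rational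
  combinations on which the Borel computation rests. Hence \<open>realizes_open\<close> and
  \<open>realizes_closed\<close>; the embedding lemma asks only for the implication from the former
  in X to the latter in Y, which both the sentences and the Borel invariant provide.\<close>

lemma star_0 [simp]: "star (0::'a::cstar_algebra) = 0"
  using star_scaleC[of 0 "0::'a"] by simp

lemma star_1 [simp]: "star (1::'a::cstar_algebra) = 1"
  by (metis mult.left_neutral mult.right_neutral star_mult star_star)

lemma star_minus [simp]: "star (- x) = - star (x::'a::cstar_algebra)"
  by (metis add_eq_0_iff star_0 star_add ab_left_minus)

lemma star_diff: "star (x - y) = star x - star (y::'a::cstar_algebra)"
  by (metis diff_conv_add_uminus star_add star_minus)

lemma star_scaleR: "star (r *\<^sub>R x) = r *\<^sub>R star (x::'a::cstar_algebra)"
  by (simp add: scaleR_scaleC star_scaleC)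

lemma star_sum: "star (\<Sum>i\<in>I. f i) = (\<Sum>i\<in>I. star (f i::'a::cstar_algebra))"
  by (induction I rule: infinite_finite_induct) (simp_all add: star_add)

declare star_star [simp]

lemma norm_star [simp]: "norm (star x) = norm (x::'a::cstar_algebra)"
proof -
  have le: "norm x \<le> norm (star x)" for x :: 'a
  proof (cases "x = 0")
    case False
    have "norm x * norm x \<le> norm (star x) * norm x"
      using cstar_identity[of x] norm_mult_ineq[of "star x" x] by (simp add: power2_eq_square)
    then show ?thesis using False by simp
  qed simp
  show ?thesis using le[of x] le[of "star x"] by simp
qed

lemma norm_square_selfadjoint: "star s = s \<Longrightarrow> norm (s * s) = (norm (s::'a::cstar_algebra))\<^sup>2"
  by (metis cstar_identity)

lemma bounded_linear_star: "bounded_linear (star :: 'a::cstar_algebra \<Rightarrow> 'a)"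
  by (rule bounded_linear_intro[of _ 1]) (simp_all add: star_add star_scaleR)

lemma tendsto_star: "(f \<longlongrightarrow> l) F \<Longrightarrow> ((\<lambda>x. star (f x)) \<longlongrightarrow> star (l::'a::cstar_algebra)) F"
  by (rule bounded_linear.tendsto[OF bounded_linear_star])

lemma bounded_linear_scaleC_right: "bounded_linear (\<lambda>x::'a::complex_normed_vector. c *\<^sub>C x)"
  by (rule bounded_linear_intro[of _ "cmod c"])
    (simp_all add: scaleC_add_right scaleR_scaleC scaleC_scaleC norm_scaleC mult.commute)

lemma tendsto_scaleC:
  fixes g :: "'b \<Rightarrow> 'a::complex_normed_vector"
  assumes f: "(f \<longlongrightarrow> c) F" and g: "(g \<longlongrightarrow> l) F"
  shows "((\<lambda>x. f x *\<^sub>C g x) \<longlongrightarrow> c *\<^sub>C l) F"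
proof -
  \<comment> \<open>Splitting the scalar into real and imaginary parts reduces joint continuity to
    that of real scaling and of the bounded linear map given by \<i>.\<close>
  have "f x *\<^sub>C g x = Re (f x) *\<^sub>R g x + Im (f x) *\<^sub>R (\<i> *\<^sub>C g x)" for x
    by (simp add: scaleR_scaleC scaleC_scaleC mult.commute[of _ \<i>] flip: scaleC_add_left complex_eq)
  moreover have "((\<lambda>x. Re (f x) *\<^sub>R g x + Im (f x) *\<^sub>R (\<i> *\<^sub>C g x)) \<longlongrightarrow>
      Re c *\<^sub>R l + Im c *\<^sub>R (\<i> *\<^sub>C l)) F"
    by (intro tendsto_intros f g bounded_linear.tendsto[OF bounded_linear_scaleC_right])
  moreover have "Re c *\<^sub>R l + Im c *\<^sub>R (\<i> *\<^sub>C l) = c *\<^sub>C l"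
    by (simp add: scaleR_scaleC scaleC_scaleC mult.commute[of _ \<i>] flip: scaleC_add_left complex_eq)
  ultimately show ?thesis by simp
qed

text \<open>The iteration \<open>g \<mapsto> (t + g\<^sup>2) / 2\<close> for \<open>1 - (1 - t)\<^sup>1\<^sup>/\<^sup>2\<close> is dominated by the scalar one with
  \<open>t = 1\<close>, which increases to a limit in \<open>[0, 1]\<close>.\<close>

primrec sqrt_iter :: "nat \<Rightarrow> real" where
  "sqrt_iter 0 = 0"
| "sqrt_iter (Suc k) = (1 + (sqrt_iter k)\<^sup>2) / 2"

lemma sqrt_iter_bounds: "0 \<le> sqrt_iter k \<and> sqrt_iter k \<le> 1"
  by (induction k) (auto simp: power_le_one)

lemma sqrt_iter_mono: "sqrt_iter k \<le> sqrt_iter (Suc k)"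
proof (induction k)
  case (Suc k)
  have "(sqrt_iter k)\<^sup>2 \<le> (sqrt_iter (Suc k))\<^sup>2"
    using Suc sqrt_iter_bounds[of k] by (intro power_mono) auto
  then show ?case by simp
qed simp

lemma Cauchy_sqrt_iter: "Cauchy sqrt_iter"
proof (rule convergent_Cauchy, rule Bseq_mono_convergent)
  show "Bseq sqrt_iter" by (rule BseqI'[of _ 1]) (simp add: abs_le_iff, smt (verit) sqrt_iter_bounds)
  show "\<forall>m. \<forall>n\<ge>m. sqrt_iter m \<le> sqrt_iter n" using sqrt_iter_mono lift_Suc_mono_le by blast
qed

text \<open>The increments telescope. Comparison with a scalar sequence gives convergence even at
  \<open>norm t = 1\<close>, where the map \<open>g \<mapsto> (t + g * g) / 2\<close> on the unit
  ball is no strict contraction.\<close>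

lemma Cauchy_dominated:
  fixes g :: "nat \<Rightarrow> 'a::real_normed_vector"
  assumes "Cauchy (s :: nat \<Rightarrow> real)" and step: "\<And>k. norm (g (Suc k) - g k) \<le> s (Suc k) - s k"
  shows "Cauchy g"
proof -
  have le: "norm (g (m + j) - g m) \<le> s (m + j) - s m" for m j
  proof (induction j)
    case (Suc j)
    have "norm (g (m + Suc j) - g m) \<le> norm (g (Suc (m + j)) - g (m + j)) + norm (g (m + j) - g m)"
      using norm_triangle_ineq[of "g (Suc (m + j)) - g (m + j)" "g (m + j) - g m"] by simp
    then show ?case using Suc step[of "m + j"] by simp
  qed simp
  have le': "dist (g m) (g n) \<le> dist (s m) (s n)" for m n
  proof -
    have "m \<le> n \<Longrightarrow> dist (g m) (g n) \<le> dist (s m) (s n)" for m n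
      using le[of m "n - m"] by (simp add: dist_norm norm_minus_commute)
    then show ?thesis using nat_le_linear[of m n] by (metis dist_commute)
  qed
  show ?thesis
    unfolding Cauchy_def using assms(1)[unfolded Cauchy_def] le' by (meson le_less_trans)
qed

text \<open>A fixed point l of the iteration satisfies 2 l = t + l^2, that is (1 - l)^2 = 1 - t.
  Every iterate is a polynomial in t, hence the clause on z; it lets roots of commuting elements
  commute, as functional calculus would.\<close>

lemma sqrt_one_minus:
  fixes t :: "'a::cstar_algebra"
  assumes t: "star t = t" "norm t \<le> 1"
  shows "\<exists>s. star s = s \<and> s * s = 1 - t \<and> norm (1 - s) \<le> 1 \<and> (\<forall>z. z * t = t * z \<longrightarrow> z * s = s * z)"
proof -
  define g where "g = rec_nat 0 (\<lambda>_ h. (1/2::real) *\<^sub>R (t + h * h))"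
  have g0: "g 0 = 0" and gS: "g (Suc k) = (1/2::real) *\<^sub>R (t + g k * g k)" for k
    by (simp_all add: g_def)
  have star_g: "star (g k) = g k" for k
    by (induction k) (simp_all add: g0 gS star_scaleR star_add star_mult t)
  have comm_g: "z * g k = g k * z" if "z * t = t * z" for z k
  proof (induction k)
    case (Suc k)
    have "z * (g k * g k) = g k * g k * z" by (metis Suc mult.assoc)
    then show ?case by (simp add: gS distrib_left distrib_right that)
  qed (simp add: g0)
  have norm_g: "norm (g k) \<le> sqrt_iter k" for k
  proof (induction k)
    case (Suc k)
    have "norm (t + g k * g k) \<le> norm t + norm (g k) * norm (g k)"
      by (meson add_left_mono norm_mult_ineq norm_triangle_ineq order_trans)
    also have "\<dots> \<le> 1 + sqrt_iter k * sqrt_iter k"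
      using t Suc by (intro add_mono mult_mono) (auto simp: sqrt_iter_bounds)
    finally show ?case by (simp add: gS power2_eq_square)
  qed (simp add: g0)
  have step: "norm (g (Suc k) - g k) \<le> sqrt_iter (Suc k) - sqrt_iter k" for k
  proof (induction k)
    case (Suc k)
    let ?a = "g (Suc k)" and ?b = "g k"
    have "g (Suc (Suc k)) - g (Suc k) = (1/2) *\<^sub>R (?a * ?a - ?b * ?b)"
      unfolding gS[of "Suc k"] gS[of k] by (simp add: scaleR_diff_right scaleR_add_right)
    \<comment> \<open>This symmetrised difference of squares holds without commutation, and its norm
      is controlled by the scalar difference of squares.\<close>
    also have "?a * ?a - ?b * ?b = (1/2) *\<^sub>R ((?a - ?b) * (?a + ?b) + (?a + ?b) * (?a - ?b))"
      by (simp add: algebra_simps flip: scaleR_2 scaleR_add_left)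
    finally have eq: "g (Suc (Suc k)) - g (Suc k) = (1/4) *\<^sub>R ((?a - ?b) * (?a + ?b) + (?a + ?b) * (?a - ?b))"
      by simp
    have "norm ((?a - ?b) * (?a + ?b) + (?a + ?b) * (?a - ?b))
        \<le> norm (?a - ?b) * norm (?a + ?b) + norm (?a + ?b) * norm (?a - ?b)"
      by (meson add_mono norm_mult_ineq norm_triangle_ineq order_trans)
    also have "\<dots> = 2 * (norm (?a - ?b) * norm (?a + ?b))" by simp
    also have "\<dots> \<le> 2 * ((sqrt_iter (Suc k) - sqrt_iter k) * (sqrt_iter (Suc k) + sqrt_iter k))"
    proof (intro mult_left_mono mult_mono Suc)
      show "norm (?a + ?b) \<le> sqrt_iter (Suc k) + sqrt_iter k"
        by (meson add_mono norm_g norm_triangle_ineq order_trans)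
      show "0 \<le> sqrt_iter (Suc k) - sqrt_iter k" using sqrt_iter_mono[of k] by (simp only: diff_ge_0_iff_ge)
    qed auto
    also have "\<dots> = 2 * ((sqrt_iter (Suc k))\<^sup>2 - (sqrt_iter k)\<^sup>2)"
      by (simp only: power2_eq_square square_diff_square_factored mult.commute)
    finally have "norm (g (Suc (Suc k)) - g (Suc k)) \<le> (1/4) * (2 * ((sqrt_iter (Suc k))\<^sup>2 - (sqrt_iter k)\<^sup>2))"
      unfolding eq norm_scaleR by (intro mult_mono) (assumption | simp)+
    also have "\<dots> = sqrt_iter (Suc (Suc k)) - sqrt_iter (Suc k)"
      unfolding sqrt_iter.simps(2)[of "Suc k"] sqrt_iter.simps(2)[of k] by (simp add: field_simps)
    finally show ?case .
  qed (use t in \<open>simp add: g0 gS\<close>)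
  have "convergent g"
    by (rule Cauchy_convergent, rule Cauchy_dominated[OF Cauchy_sqrt_iter step])
  then obtain l where l: "g \<longlonglongrightarrow> l" by (auto simp: convergent_def)
  have "(\<lambda>k. g (Suc k)) \<longlonglongrightarrow> (1/2::real) *\<^sub>R (t + l * l)"
    unfolding gS by (intro tendsto_intros l)
  then have "l = (1/2::real) *\<^sub>R (t + l * l)"
    using LIMSEQ_unique LIMSEQ_Suc[OF l] by blast
  then have "l + l = t + l * l" by (metis scaleR_2 scaleR_scaleR scaleR_one mult_1
        nonzero_mult_div_cancel_left times_divide_eq_right zero_neq_numeral)
  then have sq: "(1 - l) * (1 - l) = 1 - t" by (simp add: algebra_simps)
  have star_l: "star l = l"
    using LIMSEQ_unique[OF tendsto_star[OF l]] l by (simp add: star_g)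
  have norm_l: "norm l \<le> 1"
  proof (rule LIMSEQ_le_const2[OF tendsto_norm[OF l]])
    show "\<exists>N. \<forall>n\<ge>N. norm (g n) \<le> 1" using norm_g sqrt_iter_bounds order_trans by blast
  qed
  have "z * (1 - l) = (1 - l) * z" if z: "z * t = t * z" for z
  proof -
    have "(\<lambda>k. z * g k) \<longlonglongrightarrow> z * l"
      by (intro tendsto_intros l)
    moreover have "(\<lambda>k. z * g k) \<longlonglongrightarrow> l * z"
      unfolding comm_g[OF z] by (intro tendsto_intros l)
    ultimately have "z * l = l * z" by (rule LIMSEQ_unique)
    then show ?thesis by (simp add: left_diff_distrib right_diff_distrib)
  qed
  then have "\<forall>z. z * t = t * z \<longrightarrow> z * (1 - l) = (1 - l) * z" by blast
  moreover have "star (1 - l) = 1 - l" "norm (1 - (1 - l)) \<le> 1" using star_l norm_l by (simp_all add: star_diff)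
  ultimately show ?thesis using sq by blast
qed

section \<open>The order on self-adjoint elements\<close>

text \<open>Squares of self-adjoint elements are the workable notion of positivity until
  \<open>cpos_star_mult\<close> shows that every \<open>star x * x\<close> is one.\<close>

definition cpos :: "'a::cstar_algebra \<Rightarrow> bool" where
  "cpos a \<longleftrightarrow> (\<exists>s. star s = s \<and> a = s * s)"

lemma cpos_selfadjoint: "cpos a \<Longrightarrow> star a = a"
  by (auto simp: cpos_def star_mult)

lemma cpos_0 [simp]: "cpos 0"
  unfolding cpos_def by (rule exI[of _ 0]) simp

text \<open>Since r and s commute, u = r + \<i> s satisfies
  \<open>star u * u = r * r + s * s\<close>, which fixes norm u; and r is the real part of
  u.\<close>

lemma norm_le_of_sum_squares:
  fixes r s :: "'a::cstar_algebra"
  assumes "star r = r" "star s = s" "r * s = s * r" "r * r + s * s = t\<^sup>2 *\<^sub>R 1"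
  shows "norm r \<le> \<bar>t\<bar>"
proof -
  define u where "u = r + \<i> *\<^sub>C s"
  have u': "star u = r - \<i> *\<^sub>C s"
    by (simp add: u_def star_add star_scaleC assms)
  have "star u * u = r * r + s * s"
    unfolding u' unfolding u_def
    by (simp add: algebra_simps mult_scaleC_left mult_scaleC_right scaleC_scaleC assms)
  then have "(norm u)\<^sup>2 = t\<^sup>2" by (metis assms(4) cstar_identity norm_scaleR norm_one mult_1_right abs_power2)
  then have "norm u = \<bar>t\<bar>" by (metis abs_norm_cancel power2_eq_iff abs_minus_cancel)
  moreover have "r = (1/2) *\<^sub>R (u + star u)" unfolding u' unfolding u_def by (simp flip: scaleR_2)
  then have "norm r \<le> (1/2) * (norm u + norm (star u))"
    using norm_triangle_ineq[of u "star u"] by simp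
  ultimately show ?thesis by simp
qed

text \<open>\<open>sqrt_one_minus\<close> applied to 1 - a / t and rescaled. The bound on s has the
  form of the hypothesis on a, so s is again positive and a further root can be taken. For t = 0 the
  hypothesis forces a = 0.\<close>

lemma sqrt_exists:
  fixes a :: "'a::cstar_algebra"
  assumes a: "star a = a" "norm (t *\<^sub>R 1 - a) \<le> t"
  shows "\<exists>s. star s = s \<and> s * s = a \<and> norm (sqrt t *\<^sub>R 1 - s) \<le> sqrt t \<and> (\<forall>z. z * a = a * z \<longrightarrow> z * s = s * z)"
proof (cases "t > 0")
  case True
  define b where "b = 1 - (1/t) *\<^sub>R a"
  have "b = (1/t) *\<^sub>R (t *\<^sub>R 1 - a)" using True by (simp add: b_def scaleR_diff_right)
  then have "norm b = (1/t) * norm (t *\<^sub>R 1 - a)" using True by simp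
  then have nb: "norm b \<le> 1" using a(2) True by (simp add: divide_le_eq)
  have sb: "star b = b" by (simp add: b_def star_diff star_scaleR a)
  obtain s where s: "star s = s" "s * s = 1 - b" "norm (1 - s) \<le> 1" "\<And>z. z * b = b * z \<Longrightarrow> z * s = s * z"
    using sqrt_one_minus[OF sb nb] by blast
  define r where "r = sqrt t *\<^sub>R s"
  have "r * r = t *\<^sub>R (s * s)" using True by (simp add: r_def)
  then have "r * r = a" using True by (simp add: s b_def)
  moreover have "norm (sqrt t *\<^sub>R 1 - r) \<le> sqrt t"
  proof -
    have "sqrt t *\<^sub>R 1 - r = sqrt t *\<^sub>R (1 - s)" by (simp add: r_def scaleR_diff_right)
    then have "norm (sqrt t *\<^sub>R 1 - r) = sqrt t * norm (1 - s)" using True by simp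
    then show ?thesis using s(3) True by (simp add: mult_left_le)
  qed
  moreover have "z * r = r * z" if "z * a = a * z" for z
  proof -
    have "z * b = b * z" by (simp add: b_def algebra_simps that)
    then show ?thesis using s(4) by (simp add: r_def)
  qed
  ultimately show ?thesis by (intro exI[of _ r]) (simp add: r_def star_scaleR s)
next
  case False
  then have "t = 0" using a(2) norm_ge_zero[of "t *\<^sub>R 1 - a"] by linarith
  then show ?thesis using a by (intro exI[of _ 0]) auto
qed

lemma cposI: "star a = a \<Longrightarrow> norm (t *\<^sub>R 1 - a) \<le> t \<Longrightarrow> cpos a"
  using sqrt_exists[of a t] unfolding cpos_def by metis

text \<open>Converse of \<open>cposI\<close>. As norm a <= t, the element t - a satisfies the
  hypothesis of \<open>sqrt_exists\<close>; its root r commutes with the root s of a, and r^2 + s^2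
  = t bounds norm r by sqrt t.\<close>

lemma cpos_norm:
  fixes a :: "'a::cstar_algebra"
  assumes "cpos a" "norm a \<le> t"
  shows "norm (t *\<^sub>R 1 - a) \<le> t"
proof -
  obtain s where s: "star s = s" "a = s * s" using assms by (auto simp: cpos_def)
  have t: "t \<ge> 0" using assms(2) norm_ge_zero order_trans by blast
  have "norm (t *\<^sub>R 1 - (t *\<^sub>R 1 - a)) \<le> t" using assms by simp
  moreover have "star (t *\<^sub>R 1 - a) = t *\<^sub>R 1 - a" by (simp add: star_diff star_scaleR s star_mult)
  ultimately obtain r where r: "star r = r" "r * r = t *\<^sub>R 1 - a"
     "\<And>z. z * (t *\<^sub>R 1 - a) = (t *\<^sub>R 1 - a) * z \<Longrightarrow> z * r = r * z"
    using sqrt_exists by metis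
  have "s * (t *\<^sub>R 1 - a) = (t *\<^sub>R 1 - a) * s" by (simp add: s algebra_simps)
  then have "s * r = r * s" by (rule r)
  then have "norm r \<le> \<bar>sqrt t\<bar>"
    using t by (intro norm_le_of_sum_squares[of r s]) (simp_all add: r s)
  then have "(norm r)\<^sup>2 \<le> (sqrt t)\<^sup>2" using t by (intro power_mono) auto
  then show ?thesis using t norm_square_selfadjoint[OF r(1)] r(2) by simp
qed

lemma cpos_scaleR: "cpos a \<Longrightarrow> r \<ge> 0 \<Longrightarrow> cpos (r *\<^sub>R a)"
  unfolding cpos_def
  by (elim exE) (rule_tac x = "sqrt r *\<^sub>R s" in exI, simp add: star_scaleR)

text \<open>A sum of squares is hard to recognise as a square; through the norm criterion the claim
  becomes the triangle inequality.\<close>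

lemma cpos_add:
  fixes a b :: "'a::cstar_algebra"
  assumes "cpos a" "cpos b"
  shows "cpos (a + b)"
proof (rule cposI)
  show "star (a + b) = a + b" using assms by (simp add: star_add cpos_selfadjoint)
  have "(norm a + norm b) *\<^sub>R 1 - (a + b) = (norm a *\<^sub>R 1 - a) + (norm b *\<^sub>R 1 - b)"
    by (simp add: algebra_simps)
  then show "norm ((norm a + norm b) *\<^sub>R 1 - (a + b)) \<le> norm a + norm b"
    using norm_triangle_ineq[of "norm a *\<^sub>R 1 - a" "norm b *\<^sub>R 1 - b"]
      cpos_norm[OF assms(1) order_refl] cpos_norm[OF assms(2) order_refl] by (simp only:)
qed

text \<open>Commuting roots of a and - a have squares that sum to 0, the case t = 0 of
  \<open>norm_le_of_sum_squares\<close>.\<close>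

lemma cpos_antisym:
  fixes a :: "'a::cstar_algebra"
  assumes "cpos a" "cpos (- a)"
  shows "a = 0"
proof -
  obtain s where s: "star s = s" "a = s * s" using assms by (auto simp: cpos_def)
  have "norm (norm (- a) *\<^sub>R 1 - (- a)) \<le> norm (- a)" using cpos_norm[OF assms(2)] by blast
  then obtain r where r: "star r = r" "r * r = - a" "\<And>z. z * (- a) = (- a) * z \<Longrightarrow> z * r = r * z"
    using sqrt_exists[of "- a"] cpos_selfadjoint[OF assms(2)] by metis
  have "s * r = r * s" by (rule r) (simp add: s mult.assoc)
  then have "norm s \<le> \<bar>0\<bar>" by (intro norm_le_of_sum_squares[of s r]) (simp_all add: r s)
  then show ?thesis by (simp add: s)
qed

lemma cpos_norm_le:
  fixes a :: "'a::cstar_algebra"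
  assumes a: "cpos a" and b: "cpos (t *\<^sub>R 1 - a)" and t: "t \<ge> 0"
  shows "norm a \<le> t"
proof -
  obtain w where w: "star w = w" "w * w = t *\<^sub>R 1 - a" "\<And>z. z * (t *\<^sub>R 1 - a) = (t *\<^sub>R 1 - a) * z \<Longrightarrow> z * w = w * z"
    using sqrt_exists[OF cpos_selfadjoint[OF b] cpos_norm[OF b order_refl]] by metis
  obtain s where s: "star s = s" "a = s * s" using a by (auto simp: cpos_def)
  have "s * w = w * s" by (rule w) (simp add: s algebra_simps)
  then have "norm s \<le> \<bar>sqrt t\<bar>" using t by (intro norm_le_of_sum_squares[of s w]) (simp_all add: w s)
  then have "(norm s)\<^sup>2 \<le> (sqrt t)\<^sup>2" using t by (intro power_mono) auto
  then show ?thesis using norm_square_selfadjoint[OF s(1)] s(2) t by simp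
qed

lemma cpos_norm_diff: "cpos a \<Longrightarrow> norm a \<le> t \<Longrightarrow> cpos (t *\<^sub>R 1 - a)"
  by (rule cposI[of _ t]) (auto simp: star_diff star_scaleR cpos_selfadjoint)

lemma cpos_norm_mono:
  fixes a b :: "'a::cstar_algebra"
  assumes "cpos a" "cpos (b - a)"
  shows "norm a \<le> norm b"
proof (rule cpos_norm_le[OF assms(1)])
  have "cpos b" using cpos_add[OF assms] by simp
  then have "cpos (norm b *\<^sub>R 1 - b)" using cpos_norm_diff by blast
  then show "cpos (norm b *\<^sub>R 1 - a)" using cpos_add[OF _ assms(2)] by fastforce
qed simp

section \<open>Positivity of star x * x and the Cauchy-Schwarz inequality\<close>

lemma power_two_power_norm:
  fixes a :: "'a::cstar_algebra"
  assumes "star a = a"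
  shows "star (a ^ 2 ^ k) = a ^ 2 ^ k \<and> norm (a ^ 2 ^ k) = norm a ^ 2 ^ k"
proof (induction k)
  case (Suc k)
  have "a ^ 2 ^ Suc k = a ^ 2 ^ k * a ^ 2 ^ k" by (simp add: power_add mult_2)
  moreover have "norm a ^ 2 ^ Suc k = (norm a ^ 2 ^ k)\<^sup>2" by (simp flip: power_mult add: mult.commute)
  ultimately show ?case using Suc norm_square_selfadjoint[of "a ^ 2 ^ k"] by (simp only: star_mult)
qed (use assms in simp)

text \<open>Passing from \<open>y\<^sup>* y\<close> to \<open>y y\<^sup>*\<close> without spectra: for self-adjoint elements the norm is read off
  from high powers, and \<open>(t + y y\<^sup>*)\<^sup>m - t\<^sup>m = y q(y\<^sup>* y) y\<^sup>*\<close> with \<open>q(z) = \<Sum>\<^sub>i (t + z)\<^sup>i t\<^sup>m\<^sup>-\<^sup>1\<^sup>-\<^sup>i\<close>.\<close>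

lemma cpos_swap:
  fixes y :: "'a::cstar_algebra"
  assumes "cpos (- (star y * y))"
  shows "cpos (- (y * star y))"
proof -
  define t where "t = (norm y)\<^sup>2"
  define p where "p = t *\<^sub>R 1 + star y * y"
  define q where "q = t *\<^sub>R 1 + y * star y"
  have t0: "t \<ge> 0" by (simp add: t_def)
  have np: "norm p \<le> t" using cpos_norm[OF assms, of t] by (simp add: p_def cstar_identity t_def)
  have yq: "q * y = y * p" by (simp add: p_def q_def algebra_simps)
  have pw: "norm (q ^ m) \<le> t ^ m * (real m + 1)" for m
  proof -
    have ypw: "q ^ m * y = y * p ^ m" for m
      by (induction m) (simp_all add: mult.assoc, metis mult.assoc yq)
    have "norm (q ^ m) \<le> t ^ m + real m * t ^ m" for m
    proof (induction m)
      case (Suc m)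
      \<comment> \<open>Here q^m y = y p^m moves the powers over to p, whose norm is at most t. Each
        step therefore adds at most norm y * t^m * norm y = t^(m+1), and the factor in front of t^m
        grows only linearly.\<close>
      have "q ^ Suc m = t *\<^sub>R q ^ m + y * p ^ m * star y"
        by (simp add: power_Suc2 q_def distrib_left flip: mult.assoc ypw del: power_Suc)
      moreover have "norm (y * p ^ m * star y) \<le> norm y * t ^ m * norm y"
      proof -
        have "norm (p ^ m) \<le> t ^ m" using norm_power_ineq[of p m] np power_mono[OF np] by (meson norm_ge_zero order_trans)
        then have "norm (y * p ^ m) \<le> norm y * t ^ m"
          by (meson mult_left_mono norm_ge_zero norm_mult_ineq order_trans)
        then show ?thesis using norm_mult_ineq[of "y * p ^ m" "star y"] mult_right_mono[of "norm (y * p ^ m)" "norm y * t ^ m" "norm y"]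
          by simp
      qed
      moreover have "norm (t *\<^sub>R q ^ m) \<le> t * (t ^ m + real m * t ^ m)" using Suc t0 by (simp add: mult_left_mono)
      ultimately have "norm (q ^ Suc m) \<le> t * (t ^ m + real m * t ^ m) + norm y * t ^ m * norm y"
        using norm_triangle_ineq[of "t *\<^sub>R q ^ m" "y * p ^ m * star y"] by (simp only:)
      also have "\<dots> = t ^ Suc m + real (Suc m) * t ^ Suc m"
        by (simp add: t_def power2_eq_square algebra_simps)
      finally show ?case .
    qed simp
    then show ?thesis by (simp add: algebra_simps)
  qed
  have sq: "star q = q" by (simp add: q_def star_add star_scaleR star_mult)
  have "norm q \<le> t"
  proof (rule ccontr)
    assume "\<not> norm q \<le> t"
    then have qt: "norm q > t" by simp
    have "t > 0"
    proof (rule ccontr)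
      assume "\<not> t > 0"
      then have "t = 0" using t0 by simp
      moreover from this have "y = 0" by (simp add: t_def)
      ultimately show False using qt by (simp add: q_def)
    qed
    \<comment> \<open>For m = 2^k the norm of q^m is exactly norm q ^ m, so r > 1 would give r^m <=
      m + 1 for all these m, against exponential growth.\<close>
    define r where "r = norm q / t"
    have r1: "r > 1" using qt \<open>t > 0\<close> by (simp add: r_def)
    have bd: "r ^ 2 ^ k \<le> real (2 ^ k) + 1" for k
    proof -
      have "norm q ^ 2 ^ k \<le> t ^ 2 ^ k * (real (2 ^ k) + 1)"
        using pw[of "2 ^ k"] power_two_power_norm[OF sq, of k] by simp
      then show ?thesis using \<open>t > 0\<close> by (simp add: r_def power_divide field_simps)
    qed
    have "((\<lambda>m. (real m + 1) / r ^ m) \<longlongrightarrow> 0) sequentially"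
      using r1 by real_asymp
    then have "eventually (\<lambda>m. (real m + 1) / r ^ m < 1) sequentially"
      by (rule order_tendstoD) simp
    then obtain N where N: "\<And>m. m \<ge> N \<Longrightarrow> (real m + 1) / r ^ m < 1" by (auto simp: eventually_sequentially)
    have "2 ^ N \<ge> N" by (simp add: less_exp less_imp_le)
    then show False using N[of "2 ^ N"] bd[of N] r1 by (simp add: divide_less_eq)
  qed
  then show ?thesis by (intro cposI[of _ t]) (simp_all add: star_mult q_def)
qed

text \<open>Kaplansky's argument. With \<open>c = \<bar>a\<bar>\<close> and \<open>n = c - a\<close> for \<open>a = x\<^sup>* x\<close>, the element \<open>y = x n\<close> has
  \<open>y\<^sup>* y = - n c n \<le> 0\<close>, which forces \<open>y = 0\<close> and hence \<open>a = c\<close>.\<close>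

lemma cpos_star_mult: "cpos (star x * (x::'a::cstar_algebra))"
proof -
  define a where "a = star x * x"
  have sa: "star a = a" by (simp add: a_def star_mult)
  have "cpos (a * a)" using sa by (auto simp: cpos_def)
  define t where "t = norm (a * a)"
  have sa2: "star (a * a) = a * a" by (simp add: sa star_mult)
  have "norm (t *\<^sub>R 1 - a * a) \<le> t" using cpos_norm[OF \<open>cpos (a * a)\<close>] by (simp add: t_def)
  then obtain c where c: "star c = c" "c * c = a * a" "norm (sqrt t *\<^sub>R 1 - c) \<le> sqrt t"
       "\<And>z. z * (a * a) = (a * a) * z \<Longrightarrow> z * c = c * z"
    using sqrt_exists[OF sa2] by blast
  have ac: "a * c = c * a" by (rule c) (simp add: mult.assoc)
  obtain d where d: "star d = d" "d * d = c" "\<And>z. z * c = c * z \<Longrightarrow> z * d = d * z"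
    using sqrt_exists[OF c(1) c(3)] by blast
  define n where "n = c - a"
  have sn: "star n = n" by (simp add: n_def star_diff c sa)
  have an: "a * n = - (c * n)"
    by (simp add: n_def algebra_simps ac c)
  have nc: "n * c = c * n" by (simp add: n_def algebra_simps ac)
  have nd: "n * d = d * n" by (rule d(3)[OF nc])
  define y where "y = x * n"
  have yy: "star y * y = - (n * c * n)"
  proof -
    have "star y * y = n * (a * n)" by (simp add: y_def star_mult sn a_def mult.assoc)
    then show ?thesis by (simp add: an mult.assoc)
  qed
  have "n * c * n = (n * d) * (n * d)" using nd d(2) by (metis mult.assoc)
  moreover have "star (n * d) = n * d" by (simp add: star_mult sn d nd)
  ultimately have neg: "cpos (- (star y * y))" unfolding yy cpos_def by auto
  \<comment> \<open>With b and e the real and imaginary parts of y, 2 (b^2 + e^2) is the sum of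
    \<open>star y * y\<close> and \<open>y * star y\<close>. Since the negative of the latter is
    positive by \<open>cpos_swap\<close>, the former is positive together with its negative, hence
    0.\<close>
  define b where "b = (1/2::real) *\<^sub>R (y + star y)"
  define e where "e = (1/2::real) *\<^sub>R (\<i> *\<^sub>C (star y - y))"
  have sb: "star b = b" by (simp add: b_def star_scaleR star_add add.commute)
  have se: "star e = e" by (simp add: e_def star_scaleR star_scaleC star_diff complex_vector.scale_right_diff_distrib)
  have ii: "\<i> *\<^sub>C u * \<i> *\<^sub>C v = - (u * v)" for u v :: 'a
    by (simp add: mult_scaleC_left mult_scaleC_right scaleC_scaleC)
  have "b * b + e * e = (1/4) *\<^sub>R ((y + star y) * (y + star y) - (star y - y) * (star y - y))"
    by (simp add: b_def e_def ii scaleR_diff_right)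
  also have "(y + star y) * (y + star y) - (star y - y) * (star y - y) = 2 *\<^sub>R (star y * y + y * star y)"
    by (simp add: algebra_simps scaleR_2)
  finally have "2 *\<^sub>R (b * b + e * e) = star y * y + y * star y" by simp
  then have "star y * y = 2 *\<^sub>R (b * b + e * e) + - (y * star y)" by simp
  moreover have "cpos (b * b)" "cpos (e * e)" using sb se unfolding cpos_def by auto
  ultimately have "cpos (star y * y)"
    by (simp only:) (intro cpos_add cpos_scaleR cpos_swap neg; simp)
  then have "star y * y = 0" using neg by (rule cpos_antisym)
  then have "y = 0" using cstar_identity[of y] by simp
  then have "a * n = 0" by (simp add: y_def a_def mult.assoc)
  moreover from this have "c * n = 0" using an by simp
  ultimately have "n * n = 0" by (simp add: n_def left_diff_distrib)
  then have "n = 0" using norm_square_selfadjoint[OF sn] by simp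
  then have "a = c" by (simp add: n_def)
  then show ?thesis using cposI[OF c(1) c(3)] by (simp add: a_def)
qed

lemma cpos_conj: "cpos a \<Longrightarrow> cpos (star x * a * (x::'a::cstar_algebra))"
proof -
  assume "cpos a"
  then obtain s where s: "star s = s" "a = s * s" by (auto simp: cpos_def)
  have "star x * a * x = star (s * x) * (s * x)" by (simp add: star_mult s mult.assoc)
  then show ?thesis using cpos_star_mult by metis
qed

lemma cpos_sum: "(\<And>i. i \<in> I \<Longrightarrow> cpos (f i)) \<Longrightarrow> cpos (\<Sum>i\<in>I. f i)"
  by (induction I rule: infinite_finite_induct) (auto intro: cpos_add)

text \<open>The Cauchy--Schwarz inequality for an algebra-valued inner product, with \<open>\<alpha> = \<langle>x, x\<rangle>\<close>,
  \<open>\<beta> = \<langle>x, y\<rangle>\<close> and \<open>\<gamma> = \<langle>y, y\<rangle>\<close>; the second hypothesis is \<open>\<langle>x z - y, x z - y\<rangle> \<ge> 0\<close>.\<close>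

lemma cstar_Cauchy_Schwarz:
  fixes \<alpha> \<beta> \<gamma> :: "'a::cstar_algebra"
  assumes a: "cpos \<alpha>" and pos: "\<And>z. cpos (star z * \<alpha> * z - star z * \<beta> - star \<beta> * z + \<gamma>)"
  shows "(norm \<beta>)\<^sup>2 \<le> norm \<alpha> * norm \<gamma>"
proof -
  \<comment> \<open>The element \<alpha> need not be invertible, so it is replaced by a scalar bound
    K > 0. Then z = \<beta> / K minimises the resulting quadratic expression, and K tends to norm
    \<alpha> at the end.\<close>
  have K: "(norm \<beta>)\<^sup>2 \<le> K * norm \<gamma>" if K: "K > 0" "norm \<alpha> \<le> K" for K
  proof -
    define z where "z = (1/K) *\<^sub>R \<beta>"
    have "cpos (star z * (K *\<^sub>R 1 - \<alpha>) * z)" by (intro cpos_conj cpos_norm_diff a K)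
    then have "cpos (star z * (K *\<^sub>R 1 - \<alpha>) * z + (star z * \<alpha> * z - star z * \<beta> - star \<beta> * z + \<gamma>))"
      by (rule cpos_add) (rule pos)
    also have "star z * (K *\<^sub>R 1 - \<alpha>) * z + (star z * \<alpha> * z - star z * \<beta> - star \<beta> * z + \<gamma>)
       = K *\<^sub>R (star z * z) - star z * \<beta> - star \<beta> * z + \<gamma>" by (simp add: algebra_simps)
    also have "\<dots> = \<gamma> - (1/K) *\<^sub>R (star \<beta> * \<beta>)"
      using K by (simp add: z_def star_scaleR)
    finally have "norm ((1/K) *\<^sub>R (star \<beta> * \<beta>)) \<le> norm \<gamma>"
      using K by (intro cpos_norm_mono cpos_scaleR cpos_star_mult) auto
    then show ?thesis using K by (simp add: cstar_identity field_simps)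
  qed
  have "(\<lambda>k. (norm \<alpha> + inverse (real (Suc k))) * norm \<gamma>) \<longlonglongrightarrow> (norm \<alpha> + 0) * norm \<gamma>"
    by (intro tendsto_intros LIMSEQ_inverse_real_of_nat)
  then have "(norm \<beta>)\<^sup>2 \<le> (norm \<alpha> + 0) * norm \<gamma>"
    by (rule LIMSEQ_le_const) (intro exI[of _ 0] allI impI K; simp add: add_nonneg_pos)
  then show ?thesis by simp
qed

section \<open>The Hilbert module of columns and the C*-norm of matrices\<close>

definition cip :: "'a::cstar_algebra Matrix.vec \<Rightarrow> 'a Matrix.vec \<Rightarrow> 'a" where
  "cip x y = (\<Sum>i<dim_vec x. star (vec_index x i) * vec_index y i)"

lemma column_norm_cip: "column_norm x = sqrt (norm (cip x x))"
  by (simp add: column_norm_def cip_def)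

lemma column_norm_power2: "(column_norm x)\<^sup>2 = norm (cip x x)"
  by (simp add: column_norm_cip)

lemma column_norm_nonneg [simp]: "0 \<le> column_norm x"
  by (simp add: column_norm_def)

lemma star_cip: "dim_vec x = dim_vec y \<Longrightarrow> star (cip x y) = cip y x"
  by (simp add: cip_def star_sum star_mult)

lemma cpos_cip: "cpos (cip x x)"
  unfolding cip_def by (intro cpos_sum cpos_star_mult)

lemma cip_add_left: "x \<in> carrier_vec n \<Longrightarrow> y \<in> carrier_vec n \<Longrightarrow> cip (x + y) z = cip x z + cip y z"
  by (auto simp: cip_def star_add distrib_right sum.distrib intro!: sum.cong)

lemma cip_add_right: "x \<in> carrier_vec n \<Longrightarrow> y \<in> carrier_vec n \<Longrightarrow> z \<in> carrier_vec n \<Longrightarrow>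
    cip x (y + z) = cip x y + cip x z"
  by (auto simp: cip_def distrib_left sum.distrib intro!: sum.cong)

lemma cip_diff_right: "x \<in> carrier_vec n \<Longrightarrow> y \<in> carrier_vec n \<Longrightarrow> z \<in> carrier_vec n \<Longrightarrow>
    cip x (y - z) = cip x y - cip x z"
  by (auto simp: cip_def right_diff_distrib sum_subtractf intro!: sum.cong)

lemma norm_cip_le:
  assumes x: "x \<in> carrier_vec n" and y: "y \<in> carrier_vec n"
  shows "norm (cip x y) \<le> column_norm x * column_norm y"
proof (rule power2_le_imp_le)
  have "(norm (cip x y))\<^sup>2 \<le> norm (cip x x) * norm (cip y y)"
  proof (rule cstar_Cauchy_Schwarz[OF cpos_cip])
    fix z
    have "star z * cip x x * z - star z * cip x y - star (cip x y) * z + cip y y =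
       (\<Sum>i<n. star (vec_index x i * z - vec_index y i) * (vec_index x i * z - vec_index y i))"
      using x y by (simp add: star_cip)
        (simp add: cip_def sum_distrib_left sum_distrib_right star_diff star_mult
          left_diff_distrib right_diff_distrib sum_subtractf sum.distrib mult.assoc)
    also have "cpos \<dots>" by (intro cpos_sum cpos_star_mult)
    finally show "cpos (star z * cip x x * z - star z * cip x y - star (cip x y) * z + cip y y)" .
  qed
  then show "(norm (cip x y))\<^sup>2 \<le> (column_norm x * column_norm y)\<^sup>2"
    by (simp add: power_mult_distrib column_norm_power2)
qed simp

lemma column_norm_triangle:
  assumes x: "x \<in> carrier_vec n" and y: "y \<in> carrier_vec n"
  shows "column_norm (x + y) \<le> column_norm x + column_norm y"
proof (rule power2_le_imp_le)
  have "cip (x + y) (x + y) = cip x x + cip x y + (cip y x + cip y y)"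
    using x y by (simp add: cip_add_left[OF x y] cip_add_right[OF x x y] cip_add_right[OF y x y])
  then have "(column_norm (x + y))\<^sup>2 \<le> (norm (cip x x) + norm (cip x y)) + (norm (cip y x) + norm (cip y y))"
    unfolding column_norm_power2
    using norm_triangle_ineq[of "cip x x + cip x y" "cip y x + cip y y"]
      norm_triangle_ineq[of "cip x x" "cip x y"] norm_triangle_ineq[of "cip y x" "cip y y"] by (simp only:)
  also have "\<dots> \<le> ((column_norm x)\<^sup>2 + column_norm x * column_norm y) + (column_norm y * column_norm x + (column_norm y)\<^sup>2)"
    by (intro add_mono norm_cip_le[OF x y] norm_cip_le[OF y x]) (simp_all add: column_norm_power2)
  also have "\<dots> = (column_norm x + column_norm y)\<^sup>2"
    by (simp add: power2_eq_square algebra_simps)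
  finally show "(column_norm (x + y))\<^sup>2 \<le> (column_norm x + column_norm y)\<^sup>2" .
qed simp

lemma column_norm_entry:
  assumes "i < dim_vec x"
  shows "norm (vec_index x i) \<le> column_norm x"
proof (rule power2_le_imp_le)
  have "cip x x - star (vec_index x i) * vec_index x i
      = (\<Sum>j\<in>{..<dim_vec x} - {i}. star (vec_index x j) * vec_index x j)"
    using assms by (simp add: cip_def sum.remove)
  also have "cpos \<dots>" by (intro cpos_sum cpos_star_mult)
  finally show "(norm (vec_index x i))\<^sup>2 \<le> (column_norm x)\<^sup>2"
    unfolding column_norm_power2 cstar_identity[symmetric] by (intro cpos_norm_mono cpos_star_mult)
qed simp

lemma column_norm_le_sum: "column_norm x \<le> (\<Sum>i<dim_vec x. norm (vec_index x i))"
proof -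
  have "norm (cip x x) \<le> (\<Sum>i<dim_vec x. (norm (vec_index x i))\<^sup>2)"
    unfolding cip_def cstar_identity[symmetric] by (rule norm_sum)
  then have "column_norm x \<le> L2_set (\<lambda>i. norm (vec_index x i)) {..<dim_vec x}"
    by (simp add: column_norm_cip L2_set_def)
  also have "\<dots> \<le> (\<Sum>i<dim_vec x. norm (vec_index x i))" by (rule L2_set_le_sum) simp
  finally show ?thesis .
qed

lemma column_norm_scaleC: "column_norm (map_vec (scaleC c) x) = cmod c * column_norm x"
proof -
  have "cip (map_vec (scaleC c) x) (map_vec (scaleC c) x) = (cnj c * c) *\<^sub>C cip x x"
    by (simp add: cip_def star_scaleC mult_scaleC_left mult_scaleC_right scaleC_scaleC complex_vector.scale_sum_right mult.commute)
  then have "norm (cip (map_vec (scaleC c) x) (map_vec (scaleC c) x)) = (cmod c)\<^sup>2 * norm (cip x x)"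
    by (simp add: norm_scaleC norm_mult power2_eq_square)
  then show ?thesis by (simp add: column_norm_cip real_sqrt_mult)
qed

lemma column_norm_zero [simp]: "column_norm (0\<^sub>v n) = 0"
  by (simp add: column_norm_cip cip_def)

section \<open>Matrices acting on columns\<close>

lemma mult_mat_vec_in_carrier: "a \<in> carrier_mat m n \<Longrightarrow> a *\<^sub>v x \<in> carrier_vec m"
  by (rule carrier_vecI) simp

lemma index_mult_mat_vec_sum:
  "a \<in> carrier_mat m n \<Longrightarrow> x \<in> carrier_vec n \<Longrightarrow> i < m \<Longrightarrow>
    vec_index (a *\<^sub>v x) i = (\<Sum>j<n. a $$ (i, j) * vec_index x j)"
  by (auto simp: scalar_prod_def lessThan_atLeast0)

lemma index_mult_mat_sum:
  "a \<in> carrier_mat m n \<Longrightarrow> b \<in> carrier_mat n k \<Longrightarrow> i < m \<Longrightarrow> j < k \<Longrightarrow>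
    (a * b) $$ (i, j) = (\<Sum>l<n. a $$ (i, l) * b $$ (l, j))"
  by (auto simp: scalar_prod_def lessThan_atLeast0)

lemma mat_star_carrier [simp]: "a \<in> carrier_mat m n \<Longrightarrow> mat_star a \<in> carrier_mat n m"
  by (auto simp: mat_star_def)

lemma mat_star_dim [simp]: "dim_row (mat_star a) = dim_col a" "dim_col (mat_star a) = dim_row a"
  by (auto simp: mat_star_def)

lemma mat_star_index: "a \<in> carrier_mat m n \<Longrightarrow> i < n \<Longrightarrow> j < m \<Longrightarrow> mat_star a $$ (i, j) = star (a $$ (j, i))"
  by (auto simp: mat_star_def)

lemma mat_star_star [simp]: "mat_star (mat_star a) = a"
  by (rule eq_matI) (auto simp: mat_star_def)

lemma mat_star_one [simp]: "mat_star (1\<^sub>m n) = 1\<^sub>m n"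
  by (rule eq_matI) (auto simp: mat_star_def)

lemma mat_star_zero [simp]: "mat_star (0\<^sub>m m n) = 0\<^sub>m n m"
  by (rule eq_matI) (auto simp: mat_star_def)

lemma mat_star_add: "a \<in> carrier_mat m n \<Longrightarrow> b \<in> carrier_mat m n \<Longrightarrow> mat_star (a + b) = mat_star a + mat_star b"
  by (rule eq_matI) (auto simp: mat_star_def star_add)

lemma mat_star_diff: "a \<in> carrier_mat m n \<Longrightarrow> b \<in> carrier_mat m n \<Longrightarrow> mat_star (a - b) = mat_star a - mat_star b"
  by (rule eq_matI) (auto simp: mat_star_def star_diff)

lemma mat_star_mult:
  assumes a: "a \<in> carrier_mat m n" and b: "b \<in> carrier_mat n k"
  shows "mat_star (a * b) = mat_star b * mat_star a"
proof (rule eq_matI)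
  fix i j assume "i < dim_row (mat_star b * mat_star a)" "j < dim_col (mat_star b * mat_star a)"
  then have ij: "i < k" "j < m" using a b by auto
  then show "mat_star (a * b) $$ (i, j) = (mat_star b * mat_star a) $$ (i, j)"
    using mat_star_index[OF mult_carrier_mat[OF a b] ij]
    by (simp add: index_mult_mat_sum[OF a b] index_mult_mat_sum[OF mat_star_carrier[OF b] mat_star_carrier[OF a]]
        star_sum star_mult mat_star_index[OF a] mat_star_index[OF b])
qed (use a b in auto)

lemma mat_scaleC_carrier [simp]: "mat_scaleC c a \<in> carrier_mat m n \<longleftrightarrow> a \<in> carrier_mat m n"
  by (simp add: mat_scaleC_def)

lemma mat_scaleC_dim [simp]: "dim_row (mat_scaleC c a) = dim_row a" "dim_col (mat_scaleC c a) = dim_col a"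
  by (auto simp: mat_scaleC_def)

lemma mat_scaleC_index [simp]: "i < dim_row a \<Longrightarrow> j < dim_col a \<Longrightarrow> mat_scaleC c a $$ (i, j) = c *\<^sub>C a $$ (i, j)"
  by (auto simp: mat_scaleC_def)

lemma mat_star_scaleC: "mat_star (mat_scaleC c a) = mat_scaleC (cnj c) (mat_star a)"
  by (rule eq_matI) (auto simp: mat_star_def star_scaleC)

lemma mat_scaleC_scaleC: "mat_scaleC c (mat_scaleC d a) = mat_scaleC (c * d) a"
  by (rule eq_matI) (auto simp: scaleC_scaleC)

lemma mat_scaleC_one [simp]: "mat_scaleC 1 a = a"
  by (rule eq_matI) (auto simp: scaleC_one)

lemma mat_scaleC_mult_left:
  assumes a: "a \<in> carrier_mat m n" and b: "b \<in> carrier_mat n k"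
  shows "mat_scaleC c a * b = mat_scaleC c (a * b)"
proof (rule eq_matI)
  fix i j assume "i < dim_row (mat_scaleC c (a * b))" "j < dim_col (mat_scaleC c (a * b))"
  then have ij: "i < m" "j < k" using a b by auto
  have ca: "mat_scaleC c a \<in> carrier_mat m n" using a by simp
  show "(mat_scaleC c a * b) $$ (i, j) = mat_scaleC c (a * b) $$ (i, j)"
    using a b ij by (subst index_mult_mat_sum[OF ca b ij])
      (simp add: index_mult_mat_sum[OF a b ij] mult_scaleC_left complex_vector.scale_sum_right del: index_mult_mat(1))
qed (use a b in auto)

lemma mat_scaleC_mult_right:
  assumes a: "a \<in> carrier_mat m n" and b: "b \<in> carrier_mat n k"
  shows "a * mat_scaleC c b = mat_scaleC c (a * b)"
proof (rule eq_matI)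
  fix i j assume "i < dim_row (mat_scaleC c (a * b))" "j < dim_col (mat_scaleC c (a * b))"
  then have ij: "i < m" "j < k" using a b by auto
  have cb: "mat_scaleC c b \<in> carrier_mat n k" using b by simp
  show "(a * mat_scaleC c b) $$ (i, j) = mat_scaleC c (a * b) $$ (i, j)"
    using a b ij by (subst index_mult_mat_sum[OF a cb ij])
      (simp add: index_mult_mat_sum[OF a b ij] mult_scaleC_right complex_vector.scale_sum_right del: index_mult_mat(1))
qed (use a b in auto)

lemma mat_scaleC_mult_vec:
  assumes a: "a \<in> carrier_mat m n" and x: "x \<in> carrier_vec n"
  shows "mat_scaleC c a *\<^sub>v x = map_vec (scaleC c) (a *\<^sub>v x)"
    "a *\<^sub>v map_vec (scaleC c) x = map_vec (scaleC c) (a *\<^sub>v x)"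
proof -
  have ca: "mat_scaleC c a \<in> carrier_mat m n" and cx: "map_vec (scaleC c) x \<in> carrier_vec n"
    using a x by auto
  show "mat_scaleC c a *\<^sub>v x = map_vec (scaleC c) (a *\<^sub>v x)"
    using a x by (intro eq_vecI)
      (simp_all add: index_mult_mat_vec_sum[OF ca x] index_mult_mat_vec_sum[OF a x]
        mult_scaleC_left complex_vector.scale_sum_right del: index_mult_mat_vec)
  show "a *\<^sub>v map_vec (scaleC c) x = map_vec (scaleC c) (a *\<^sub>v x)"
    using a x by (intro eq_vecI)
      (simp_all add: index_mult_mat_vec_sum[OF a cx] index_mult_mat_vec_sum[OF a x]
        mult_scaleC_right complex_vector.scale_sum_right del: index_mult_mat_vec)
qed

lemma cip_adjoint:
  assumes a: "a \<in> carrier_mat m n" and x: "x \<in> carrier_vec n" and y: "y \<in> carrier_vec m"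
  shows "cip (a *\<^sub>v x) y = cip x (mat_star a *\<^sub>v y)"
proof -
  have "cip (a *\<^sub>v x) y = (\<Sum>i<m. (\<Sum>j<n. star (vec_index x j) * star (a $$ (i, j)) * vec_index y i))"
    using a by (simp add: cip_def index_mult_mat_vec_sum[OF a x] star_sum star_mult sum_distrib_right del: index_mult_mat_vec)
  also have "\<dots> = (\<Sum>j<n. (\<Sum>i<m. star (vec_index x j) * star (a $$ (i, j)) * vec_index y i))"
    by (rule sum.swap)
  also have "\<dots> = cip x (mat_star a *\<^sub>v y)"
    using x by (simp add: cip_def index_mult_mat_vec_sum[OF mat_star_carrier[OF a] y] mat_star_index[OF a]
        sum_distrib_left mult.assoc del: index_mult_mat_vec)
  finally show ?thesis .
qed

text \<open>Makes the supremum in \<open>mat_norm\<close> finite, and later turns entrywise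
  convergence into convergence of matrix norms.\<close>

lemma column_norm_mult_mat_vec_crude:
  assumes a: "a \<in> carrier_mat m n" and x: "x \<in> carrier_vec n"
  shows "column_norm (a *\<^sub>v x) \<le> (\<Sum>i<m. \<Sum>j<n. norm (a $$ (i, j))) * column_norm x"
proof -
  have "column_norm (a *\<^sub>v x) \<le> (\<Sum>i<m. norm (\<Sum>j<n. a $$ (i, j) * vec_index x j))"
    using column_norm_le_sum[of "a *\<^sub>v x"] a by (simp add: index_mult_mat_vec_sum[OF a x] del: index_mult_mat_vec)
  also have "\<dots> \<le> (\<Sum>i<m. \<Sum>j<n. norm (a $$ (i, j)) * column_norm x)"
  proof (intro sum_mono order_trans[OF norm_sum])
    fix i j assume "j \<in> {..<n}"
    then have "norm (vec_index x j) \<le> column_norm x" using x by (intro column_norm_entry) auto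
    then show "norm (a $$ (i, j) * vec_index x j) \<le> norm (a $$ (i, j)) * column_norm x"
      by (meson mult_left_mono norm_ge_zero norm_mult_ineq order_trans)
  qed
  finally show ?thesis by (simp add: sum_distrib_right)
qed

section \<open>The operator norm of matrices\<close>

lemma mat_norm_bdd_above:
  "a \<in> carrier_mat m n \<Longrightarrow> bdd_above ((\<lambda>x. column_norm (a *\<^sub>v x)) ` {x \<in> carrier_vec n. column_norm x \<le> 1})"
  by (intro bdd_aboveI2[where M = "\<Sum>i<m. \<Sum>j<n. norm (a $$ (i, j))"])
    (auto intro!: order_trans[OF column_norm_mult_mat_vec_crude] mult_left_le sum_nonneg)

lemma mat_norm_nonneg: "a \<in> carrier_mat m n \<Longrightarrow> 0 \<le> mat_norm a"
  unfolding mat_norm_def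
  by (rule cSUP_upper2[where x = "0\<^sub>v n"]) (use mat_norm_bdd_above in auto)

lemma mat_norm_leI:
  fixes a :: "'a::cstar_algebra mat"
  assumes "a \<in> carrier_mat m n" "\<And>x. x \<in> carrier_vec n \<Longrightarrow> column_norm (a *\<^sub>v x) \<le> B * column_norm x" "B \<ge> 0"
  shows "mat_norm a \<le> B"
  unfolding mat_norm_def
proof (rule cSUP_least)
  show "{x \<in> carrier_vec (dim_col a). column_norm x \<le> 1} \<noteq> {}"
    by (rule ex_in_conv[THEN iffD1], rule exI[of _ "0\<^sub>v (dim_col a)"]) simp
  fix x :: "'a Matrix.vec" assume "x \<in> {x \<in> carrier_vec (dim_col a). column_norm x \<le> 1}"
  then have x: "x \<in> carrier_vec n" "column_norm x \<le> 1" using assms(1) by auto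
  show "column_norm (a *\<^sub>v x) \<le> B"
    using assms(2)[OF x(1)] x(2) assms(3) by (meson mult_left_le order_trans column_norm_nonneg)
qed

lemma column_norm_mult_mat_vec:
  assumes a: "a \<in> carrier_mat m n" and x: "x \<in> carrier_vec n"
  shows "column_norm (a *\<^sub>v x) \<le> mat_norm a * column_norm x"
proof (cases "column_norm x = 0")
  case True
  then show ?thesis using column_norm_mult_mat_vec_crude[OF a x] by simp
next
  case False
  define y where "y = map_vec (scaleC (complex_of_real (inverse (column_norm x)))) x"
  have y: "y \<in> carrier_vec n" "column_norm y = 1"
    using x False by (auto simp: y_def column_norm_scaleC norm_inverse)
  have "column_norm (a *\<^sub>v y) \<le> mat_norm a"
    unfolding mat_norm_def by (rule cSUP_upper) (use a y mat_norm_bdd_above[OF a] in auto)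
  moreover have "column_norm (a *\<^sub>v y) = inverse (column_norm x) * column_norm (a *\<^sub>v x)"
    unfolding y_def mat_scaleC_mult_vec(2)[OF a x] column_norm_scaleC by (simp add: norm_inverse)
  ultimately show ?thesis using False by (simp add: field_simps less_le)
qed

lemma mat_norm_triangle:
  fixes a :: "'a::cstar_algebra mat"
  assumes "a \<in> carrier_mat m n" "b \<in> carrier_mat m n"
  shows "mat_norm (a + b) \<le> mat_norm a + mat_norm b"
proof (rule mat_norm_leI[of _ m n])
  fix x :: "'a Matrix.vec" assume x: "x \<in> carrier_vec n"
  have "column_norm ((a + b) *\<^sub>v x) \<le> column_norm (a *\<^sub>v x) + column_norm (b *\<^sub>v x)"
    unfolding add_mult_distrib_mat_vec[OF assms x] by (rule column_norm_triangle[OF mult_mat_vec_in_carrier[OF assms(1)] mult_mat_vec_in_carrier[OF assms(2)]])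
  also have "\<dots> \<le> mat_norm a * column_norm x + mat_norm b * column_norm x"
    by (intro add_mono column_norm_mult_mat_vec[OF assms(1) x] column_norm_mult_mat_vec[OF assms(2) x])
  finally show "column_norm ((a + b) *\<^sub>v x) \<le> (mat_norm a + mat_norm b) * column_norm x"
    by (simp add: distrib_right)
qed (use assms mat_norm_nonneg[OF assms(1)] mat_norm_nonneg[OF assms(2)] in auto)

lemma mat_norm_scaleC_le:
  fixes a :: "'a::cstar_algebra mat"
  assumes "a \<in> carrier_mat m n"
  shows "mat_norm (mat_scaleC c a) \<le> cmod c * mat_norm a"
proof (rule mat_norm_leI)
  fix x :: "'a Matrix.vec" assume x: "x \<in> carrier_vec n"
  show "column_norm (mat_scaleC c a *\<^sub>v x) \<le> cmod c * mat_norm a * column_norm x"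
    unfolding mat_scaleC_mult_vec(1)[OF assms x] column_norm_scaleC mult.assoc
    by (intro mult_left_mono column_norm_mult_mat_vec[OF assms x]) simp
qed (use assms mat_norm_nonneg[OF assms] in auto)

lemma mat_norm_scaleC:
  assumes "a \<in> carrier_mat m n"
  shows "mat_norm (mat_scaleC c a) = cmod c * mat_norm a"
proof (cases "c = 0")
  case True
  then show ?thesis using mat_norm_scaleC_le[OF assms, of 0] mat_norm_nonneg[of "mat_scaleC 0 a"] assms by simp
next
  case False
  have "mat_norm (mat_scaleC (inverse c) (mat_scaleC c a)) \<le> cmod (inverse c) * mat_norm (mat_scaleC c a)"
    by (rule mat_norm_scaleC_le) (use assms in simp)
  then have "cmod c * mat_norm a \<le> mat_norm (mat_scaleC c a)"
    using False by (simp add: mat_scaleC_scaleC norm_inverse field_simps norm_divide)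
  then show ?thesis using mat_norm_scaleC_le[OF assms, of c] by (rule antisym[rotated])
qed

lemma mat_norm_mult:
  fixes a :: "'a::cstar_algebra mat"
  assumes "a \<in> carrier_mat m n" "b \<in> carrier_mat n k"
  shows "mat_norm (a * b) \<le> mat_norm a * mat_norm b"
proof (rule mat_norm_leI)
  fix x :: "'a Matrix.vec" assume x: "x \<in> carrier_vec k"
  have "column_norm (a * b *\<^sub>v x) \<le> mat_norm a * column_norm (b *\<^sub>v x)"
    unfolding assoc_mult_mat_vec[OF assms x] by (rule column_norm_mult_mat_vec[OF assms(1) mult_mat_vec_in_carrier[OF assms(2)]])
  also have "\<dots> \<le> mat_norm a * (mat_norm b * column_norm x)"
    by (intro mult_left_mono column_norm_mult_mat_vec[OF assms(2) x] mat_norm_nonneg[OF assms(1)])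
  finally show "column_norm (a * b *\<^sub>v x) \<le> mat_norm a * mat_norm b * column_norm x" by (simp add: mult.assoc)
qed (use assms mat_norm_nonneg[OF assms(1)] mat_norm_nonneg[OF assms(2)] in \<open>auto intro!: mult_nonneg_nonneg\<close>)

lemma mat_norm_uminus: "a \<in> carrier_mat m n \<Longrightarrow> mat_norm (- a) = mat_norm a"
proof -
  assume a: "a \<in> carrier_mat m n"
  have "- a = mat_scaleC (-1) a" by (rule eq_matI) (auto simp: scaleC_one)
  then show ?thesis using mat_norm_scaleC[OF a, of "-1"] by simp
qed

lemma mat_norm_diff:
  assumes "a \<in> carrier_mat m n" "b \<in> carrier_mat m n"
  shows "mat_norm (a - b) \<le> mat_norm a + mat_norm b"
  using mat_norm_triangle[of a m n "- b"] mat_norm_uminus[of b m n] assms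
  by (simp add: minus_add_uminus_mat[OF assms])

lemma mat_norm_diff_abs:
  assumes a: "a \<in> carrier_mat m n" and b: "b \<in> carrier_mat m n"
  shows "\<bar>mat_norm a - mat_norm b\<bar> \<le> mat_norm (a - b)"
proof -
  have "b + (a - b) = a" "a + (b - a) = b" "b - a = - (a - b)" using a b by (auto intro!: eq_matI)
  then have "mat_norm a \<le> mat_norm b + mat_norm (a - b)" "mat_norm b \<le> mat_norm a + mat_norm (a - b)"
    using mat_norm_triangle[OF b minus_carrier_mat[OF b], of a] mat_norm_triangle[OF a minus_carrier_mat[OF a], of b]
      mat_norm_uminus[OF minus_carrier_mat[OF b], of a] by (simp_all only:)
  then show ?thesis by linarith
qed

lemma mat_norm_le_sum:
  "a \<in> carrier_mat m n \<Longrightarrow> mat_norm a \<le> (\<Sum>i<m. \<Sum>j<n. norm (a $$ (i, j)))"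
  by (intro mat_norm_leI column_norm_mult_mat_vec_crude sum_nonneg) auto

lemma mat_norm_entry:
  assumes a: "a \<in> carrier_mat m n" and ij: "i < m" "j < n"
  shows "norm (a $$ (i, j)) \<le> mat_norm a"
proof -
  have u: "unit_vec n j \<in> carrier_vec n" by simp
  have "cip (unit_vec n j) (unit_vec n j) = (1::'a)"
    using ij by (simp add: cip_def unit_vec_def if_distrib[of star] if_distrib[of "\<lambda>x. x * _"] cong: if_cong)
  then have n1: "column_norm (unit_vec n j :: 'a Matrix.vec) = 1" by (simp add: column_norm_cip)
  have "vec_index (a *\<^sub>v unit_vec n j) i = a $$ (i, j)"
    using ij unfolding index_mult_mat_vec_sum[OF a u ij(1)]
    by (simp add: unit_vec_def if_distrib[of "\<lambda>x. _ * x"] cong: if_cong)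
  then have "norm (a $$ (i, j)) \<le> column_norm (a *\<^sub>v unit_vec n j)"
    using column_norm_entry[of i "a *\<^sub>v unit_vec n j"] a ij by simp
  then show ?thesis using column_norm_mult_mat_vec[OF a u] n1 by simp
qed

lemma mat_norm_star_le:
  fixes a :: "'a::cstar_algebra mat"
  assumes a: "a \<in> carrier_mat m n"
  shows "mat_norm (mat_star a) \<le> mat_norm a"
proof (rule mat_norm_leI)
  have a': "mat_star a \<in> carrier_mat n m" using a by simp
  fix y :: "'a Matrix.vec" assume y: "y \<in> carrier_vec m"
  define z where "z = mat_star a *\<^sub>v y"
  have z: "z \<in> carrier_vec n" unfolding z_def by (rule mult_mat_vec_in_carrier[OF a'])
  have "(column_norm z)\<^sup>2 = norm (cip y (a *\<^sub>v z))"
    unfolding column_norm_power2 using cip_adjoint[OF a' y z] by (simp add: z_def)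
  also have "\<dots> \<le> column_norm y * column_norm (a *\<^sub>v z)"
    by (intro norm_cip_le[OF y] mult_mat_vec_in_carrier[OF a])
  also have "\<dots> \<le> column_norm y * (mat_norm a * column_norm z)"
    by (intro mult_left_mono column_norm_mult_mat_vec[OF a z]) simp
  finally have "column_norm z * column_norm z \<le> (mat_norm a * column_norm y) * column_norm z"
    by (simp add: power2_eq_square mult_ac)
  then have "column_norm z \<noteq> 0 \<Longrightarrow> column_norm z \<le> mat_norm a * column_norm y"
    by (rule mult_right_le_imp_le) (simp add: less_le)
  moreover have "0 \<le> mat_norm a * column_norm y" using mat_norm_nonneg[OF a] by simp
  ultimately show "column_norm (mat_star a *\<^sub>v y) \<le> mat_norm a * column_norm y"
    unfolding z_def by fastforce
qed (use a mat_norm_nonneg[OF a] in auto)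

lemma mat_norm_star:
  assumes a: "a \<in> carrier_mat m n"
  shows "mat_norm (mat_star a) = mat_norm a"
  using mat_norm_star_le[OF a] mat_norm_star_le[OF mat_star_carrier[OF a]] by simp

lemma mat_norm_zero [simp]: "mat_norm (0\<^sub>m m n) = 0"
  by (rule antisym[OF order_trans[OF mat_norm_le_sum[OF zero_carrier_mat]] mat_norm_nonneg[OF zero_carrier_mat]]) simp

lemma mat_norm_1x1: "a \<in> carrier_mat 1 1 \<Longrightarrow> mat_norm a = norm (a $$ (0, 0))"
  using mat_norm_le_sum[of a 1 1] mat_norm_entry[of a 1 1 0 0] by simp

lemma tendsto_mat_norm:
  fixes A :: "'b \<Rightarrow> 'a::cstar_algebra mat"
  assumes A: "\<And>t. A t \<in> carrier_mat m n" and L: "L \<in> carrier_mat m n"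
    and lim: "\<And>i j. i < m \<Longrightarrow> j < n \<Longrightarrow> ((\<lambda>t. A t $$ (i, j)) \<longlongrightarrow> L $$ (i, j)) F"
  shows "((\<lambda>t. mat_norm (A t)) \<longlongrightarrow> mat_norm L) F"
proof -
  have "((\<lambda>t. \<Sum>i<m. \<Sum>j<n. norm (A t $$ (i, j) - L $$ (i, j))) \<longlongrightarrow> (\<Sum>i<m. \<Sum>j<n. norm (L $$ (i, j) - L $$ (i, j)))) F"
    by (intro tendsto_intros lim) auto
  then have z: "((\<lambda>t. \<Sum>i<m. \<Sum>j<n. norm (A t $$ (i, j) - L $$ (i, j))) \<longlongrightarrow> 0) F" by simp
  have le: "norm (mat_norm (A t) - mat_norm L) \<le> (\<Sum>i<m. \<Sum>j<n. norm (A t $$ (i, j) - L $$ (i, j)))" for t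
  proof -
    have "norm (mat_norm (A t) - mat_norm L) \<le> mat_norm (A t - L)"
      using mat_norm_diff_abs[OF A L] by simp
    also have "\<dots> \<le> (\<Sum>i<m. \<Sum>j<n. norm ((A t - L) $$ (i, j)))"
      using A L by (intro mat_norm_le_sum) auto
    also have "\<dots> = (\<Sum>i<m. \<Sum>j<n. norm (A t $$ (i, j) - L $$ (i, j)))"
      using A L by (intro sum.cong) auto
    finally show ?thesis .
  qed
  have "((\<lambda>t. mat_norm (A t) - mat_norm L) \<longlongrightarrow> 0) F"
    by (intro Lim_null_comparison[OF always_eventually z] allI le)
  then show ?thesis by (simp add: LIM_zero_iff)
qed

section \<open>Square roots of matrices and positivity as a norm condition\<close>

text \<open>The iteration of \<open>sqrt_one_minus\<close> again, now estimated in
  \<open>mat_norm\<close>. An entry is bounded by the norm of the matrix, so completeness of the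
  algebra gives limits of all entries, and the fixed point equation is checked there.\<close>

lemma mat_sqrt_one_minus:
  fixes t :: "'a::cstar_algebra mat"
  assumes t: "t \<in> carrier_mat n n" "mat_star t = t" "mat_norm t \<le> 1"
  shows "\<exists>s\<in>carrier_mat n n. mat_star s = s \<and> s * s = 1\<^sub>m n - t"
proof -
  define g where "g = rec_nat (0\<^sub>m n n) (\<lambda>_ h. mat_scaleC (1/2) (t + h * h))"
  have g0: "g 0 = 0\<^sub>m n n" and gS: "g (Suc k) = mat_scaleC (1/2) (t + g k * g k)" for k
    by (simp_all add: g_def)
  have g [simp]: "g k \<in> carrier_mat n n" for k
    by (induction k) (use t in \<open>auto simp: g0 gS\<close>)
  have star_g: "mat_star (g k) = g k" for k
  proof (induction k)
    case (Suc k)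
    have "mat_star (t + g k * g k) = t + g k * g k"
      unfolding mat_star_add[OF t(1) mult_carrier_mat[OF g g]] mat_star_mult[OF g g] Suc t(2) ..
    then show ?case by (simp add: gS mat_star_scaleC)
  qed (simp add: g0)
  have norm_g: "mat_norm (g k) \<le> sqrt_iter k" for k
  proof (induction k)
    case (Suc k)
    have "mat_norm (t + g k * g k) \<le> mat_norm t + mat_norm (g k) * mat_norm (g k)"
      using t by (meson add_left_mono mat_norm_mult mat_norm_triangle order_trans g mult_carrier_mat)
    also have "\<dots> \<le> 1 + sqrt_iter k * sqrt_iter k"
      using t Suc by (intro add_mono mult_mono) (auto simp: sqrt_iter_bounds mat_norm_nonneg[of _ n n])
    finally show ?case using mat_norm_scaleC[OF add_carrier_mat[OF mult_carrier_mat[OF g g]], of "1/2" t k k] t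
      by (simp add: gS power2_eq_square)
  qed (simp add: g0)
  have step: "mat_norm (g (Suc k) - g k) \<le> sqrt_iter (Suc k) - sqrt_iter k" for k
  proof (induction k)
    case 0
    have "mat_scaleC (1/2) (t + 0\<^sub>m n n * 0\<^sub>m n n) - 0\<^sub>m n n = mat_scaleC (1/2) t" using t by (auto intro!: eq_matI)
    then show ?case using t mat_norm_scaleC[OF t(1), of "1/2"] by (simp add: g0 gS)
  next
    case (Suc k)
    let ?a = "g (Suc k)" and ?b = "g k"
    \<comment> \<open>P, Q and R stand for a a, b b and a b with a, b consecutive iterates: the
      difference of the squares telescopes through the mixed product.\<close>
    have "(t + P) - (t + Q) = (P - R) + (R - Q)"
      if "P \<in> carrier_mat n n" "Q \<in> carrier_mat n n" "R \<in> carrier_mat n n" for P Q R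
      using t that by (intro eq_matI) auto
    from this[OF mult_carrier_mat[OF g g] mult_carrier_mat[OF g g] mult_carrier_mat[OF g g]]
    have "(t + ?a * ?a) - (t + ?b * ?b) = ?a * (?a - ?b) + (?a - ?b) * ?b"
      unfolding mult_minus_distrib_mat[OF g g g] minus_mult_distrib_mat[OF g g g] by blast
    moreover have "mat_scaleC (1/2) P - mat_scaleC (1/2) Q = mat_scaleC (1/2) (P - Q)"
      if "P \<in> carrier_mat n n" "Q \<in> carrier_mat n n" for P Q :: "'a mat"
      using that by (intro eq_matI) (auto simp: complex_vector.scale_right_diff_distrib)
    from this[OF add_carrier_mat[OF mult_carrier_mat[OF g g]] add_carrier_mat[OF mult_carrier_mat[OF g g]]]
    have "mat_scaleC (1/2) (t + ?a * ?a) - mat_scaleC (1/2) (t + ?b * ?b) = mat_scaleC (1/2) ((t + ?a * ?a) - (t + ?b * ?b))" .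
    ultimately have eq: "g (Suc (Suc k)) - g (Suc k) = mat_scaleC (1/2) (?a * (?a - ?b) + (?a - ?b) * ?b)"
      unfolding gS[of "Suc k"] by (subst (2) gS) simp
    have c: "?a * (?a - ?b) \<in> carrier_mat n n" "(?a - ?b) * ?b \<in> carrier_mat n n"
      using mult_carrier_mat[OF g minus_carrier_mat[OF g]] mult_carrier_mat[OF minus_carrier_mat[OF g] g] by blast+
    have "mat_norm (?a * (?a - ?b) + (?a - ?b) * ?b) \<le> mat_norm ?a * mat_norm (?a - ?b) + mat_norm (?a - ?b) * mat_norm ?b"
      by (intro order_trans[OF mat_norm_triangle[OF c]] add_mono mat_norm_mult[OF g minus_carrier_mat[OF g]] mat_norm_mult[OF minus_carrier_mat[OF g] g])
    also have "\<dots> = mat_norm (?a - ?b) * (mat_norm ?a + mat_norm ?b)" by (simp add: algebra_simps)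
    also have "\<dots> \<le> (sqrt_iter (Suc k) - sqrt_iter k) * (sqrt_iter (Suc k) + sqrt_iter k)"
    proof (intro mult_mono Suc add_mono norm_g)
      show "0 \<le> sqrt_iter (Suc k) - sqrt_iter k" using sqrt_iter_mono[of k] by (simp only: diff_ge_0_iff_ge)
      show "0 \<le> mat_norm ?a + mat_norm ?b" using mat_norm_nonneg[OF g] by (simp add: add_nonneg_nonneg)
    qed
    also have "\<dots> = (sqrt_iter (Suc k))\<^sup>2 - (sqrt_iter k)\<^sup>2"
      by (simp only: power2_eq_square square_diff_square_factored mult.commute)
    finally have *: "mat_norm (?a * (?a - ?b) + (?a - ?b) * ?b) \<le> (sqrt_iter (Suc k))\<^sup>2 - (sqrt_iter k)\<^sup>2" .
    have "mat_norm (g (Suc (Suc k)) - g (Suc k)) = (1/2) * mat_norm (?a * (?a - ?b) + (?a - ?b) * ?b)"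
      unfolding eq by (subst mat_norm_scaleC[of _ n n]) (use c in auto)
    also have "\<dots> \<le> (1/2) * ((sqrt_iter (Suc k))\<^sup>2 - (sqrt_iter k)\<^sup>2)" by (intro mult_left_mono *) simp
    also have "\<dots> = sqrt_iter (Suc (Suc k)) - sqrt_iter (Suc k)"
      unfolding sqrt_iter.simps(2)[of "Suc k"] sqrt_iter.simps(2)[of k] by (simp add: field_simps)
    finally show ?case .
  qed
  have "\<exists>l. (\<lambda>k. g k $$ (i, j)) \<longlonglongrightarrow> l" if "i < n" "j < n" for i j
  proof -
    have gc: "g k \<in> carrier_mat n n" for k by simp
    have "Cauchy (\<lambda>k. g k $$ (i, j))"
    proof (rule Cauchy_dominated[OF Cauchy_sqrt_iter])
      fix k
      have "norm ((g (Suc k) - g k) $$ (i, j)) \<le> mat_norm (g (Suc k) - g k)"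
        by (rule mat_norm_entry[OF minus_carrier_mat[OF g] that])
      moreover have "(g (Suc k) - g k) $$ (i, j) = g (Suc k) $$ (i, j) - g k $$ (i, j)"
        using that carrier_matD[OF gc[of k]] by (intro index_minus_mat(1)) simp_all
      ultimately show "norm (g (Suc k) $$ (i, j) - g k $$ (i, j)) \<le> sqrt_iter (Suc k) - sqrt_iter k"
        using step[of k] by (simp only:)
    qed
    then show ?thesis using Cauchy_convergent convergent_def by blast
  qed
  then obtain L where L: "\<And>i j. i < n \<Longrightarrow> j < n \<Longrightarrow> (\<lambda>k. g k $$ (i, j)) \<longlonglongrightarrow> L i j" by metis
  define l where "l = Matrix.mat n n (\<lambda>(i, j). L i j)"
  have l [simp]: "l \<in> carrier_mat n n" by (simp add: l_def)
  have lL: "i < n \<Longrightarrow> j < n \<Longrightarrow> (\<lambda>k. g k $$ (i, j)) \<longlonglongrightarrow> l $$ (i, j)" for i j using L by (simp add: l_def)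
  have star_l: "mat_star l = l"
  proof (rule eq_matI)
    fix i j assume "i < dim_row l" "j < dim_col l"
    then have ij: "i < n" "j < n" by (auto simp: l_def)
    have "(\<lambda>k. star (g k $$ (j, i))) \<longlonglongrightarrow> star (l $$ (j, i))" by (intro tendsto_star lL ij)
    moreover have "star (g k $$ (j, i)) = g k $$ (i, j)" for k
      using star_g[of k] mat_star_index[OF g ij, of k] by simp
    ultimately have "(\<lambda>k. g k $$ (i, j)) \<longlonglongrightarrow> star (l $$ (j, i))" by simp
    then have "star (l $$ (j, i)) = l $$ (i, j)" using lL[OF ij] by (rule LIMSEQ_unique)
    then show "mat_star l $$ (i, j) = l $$ (i, j)" using ij by (simp add: mat_star_index[OF l])
  qed (simp_all add: l_def)
  have fix_l: "l $$ (i, j) + l $$ (i, j) = t $$ (i, j) + (l * l) $$ (i, j)" if ij: "i < n" "j < n" for i j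
  proof -
    have "(\<lambda>k. (1/2) *\<^sub>C (t $$ (i, j) + (\<Sum>p<n. g k $$ (i, p) * g k $$ (p, j)))) \<longlonglongrightarrow>
        (1/2) *\<^sub>C (t $$ (i, j) + (\<Sum>p<n. l $$ (i, p) * l $$ (p, j)))"
      by (intro bounded_linear.tendsto[OF bounded_linear_scaleC_right] tendsto_add tendsto_const tendsto_sum tendsto_mult lL) (use ij in auto)
    moreover have "(1/2) *\<^sub>C (t $$ (i, j) + (\<Sum>p<n. g k $$ (i, p) * g k $$ (p, j))) = g (Suc k) $$ (i, j)" for k
    proof -
      have "g k * g k \<in> carrier_mat n n" by (rule mult_carrier_mat[OF g g])
      then show ?thesis using ij t unfolding gS by (simp add: index_mult_mat_sum[OF g g ij] carrier_matD[OF g] del: index_mult_mat(1))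
    qed
    ultimately have "(\<lambda>k. g (Suc k) $$ (i, j)) \<longlonglongrightarrow> (1/2) *\<^sub>C (t $$ (i, j) + (\<Sum>p<n. l $$ (i, p) * l $$ (p, j)))" by simp
    then have eq: "l $$ (i, j) = (1/2) *\<^sub>C (t $$ (i, j) + (l * l) $$ (i, j))"
      using LIMSEQ_unique LIMSEQ_Suc[OF lL[OF ij]] unfolding index_mult_mat_sum[OF l l ij] by blast
    have "(1/2) *\<^sub>C z + (1/2) *\<^sub>C z = z" for z :: 'a
      by (simp flip: scaleC_add_left add: scaleC_one)
    then show ?thesis using eq by metis
  qed
  have cl: "1\<^sub>m n - l \<in> carrier_mat n n" by (rule minus_carrier_mat[OF l])
  have ll: "l * l \<in> carrier_mat n n" by (rule mult_carrier_mat[OF l l])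
  have d: "dim_row l = n" "dim_col l = n" by (simp_all add: l_def)
  have "(1\<^sub>m n - l) * (1\<^sub>m n - l) = (1\<^sub>m n - l) - (l - l * l)"
    unfolding minus_mult_distrib_mat[OF one_carrier_mat l cl] left_mult_one_mat[OF cl]
      mult_minus_distrib_mat[OF l one_carrier_mat l] right_mult_one_mat[OF l] ..
  also have "\<dots> = 1\<^sub>m n - t"
  proof (rule eq_matI)
    fix i j assume "i < dim_row (1\<^sub>m n - t)" "j < dim_col (1\<^sub>m n - t)"
    then have ij: "i < n" "j < n" using t by auto
    have "1\<^sub>m n $$ (i, j) - l $$ (i, j) - (l $$ (i, j) - (l * l) $$ (i, j)) = 1\<^sub>m n $$ (i, j) - t $$ (i, j)"
    proof -
      have "z - a - (a - b) = z - c" if "a + a = c + b" for z a b c :: 'a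
      proof -
        have "z - a - (a - b) = z + b - (a + a)" by simp
        then show ?thesis by (simp only: that) simp
      qed
      then show ?thesis using fix_l[OF ij] by blast
    qed
    then show "(1\<^sub>m n - l - (l - l * l)) $$ (i, j) = (1\<^sub>m n - t) $$ (i, j)"
      using ij t ll by (simp add: d del: index_mult_mat(1))
  qed (use t ll in \<open>simp_all add: d\<close>)
  finally have "(1\<^sub>m n - l) * (1\<^sub>m n - l) = 1\<^sub>m n - t" .
  moreover have "mat_star (1\<^sub>m n - l) = 1\<^sub>m n - l"
    unfolding mat_star_diff[OF one_carrier_mat l] star_l mat_star_one ..
  ultimately show ?thesis using cl by blast
qed

lemma mat_positiveD:
  assumes "mat_positive n a"
  shows "a \<in> carrier_mat n n" "mat_star a = a"
  using assms by (auto simp: mat_positive_def mat_star_mult[of _ n n])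

lemma mat_positive_scaleC:
  assumes "mat_positive n a" "r \<ge> 0"
  shows "mat_positive n (mat_scaleC (complex_of_real r) a)"
proof -
  obtain b where b: "b \<in> carrier_mat n n" "a = mat_star b * b" using assms(1) by (auto simp: mat_positive_def)
  let ?b = "mat_scaleC (complex_of_real (sqrt r)) b"
  have "mat_star ?b * ?b = mat_scaleC (complex_of_real (sqrt r)) (mat_star b * ?b)"
    unfolding mat_star_scaleC using b by (subst mat_scaleC_mult_left[of _ n n _ n]) auto
  also have "\<dots> = mat_scaleC (complex_of_real r) a"
    using b assms(2) by (subst mat_scaleC_mult_right[of _ n n _ n]) (auto simp: mat_scaleC_scaleC simp flip: of_real_mult)
  finally show ?thesis using b unfolding mat_positive_def by (intro bexI[of _ ?b]) auto
qed

lemma mat_positive_of_norm: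
  assumes a: "a \<in> carrier_mat n n" "mat_star a = a"
    and t: "mat_norm (mat_scaleC (complex_of_real t) (1\<^sub>m n) - a) \<le> t"
  shows "mat_positive n a"
proof (cases "t > 0")
  case True
  define b where "b = mat_scaleC (complex_of_real (1/t)) (mat_scaleC (complex_of_real t) (1\<^sub>m n) - a)"
  have b: "b \<in> carrier_mat n n" using a by (simp add: b_def minus_carrier_mat)
  have "mat_norm b = (1/t) * mat_norm (mat_scaleC (complex_of_real t) (1\<^sub>m n) - a)"
    unfolding b_def using a True by (subst mat_norm_scaleC[of _ n n]) (auto simp: norm_divide)
  then have nb: "mat_norm b \<le> 1" using t True by (simp add: divide_le_eq)
  have sb: "mat_star b = b"
    using a by (simp add: b_def mat_star_scaleC mat_star_diff[of _ n n])
  obtain s where s: "s \<in> carrier_mat n n" "mat_star s = s" "s * s = 1\<^sub>m n - b"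
    using mat_sqrt_one_minus[OF b sb nb] by blast
  have "1\<^sub>m n - b = mat_scaleC (complex_of_real (1/t)) a"
    using a True by (intro eq_matI) (auto simp: b_def complex_vector.scale_right_diff_distrib scaleC_scaleC scaleC_one)
  then have "mat_positive n (mat_scaleC (complex_of_real (1/t)) a)"
    using s unfolding mat_positive_def by (intro bexI[of _ s]) auto
  then have "mat_positive n (mat_scaleC (complex_of_real t) (mat_scaleC (complex_of_real (1/t)) a))"
    by (rule mat_positive_scaleC) (use True in simp)
  moreover have "complex_of_real t * complex_of_real (1/t) = 1" using True by (simp flip: of_real_mult)
  ultimately show ?thesis by (simp only: mat_scaleC_scaleC mat_scaleC_one)
next
  case False
  have c: "mat_scaleC (complex_of_real t) (1\<^sub>m n) - a \<in> carrier_mat n n" by (rule minus_carrier_mat[OF a(1)])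
  have t0: "t = 0" using t False mat_norm_nonneg[OF c] by simp
  have "a = 0\<^sub>m n n"
  proof (rule eq_matI)
    fix i j assume "i < dim_row (0\<^sub>m n n)" "j < dim_col (0\<^sub>m n n)"
    then have ij: "i < n" "j < n" by auto
    have "norm ((mat_scaleC (complex_of_real t) (1\<^sub>m n) - a) $$ (i, j)) \<le> 0"
      using mat_norm_entry[OF c ij] t t0 by linarith
    then show "a $$ (i, j) = 0\<^sub>m n n $$ (i, j)" using ij a t0 by simp
  qed (use a in auto)
  then show ?thesis unfolding mat_positive_def by (intro bexI[of _ "0\<^sub>m n n"]) auto
qed

text \<open>The operator inequality \<open>\<langle>b \<xi>, b \<xi>\<rangle> \<le> \<langle>\<xi>, \<xi>\<rangle>\<close> for \<open>\<parallel>b\<parallel> \<le> 1\<close>, stronger than the norm inequality,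
  comes from a square root of \<open>1 - b\<^sup>* b\<close>.\<close>

lemma mat_norm_of_positive:
  fixes a :: "'a::cstar_algebra mat"
  assumes "mat_positive n a" "mat_norm a \<le> t"
  shows "mat_norm (mat_scaleC (complex_of_real t) (1\<^sub>m n) - a) \<le> t"
proof -
  have le1: "mat_norm (1\<^sub>m n - a) \<le> 1" if pa: "mat_positive n a" and na: "mat_norm a \<le> 1" for a :: "'a mat"
  proof -
    obtain b where b: "b \<in> carrier_mat n n" "a = mat_star b * b" using pa unfolding mat_positive_def by blast
    note a = mat_positiveD[OF pa]
    obtain s where s: "s \<in> carrier_mat n n" "mat_star s = s" "s * s = 1\<^sub>m n - a"
      using mat_sqrt_one_minus[OF a na] by blast
    have "mat_norm s \<le> 1"
    proof (rule mat_norm_leI[OF s(1)])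
      fix x :: "'a Matrix.vec" assume x: "x \<in> carrier_vec n"
      have sx: "s *\<^sub>v x \<in> carrier_vec n" and bx: "b *\<^sub>v x \<in> carrier_vec n" and ax: "a *\<^sub>v x \<in> carrier_vec n"
        by (rule mult_mat_vec_in_carrier[OF s(1)], rule mult_mat_vec_in_carrier[OF b(1)], rule mult_mat_vec_in_carrier[OF a(1)])
      have 1: "cip (s *\<^sub>v x) (s *\<^sub>v x) = cip x (s * s *\<^sub>v x)"
        unfolding cip_adjoint[OF s(1) x sx] s(2) assoc_mult_mat_vec[OF s(1) s(1) x] ..
      have 2: "cip (b *\<^sub>v x) (b *\<^sub>v x) = cip x (a *\<^sub>v x)"
        unfolding cip_adjoint[OF b(1) x bx] b(2) assoc_mult_mat_vec[OF mat_star_carrier[OF b(1)] b(1) x] ..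
      have "cip (s *\<^sub>v x) (s *\<^sub>v x) = cip x x - cip (b *\<^sub>v x) (b *\<^sub>v x)"
        unfolding 1 2 s(3) using minus_mult_distrib_mat_vec[OF one_carrier_mat a(1) x] cip_diff_right[OF x x ax] x
        by simp
      then have "norm (cip (s *\<^sub>v x) (s *\<^sub>v x)) \<le> norm (cip x x)"
        by (intro cpos_norm_mono cpos_cip) (metis cpos_cip diff_diff_eq2 add_diff_cancel_left')
      then show "column_norm (s *\<^sub>v x) \<le> 1 * column_norm x" by (simp add: column_norm_cip)
    qed simp
    then have "mat_norm (s * s) \<le> 1 * 1"
      by (intro order_trans[OF mat_norm_mult[OF s(1) s(1)]] mult_mono) (auto simp: mat_norm_nonneg[OF s(1)])
    then show ?thesis by (simp add: s)
  qed
  note a = mat_positiveD[OF assms(1)]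
  show ?thesis
  proof (cases "t > 0")
    case True
    let ?a = "mat_scaleC (complex_of_real (1/t)) a"
    have "mat_positive n ?a" using True by (intro mat_positive_scaleC assms) auto
    moreover have "mat_norm ?a \<le> 1" using mat_norm_scaleC[OF a(1)] assms True by (simp add: divide_le_eq norm_divide)
    ultimately have l: "mat_norm (1\<^sub>m n - ?a) \<le> 1" by (rule le1)
    have "mat_scaleC (complex_of_real t) (1\<^sub>m n) - a = mat_scaleC (complex_of_real t) (1\<^sub>m n - ?a)"
      using a True by (intro eq_matI) (auto simp: complex_vector.scale_right_diff_distrib scaleC_scaleC scaleC_one)
    then have "mat_norm (mat_scaleC (complex_of_real t) (1\<^sub>m n) - a) = t * mat_norm (1\<^sub>m n - ?a)"
      using a True by (simp only:) (subst mat_norm_scaleC[of _ n n], auto)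
    then show ?thesis using l True by (simp add: mult_left_le)
  next
    case False
    then have t0: "t = 0" "mat_norm a = 0" using mat_norm_nonneg[OF a(1)] assms by auto
    have "mat_norm (mat_scaleC 0 (1\<^sub>m n) - a) \<le> mat_norm (mat_scaleC 0 (1\<^sub>m n) :: 'a mat) + mat_norm a"
      by (rule mat_norm_diff[of _ n n]) (use a in auto)
    also have "\<dots> = 0" using t0 mat_norm_scaleC[OF one_carrier_mat[of n], of 0] by simp
    finally show ?thesis using t0 by simp
  qed
qed

text \<open>The right side mentions only the unit, the adjoint and the norm, all of which complete
  isometries preserve. The root b in \<open>mat_positive\<close>, by contrast, may have entries
  outside the operator system.\<close>

lemma mat_positive_iff:
  "mat_positive n a \<longleftrightarrow> a \<in> carrier_mat n n \<and> mat_star a = a \<and>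
     (\<exists>t. mat_norm (mat_scaleC (complex_of_real t) (1\<^sub>m n) - a) \<le> t)"
  using mat_positiveD[of n a] mat_positive_of_norm[of a n] mat_norm_of_positive[of n a "mat_norm a"] by blast

section \<open>Contractions as corners of positive block matrices\<close>

lemma sum_lessThan_add:
  fixes m n :: nat and f :: "nat \<Rightarrow> 'a::comm_monoid_add"
  shows "(\<Sum>i<m + n. f i) = (\<Sum>i<m. f i) + (\<Sum>i<n. f (m + i))"
  by (induction n) (simp_all add: add.assoc)

lemma cip_append:
  assumes "a \<in> carrier_vec m" "c \<in> carrier_vec m" "b \<in> carrier_vec n" "d \<in> carrier_vec n"
  shows "cip (a @\<^sub>v b) (c @\<^sub>v d) = cip a c + cip b d"
proof -
  have "cip (a @\<^sub>v b) (c @\<^sub>v d) = (\<Sum>i<m + n. star (vec_index (a @\<^sub>v b) i) * vec_index (c @\<^sub>v d) i)"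
    using assms by (simp add: cip_def)
  also have "\<dots> = (\<Sum>i<m. star (vec_index (a @\<^sub>v b) i) * vec_index (c @\<^sub>v d) i)
      + (\<Sum>i<n. star (vec_index (a @\<^sub>v b) (m + i)) * vec_index (c @\<^sub>v d) (m + i))"
    by (rule sum_lessThan_add)
  also have "\<dots> = cip a c + cip b d"
    using assms by (simp add: cip_def)
  finally show ?thesis .
qed

text \<open>If s^2 = 1 - x^* x, the block matrix is b^* b for b with rows 1, x and 0, s. Conversely,
  its form at the column (- x y, y) equals <y, y> - <x y, x y>, which is thus positive in the
  algebra.\<close>

lemma mat_norm_le_one_iff_positive:
  fixes x :: "'a::cstar_algebra mat"
  assumes x: "x \<in> carrier_mat n n"
  shows "mat_norm x \<le> 1 \<longleftrightarrow> mat_positive (n + n) (four_block_mat (1\<^sub>m n) x (mat_star x) (1\<^sub>m n))"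
    (is "_ \<longleftrightarrow> mat_positive _ ?M")
proof
  note x' = mat_star_carrier[OF x]
  have xx: "mat_star x * x \<in> carrier_mat n n" using x by auto
  assume "mat_norm x \<le> 1"
  then have "mat_norm (mat_star x * x) \<le> 1 * 1"
    using mat_norm_nonneg[OF x] mat_norm_star[OF x] by (intro order_trans[OF mat_norm_mult[OF x' x]] mult_mono) auto
  moreover have "mat_star (mat_star x * x) = mat_star x * x" using mat_star_mult[OF x' x] by simp
  ultimately obtain s where s: "s \<in> carrier_mat n n" "mat_star s = s" "s * s = 1\<^sub>m n - mat_star x * x"
    using mat_sqrt_one_minus[OF xx] by auto
  define b where "b = four_block_mat (1\<^sub>m n) x (0\<^sub>m n n) s"
  have b: "b \<in> carrier_mat (n + n) (n + n)" using s by (simp add: b_def)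
  have "mat_star b = four_block_mat (1\<^sub>m n) (0\<^sub>m n n) (mat_star x) s"
  proof (rule eq_matI)
    fix i j assume "i < dim_row (four_block_mat (1\<^sub>m n) (0\<^sub>m n n) (mat_star x) s)"
      "j < dim_col (four_block_mat (1\<^sub>m n) (0\<^sub>m n n) (mat_star x) s)"
    then have ij: "i < n + n" "j < n + n" using s by auto
    have "star (s $$ (p, q)) = s $$ (q, p)" if "p < n" "q < n" for p q
      using mat_star_index[OF s(1) that(2,1)] s(2) by simp
    then show "mat_star b $$ (i, j) = four_block_mat (1\<^sub>m n) (0\<^sub>m n n) (mat_star x) s $$ (i, j)"
      unfolding mat_star_index[OF b ij] using ij s x
      by (cases "i < n"; cases "j < n") (simp_all add: b_def mat_star_index[OF x])
  qed (use s b in auto)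
  note sb = this
  have "mat_star b * b = four_block_mat (1\<^sub>m n * 1\<^sub>m n + 0\<^sub>m n n * 0\<^sub>m n n) (1\<^sub>m n * x + 0\<^sub>m n n * s)
    (mat_star x * 1\<^sub>m n + s * 0\<^sub>m n n) (mat_star x * x + s * s)"
    unfolding sb unfolding b_def by (rule mult_four_block_mat[of _ n n _ n _ n]) (use s x in auto)
  also have "\<dots> = ?M"
    using x s xx x' by (intro cong_four_block_mat) (auto intro!: eq_matI simp: s(3))
  finally show "mat_positive (n + n) ?M" unfolding mat_positive_def using b by (intro bexI[of _ b]) auto
next
  note x' = mat_star_carrier[OF x]
  assume "mat_positive (n + n) ?M"
  then obtain b where b: "b \<in> carrier_mat (n + n) (n + n)" "?M = mat_star b * b" by (auto simp: mat_positive_def)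
  show "mat_norm x \<le> 1"
  proof (rule mat_norm_leI[OF x])
    fix y :: "'a Matrix.vec" assume y: "y \<in> carrier_vec n"
    define z where "z = x *\<^sub>v y"
    have z: "z \<in> carrier_vec n" unfolding z_def by (rule mult_mat_vec_in_carrier[OF x])
    define w where "w = (- z) @\<^sub>v y"
    have w: "w \<in> carrier_vec (n + n)" using y z by (simp add: w_def)
    have bw: "b *\<^sub>v w \<in> carrier_vec (n + n)" by (rule mult_mat_vec_in_carrier[OF b(1)])
    have xz: "mat_star x *\<^sub>v z \<in> carrier_vec n" by (rule mult_mat_vec_in_carrier[OF x'])
    have xz': "mat_star x *\<^sub>v (- z) = - (mat_star x *\<^sub>v z)"
      using mult_minus_distrib_mat_vec[OF x' zero_carrier_vec z] x' z xz by (auto intro!: eq_vecI)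
    have "?M *\<^sub>v w = (1\<^sub>m n *\<^sub>v (- z) + x *\<^sub>v y) @\<^sub>v (mat_star x *\<^sub>v (- z) + 1\<^sub>m n *\<^sub>v y)"
      unfolding w_def by (rule four_block_mat_mult_vec) (use x y z in auto)
    also have "1\<^sub>m n *\<^sub>v (- z) + x *\<^sub>v y = 0\<^sub>v n"
      unfolding z_def[symmetric] using z by (auto intro!: eq_vecI)
    also have "mat_star x *\<^sub>v (- z) + 1\<^sub>m n *\<^sub>v y = y - mat_star x *\<^sub>v z"
    proof -
      have "- u + y = y - u" if "u \<in> carrier_vec n" for u using that y by (auto intro!: eq_vecI)
      then show ?thesis unfolding xz' one_mult_mat_vec[OF y] using xz by blast
    qed
    finally have Mw: "?M *\<^sub>v w = 0\<^sub>v n @\<^sub>v (y - mat_star x *\<^sub>v z)" .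
    have "cip (b *\<^sub>v w) (b *\<^sub>v w) = cip w (?M *\<^sub>v w)"
      unfolding cip_adjoint[OF b(1) w bw] b(2) assoc_mult_mat_vec[OF mat_star_carrier[OF b(1)] b(1) w] ..
    also have "\<dots> = cip (- z) (0\<^sub>v n) + cip y (y - mat_star x *\<^sub>v z)"
      unfolding Mw unfolding w_def by (rule cip_append) (use y z xz in auto)
    also have "\<dots> = cip y y - cip y (mat_star x *\<^sub>v z)"
    proof -
      have "cip (- z) (0\<^sub>v n) = 0" using z unfolding cip_def by (intro sum.neutral) auto
      then show ?thesis using cip_diff_right[OF y y xz] by simp
    qed
    also have "cip y (mat_star x *\<^sub>v z) = cip z z" using cip_adjoint[OF x y z] by (simp add: z_def)
    finally have "cpos (cip y y - cip z z)" using cpos_cip by metis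
    then have "norm (cip z z) \<le> norm (cip y y)" by (intro cpos_norm_mono cpos_cip)
    then show "column_norm (x *\<^sub>v y) \<le> 1 * column_norm y" by (simp add: column_norm_cip flip: z_def)
  qed simp
qed

section \<open>Finite-dimensional subspaces\<close>

lemma closed_if_compact_balls:
  fixes S :: "'a::real_normed_vector set"
  assumes "\<And>r. compact (S \<inter> cball 0 r)"
  shows "closed S"
  unfolding closed_sequential_limits
proof (intro allI impI, elim conjE)
  fix x l assume x: "\<forall>n. x n \<in> S" "x \<longlonglongrightarrow> l"
  obtain r where r: "\<And>n. norm (x n) \<le> r"
    using convergent_imp_Bseq[of x] x(2) by (auto simp: convergent_def Bseq_def)
  have "x n \<in> S \<inter> cball 0 r" for n using x(1) r by simp
  then have "l \<in> S \<inter> cball 0 r"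
    by (rule closed_sequentially[OF compact_imp_closed[OF assms[of r]] _ x(2)])
  then show "l \<in> S" by simp
qed

text \<open>Induction on B. If b lies outside the span V of the rest, V is closed by the induction
  hypothesis and b has distance \<delta> > 0 from it. Then |c| \<delta> <= norm (v + c b) for v in V
  confines the coefficient c to a disc.\<close>

lemma compact_span_cball:
  fixes B :: "'a::complex_normed_vector set"
  assumes "finite B"
  shows "compact (complex_vector.span B \<inter> cball 0 r)"
  using assms
proof (induction B arbitrary: r)
  case (insert b B)
  let ?V = "complex_vector.span B"
  show ?case
  proof (cases "b \<in> ?V")
    case True
    then show ?thesis using insert.IH by (simp add: complex_vector.span_redundant)
  next
    case False
    define \<delta> where "\<delta> = infdist b ?V"
    have clV: "closed ?V" by (rule closed_if_compact_balls) (rule insert.IH)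
    have \<delta>: "\<delta> > 0"
      unfolding \<delta>_def using False clV complex_vector.span_zero by (intro infdist_pos_not_in_closed) auto
    have bound: "cmod c * \<delta> \<le> norm x" if "x - c *\<^sub>C b \<in> ?V" for x c
    proof (cases "c = 0")
      case False
      have "- inverse c *\<^sub>C (x - c *\<^sub>C b) \<in> ?V" using that by (rule complex_vector.span_scale)
      then have "\<delta> \<le> dist b (- inverse c *\<^sub>C (x - c *\<^sub>C b))" unfolding \<delta>_def by (rule infdist_le)
      also have "b - (- inverse c *\<^sub>C (x - c *\<^sub>C b)) = inverse c *\<^sub>C x"
        using False by (simp add: complex_vector.scale_right_diff_distrib scaleC_scaleC scaleC_one)
      then have "dist b (- inverse c *\<^sub>C (x - c *\<^sub>C b)) = norm x / cmod c"
        by (simp only: dist_norm norm_scaleC norm_inverse divide_inverse mult.commute)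
      finally show ?thesis using False by (simp add: field_simps)
    qed simp
    \<comment> \<open>The radius comes from norm (x - c b) <= norm x + |c| norm b and |c| <= r /
      \<delta>.\<close>
    let ?R = "r + r / \<delta> * norm b"
    let ?K = "(?V \<inter> cball 0 ?R) \<times> (cball 0 (r / \<delta>) :: complex set)"
    let ?f = "\<lambda>(v, c). v + c *\<^sub>C b"
    have "complex_vector.span (insert b B) \<inter> cball 0 r = ?f ` ?K \<inter> cball 0 r"
    proof (intro equalityI subsetI)
      fix x assume x: "x \<in> complex_vector.span (insert b B) \<inter> cball 0 r"
      then obtain c where c: "x - c *\<^sub>C b \<in> ?V" by (auto simp: complex_vector.span_breakdown_eq)
      have "cmod c * \<delta> \<le> r" using bound[OF c] x by simp
      then have c': "cmod c \<le> r / \<delta>" using \<delta> by (simp add: field_simps)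
      have "norm (x - c *\<^sub>C b) \<le> norm x + cmod c * norm b"
        by (metis norm_scaleC norm_triangle_ineq4)
      also have "\<dots> \<le> ?R" using x c' by (intro add_mono mult_right_mono) auto
      finally have "(x - c *\<^sub>C b, c) \<in> ?K" using c c' by simp
      moreover have "x = ?f (x - c *\<^sub>C b, c)" by simp
      ultimately show "x \<in> ?f ` ?K \<inter> cball 0 r" using x by blast
    next
      fix x assume "x \<in> ?f ` ?K \<inter> cball 0 r"
      then obtain p where p: "p \<in> ?K" "x = ?f p" "x \<in> cball 0 r" by blast
      define v c where "v = fst p" and "c = snd p"
      have vc: "v \<in> ?V" "x = v + c *\<^sub>C b" "x \<in> cball 0 r"
        using p by (auto simp: v_def c_def)
      have "x - c *\<^sub>C b \<in> ?V" using vc by simp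
      then have "x \<in> complex_vector.span (insert b B)" unfolding complex_vector.span_breakdown_eq ..
      then show "x \<in> complex_vector.span (insert b B) \<inter> cball 0 r" using vc(3) ..
    qed
    moreover have "compact (?f ` ?K)"
    proof (intro compact_continuous_image compact_Times insert.IH compact_cball)
      have "(fst \<longlongrightarrow> x) (at (x, y) within S)" "(snd \<longlongrightarrow> y) (at (x, y) within S)"
        for x :: 'a and y :: complex and S
        using tendsto_fst[OF tendsto_ident_at[of "(x, y)" S]] tendsto_snd[OF tendsto_ident_at[of "(x, y)" S]] by auto
      then show "continuous_on ?K ?f"
        by (auto simp: continuous_on_def case_prod_beta intro!: tendsto_add tendsto_scaleC tendsto_const)
    qed
    ultimately show ?thesis by (simp add: compact_Int_closed)
  qed
qed (simp add: complex_vector.span_empty finite_imp_compact)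

lemma closed_span_finite: "finite (B::'a::complex_normed_vector set) \<Longrightarrow> closed (complex_vector.span B)"
  by (rule closed_if_compact_balls) (rule compact_span_cball)

lemma finite_dimensional_compact_cball: "finite_dimensional X \<Longrightarrow> compact (X \<inter> cball 0 r)"
  by (auto simp: finite_dimensional_def compact_span_cball)

lemma finitely_generated_imp_finite_dimensional:
  "finitely_generated X \<Longrightarrow> finite_dimensional X"
  unfolding finitely_generated_def finite_dimensional_def OSy_def
  by (metis closed_span_finite closure_closed finite.emptyI finite.insertI finite_UnI finite_imageI)

text \<open>The point x is recurrent. Its orbit stays in a compact ball, so two of its terms are
  within \<epsilon> of each other; cancelling the common power of T, some T^k x with k > 0 is within
  \<epsilon> of x. Hence x lies in the closure of the compact image of the ball.\<close>

lemma isometry_into_finite_dimensional_surj: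
  fixes X :: "'a::cstar_algebra set"
  assumes X: "finite_dimensional X" and 0: "0 \<in> X" "T 0 = 0"
    and T: "\<And>x. x \<in> X \<Longrightarrow> T x \<in> X" and iso: "\<And>x y. x \<in> X \<Longrightarrow> y \<in> X \<Longrightarrow> dist (T x) (T y) = dist x y"
    and x: "x \<in> X"
  shows "x \<in> T ` X"
proof -
  let ?K = "X \<inter> cball 0 (norm x)"
  have K: "compact ?K" by (rule finite_dimensional_compact_cball[OF X])
  have TK: "T y \<in> ?K" if "y \<in> ?K" for y
    using that T iso[of y 0] 0 by auto
  define s where "s n = (T ^^ n) x" for n
  have sK: "s n \<in> ?K" for n
    by (induction n) (use x TK in \<open>auto simp: s_def\<close>)
  have shift: "dist (s m) (s (m + n)) = dist x (s n)" for m n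
    by (induction m) (use sK iso in \<open>auto simp: s_def\<close>)
  have "continuous_on ?K T"
    unfolding continuous_on_iff using iso by fastforce
  then have "closed (T ` ?K)" by (intro compact_imp_closed compact_continuous_image K)
  moreover have "x \<in> closure (T ` ?K)"
    unfolding closure_approachable
  proof (intro allI impI)
    fix \<epsilon> :: real assume "\<epsilon> > 0"
    obtain l r where "strict_mono (r :: nat \<Rightarrow> nat)" "(s \<circ> r) \<longlonglongrightarrow> l"
      using K sK unfolding compact_def by metis
    then have "Cauchy (s \<circ> r)" by (intro LIMSEQ_imp_Cauchy)
    then obtain M where M: "\<And>m n. m \<ge> M \<Longrightarrow> n \<ge> M \<Longrightarrow> dist (s (r m)) (s (r n)) < \<epsilon>"
      using \<open>\<epsilon> > 0\<close> unfolding Cauchy_def by force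
    have "r M < r (Suc M)" using \<open>strict_mono r\<close> by (simp add: strict_mono_Suc_iff)
    then obtain k where k: "r (Suc M) = r M + Suc k" using less_iff_Suc_add by auto
    have "dist (s (r M)) (s (r M + Suc k)) < \<epsilon>" using M[of M "Suc M"] by (simp add: k)
    then have "dist (s (Suc k)) x < \<epsilon>" unfolding shift by (simp only: dist_commute)
    moreover have "s (Suc k) \<in> T ` ?K" using sK[of k] by (auto simp: s_def)
    ultimately show "\<exists>y\<in>T ` ?K. dist y x < \<epsilon>" by blast
  qed
  ultimately have "x \<in> T ` ?K" by (simp add: closure_closed)
  then show ?thesis by blast
qed

section \<open>Unital complete order isomorphisms are the unital *-preserving complete isometries\<close>

lemma mats_iff: "x \<in> mats n X \<longleftrightarrow> x \<in> carrier_mat n n \<and> (\<forall>i<n. \<forall>j<n. x $$ (i, j) \<in> X)"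
  unfolding mats_def by (fastforce dest: elements_matD intro: elements_matI)

lemma matsD: "x \<in> mats n X \<Longrightarrow> x \<in> carrier_mat n n" "x \<in> mats n X \<Longrightarrow> i < n \<Longrightarrow> j < n \<Longrightarrow> x $$ (i, j) \<in> X"
  by (auto simp: mats_iff)

lemma operator_systemD:
  assumes "operator_system X"
  shows "1 \<in> X" "0 \<in> X" "x \<in> X \<Longrightarrow> y \<in> X \<Longrightarrow> x + y \<in> X" "x \<in> X \<Longrightarrow> c *\<^sub>C x \<in> X"
    "x \<in> X \<Longrightarrow> y \<in> X \<Longrightarrow> x - y \<in> X" "x \<in> X \<Longrightarrow> - x \<in> X" "x \<in> X \<Longrightarrow> star x \<in> X"
    "(\<And>i. i \<in> I \<Longrightarrow> f i \<in> X) \<Longrightarrow> sum f I \<in> X" "x \<in> X \<Longrightarrow> r *\<^sub>R x \<in> X"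
  using assms unfolding operator_system_def
  by (auto simp: complex_vector.subspace_0 complex_vector.subspace_add complex_vector.subspace_scale
      complex_vector.subspace_diff complex_vector.subspace_neg scaleR_scaleC intro: complex_vector.subspace_sum)

lemma map_mat_in_mats: "x \<in> mats n X \<Longrightarrow> (\<And>a. a \<in> X \<Longrightarrow> u a \<in> Y) \<Longrightarrow> map_mat u x \<in> mats n Y"
  by (auto simp: mats_iff)

definition linear_into :: "'a::cstar_algebra set \<Rightarrow> 'b::cstar_algebra set \<Rightarrow> ('a \<Rightarrow> 'b) \<Rightarrow> bool" where
  "linear_into X Y u \<longleftrightarrow> u ` X \<subseteq> Y \<and> u 1 = 1 \<and> (\<forall>x\<in>X. \<forall>y\<in>X. u (x + y) = u x + u y) \<and>
     (\<forall>c. \<forall>x\<in>X. u (c *\<^sub>C x) = c *\<^sub>C u x)"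

lemma linear_intoD:
  assumes "linear_into X Y u" and X: "operator_system X"
  shows "x \<in> X \<Longrightarrow> u x \<in> Y" "u 1 = 1" "x \<in> X \<Longrightarrow> y \<in> X \<Longrightarrow> u (x + y) = u x + u y" "x \<in> X \<Longrightarrow> u (c *\<^sub>C x) = c *\<^sub>C u x"
    "u 0 = 0" "x \<in> X \<Longrightarrow> u (- x) = - u x" "x \<in> X \<Longrightarrow> y \<in> X \<Longrightarrow> u (x - y) = u x - u y"
    "(\<And>i. i \<in> I \<Longrightarrow> f i \<in> X) \<Longrightarrow> u (sum f I) = (\<Sum>i\<in>I. u (f i))"
proof -
  note [simp] = operator_systemD[OF X]
  have add: "u (x + y) = u x + u y" if "x \<in> X" "y \<in> X" for x y using that assms(1) by (auto simp: linear_into_def)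
  have sc: "u (c *\<^sub>C x) = c *\<^sub>C u x" if "x \<in> X" for c x using that assms(1) by (auto simp: linear_into_def)
  show "x \<in> X \<Longrightarrow> u x \<in> Y" "u 1 = 1" using assms(1) by (auto simp: linear_into_def)
  show "x \<in> X \<Longrightarrow> y \<in> X \<Longrightarrow> u (x + y) = u x + u y" "x \<in> X \<Longrightarrow> u (c *\<^sub>C x) = c *\<^sub>C u x" using add sc by auto
  show u0: "u 0 = 0" using sc[of 1 0] by simp
  have neg: "u (- x) = - u x" if "x \<in> X" for x
    using add[of x "- x"] that u0 by (simp add: add_eq_0_iff)
  show "x \<in> X \<Longrightarrow> u (- x) = - u x" by (rule neg)
  show "x \<in> X \<Longrightarrow> y \<in> X \<Longrightarrow> u (x - y) = u x - u y" using add[of x "- y"] neg[of y] by simp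
  show "(\<And>i. i \<in> I \<Longrightarrow> f i \<in> X) \<Longrightarrow> u (sum f I) = (\<Sum>i\<in>I. u (f i))"
    by (induction I rule: infinite_finite_induct) (auto simp: u0 add)
qed

text \<open>Surjectivity is left out because compactness first yields only embeddings in both
  directions.\<close>

definition complete_isometry :: "'a::cstar_algebra set \<Rightarrow> 'b::cstar_algebra set \<Rightarrow> ('a \<Rightarrow> 'b) \<Rightarrow> bool" where
  "complete_isometry X Y u \<longleftrightarrow> linear_into X Y u \<and> (\<forall>x\<in>X. u (star x) = star (u x)) \<and>
     (\<forall>n\<ge>1. \<forall>x\<in>mats n X. mat_norm (map_mat u x) = mat_norm x)"

lemma complete_isometryD:
  assumes "complete_isometry X Y u"
  shows "linear_into X Y u" "x \<in> X \<Longrightarrow> u (star x) = star (u x)"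
    "n \<ge> 1 \<Longrightarrow> m \<in> mats n X \<Longrightarrow> mat_norm (map_mat u m) = mat_norm m"
  using assms by (auto simp: complete_isometry_def)

lemma complete_isometry_norm:
  assumes u: "complete_isometry X Y u" and X: "operator_system X" and x: "x \<in> X"
  shows "norm (u x) = norm x"
proof -
  let ?m = "Matrix.mat 1 1 (\<lambda>_. x)"
  have "mat_norm (map_mat u ?m) = mat_norm ?m"
    by (rule complete_isometryD(3)[OF u]) (use x in \<open>auto simp: mats_iff\<close>)
  then show ?thesis by (simp add: mat_norm_1x1)
qed

lemma complete_isometry_dist:
  assumes u: "complete_isometry X Y u" and X: "operator_system X" and x: "x \<in> X" "y \<in> X"
  shows "dist (u x) (u y) = dist x y"
  using complete_isometry_norm[OF u X operator_systemD(5)[OF X x]]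
  by (simp add: dist_norm linear_intoD[OF complete_isometryD(1)[OF u] X] x)

lemma complete_isometry_inj:
  assumes "complete_isometry X Y u" "operator_system X"
  shows "inj_on u X"
  by (rule inj_onI) (metis complete_isometry_dist[OF assms] dist_eq_0_iff)

lemma map_mat_star:
  assumes "\<And>x. x \<in> X \<Longrightarrow> u (star x) = star (u x)" "a \<in> mats n X"
  shows "map_mat u (mat_star a) = mat_star (map_mat u a)"
  using assms by (intro eq_matI) (auto simp: mats_iff mat_star_def)

lemma complete_isometry_mat_positive:
  assumes u: "complete_isometry X Y u" and X: "operator_system X" and n: "n \<ge> 1" and x: "x \<in> mats n X"
  shows "mat_positive n (map_mat u x) \<longleftrightarrow> mat_positive n x"
proof -
  note lin = linear_intoD[OF complete_isometryD(1)[OF u] X]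
  have c: "x \<in> carrier_mat n n" using x by (simp add: mats_iff)
  have "mat_star (map_mat u x) = map_mat u x \<longleftrightarrow> mat_star x = x"
  proof -
    have s: "mat_star x \<in> mats n X" using x operator_systemD(7)[OF X] by (auto simp: mats_iff mat_star_def)
    have inj: "mat_star x = x" if "map_mat u (mat_star x) = map_mat u x"
    proof (rule eq_matI)
      fix i j assume ij: "i < dim_row x" "j < dim_col x"
      then have "map_mat u (mat_star x) $$ (i, j) = map_mat u x $$ (i, j)" by (simp add: that)
      then have "u (mat_star x $$ (i, j)) = u (x $$ (i, j))" using ij c by simp
      then show "mat_star x $$ (i, j) = x $$ (i, j)"
        using complete_isometry_inj[OF u X] ij c matsD(2)[OF s] matsD(2)[OF x] by (auto dest: inj_onD)
    qed (use c in auto)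
    show ?thesis using inj map_mat_star[of X u x n, OF complete_isometryD(2)[OF u] x] by auto
  qed
  moreover have "mat_norm (mat_scaleC (complex_of_real t) (1\<^sub>m n) - map_mat u x) = mat_norm (mat_scaleC (complex_of_real t) (1\<^sub>m n) - x)" for t
  proof -
    let ?d = "mat_scaleC (complex_of_real t) (1\<^sub>m n) - x"
    have d: "?d \<in> mats n X" using x operator_systemD[OF X] by (auto simp: mats_iff)
    have "map_mat u ?d = mat_scaleC (complex_of_real t) (1\<^sub>m n) - map_mat u x"
    proof (rule eq_matI)
      fix i j assume "i < dim_row (mat_scaleC (complex_of_real t) (1\<^sub>m n) - map_mat u x)"
        "j < dim_col (mat_scaleC (complex_of_real t) (1\<^sub>m n) - map_mat u x)"
      then have ij: "i < n" "j < n" using c by auto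
      then show "map_mat u ?d $$ (i, j) = (mat_scaleC (complex_of_real t) (1\<^sub>m n) - map_mat u x) $$ (i, j)"
        using c matsD(2)[OF x ij] operator_systemD[OF X] by (simp add: lin)
    qed (use c in auto)
    then show ?thesis using complete_isometryD(3)[OF u n d] by simp
  qed
  ultimately show ?thesis unfolding mat_positive_iff using c by simp
qed

lemma complete_isometry_imp_coi:
  assumes u: "complete_isometry X Y u" and X: "operator_system X" and Y: "operator_system Y" and surj: "u ` X = Y"
  shows "complete_order_isomorphism X Y u"
proof -
  have inj: "inj_on u X" by (rule complete_isometry_inj[OF u X])
  have into: "x \<in> X \<Longrightarrow> u x \<in> Y" for x using surj by auto
  have cp: "completely_positive X Y u"
    unfolding completely_positive_def positive_cone_def
    using complete_isometry_mat_positive[OF u X] map_mat_in_mats[of _ _ X u Y, OF _ into] by auto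
  have cp': "completely_positive Y X (inv_into X u)"
    unfolding completely_positive_def positive_cone_def
  proof (intro allI impI ballI CollectI, elim CollectE conjE, intro conjI)
    fix n :: nat and y assume n: "1 \<le> n" and y: "y \<in> mats n Y" "mat_positive n y"
    show m: "map_mat (inv_into X u) y \<in> mats n X"
      using surj by (intro map_mat_in_mats[OF y(1)]) (auto intro: inv_into_into)
    have "map_mat u (map_mat (inv_into X u) y) = y"
      using matsD[OF y(1)] surj by (intro eq_matI) (auto simp: f_inv_into_f)
    then show "mat_positive n (map_mat (inv_into X u) y)"
      using complete_isometry_mat_positive[OF u X n m] y(2) by simp
  qed
  show ?thesis
    unfolding complete_order_isomorphism_def
    using inj surj cp cp' complete_isometryD(1)[OF u] by (auto simp: bij_betw_def linear_into_def)
qed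

lemma coi_linear_into: "complete_order_isomorphism X Y u \<Longrightarrow> linear_into X Y u"
  by (auto simp: complete_order_isomorphism_def linear_into_def bij_betw_def)

lemma positive_coneI: "x \<in> mats n X \<Longrightarrow> mat_positive n x \<Longrightarrow> x \<in> positive_cone n X"
  by (simp add: positive_cone_def)

text \<open>A self-adjoint a becomes positive when its norm is added, so u maps it to a self-adjoint
  element. A general x is split into real and imaginary parts.\<close>

lemma completely_positive_star:
  assumes u: "linear_into X Y u" "completely_positive X Y u" and X: "operator_system X" and x: "x \<in> X"
  shows "u (star x) = star (u x)"
proof -
  note lin = linear_intoD[OF u(1) X]
  note sys = operator_systemD[OF X]
  have sa: "star (u a) = u a" if a: "a \<in> X" "star a = a" for a
  proof -
    let ?r = "complex_of_real (norm a)"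
    let ?m = "Matrix.mat 1 1 (\<lambda>_. ?r *\<^sub>C 1 + a)"
    have "mat_positive 1 ?m"
    proof (rule mat_positive_of_norm)
      show "mat_star ?m = ?m" using a by (intro eq_matI) (auto simp: mat_star_def star_add star_scaleC)
      have "mat_scaleC ?r (1\<^sub>m 1) - ?m = Matrix.mat 1 1 (\<lambda>_. - a)" by (intro eq_matI) auto
      then show "mat_norm (mat_scaleC ?r (1\<^sub>m 1) - ?m) \<le> norm a" by (simp add: mat_norm_1x1)
    qed simp
    moreover have "?m \<in> mats 1 X" using a sys by (auto simp: mats_iff)
    ultimately have "map_mat u ?m \<in> positive_cone 1 Y"
      using u(2) unfolding completely_positive_def by (auto intro: positive_coneI)
    then have "mat_positive 1 (map_mat u ?m)" by (simp add: positive_cone_def)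
    then have "mat_star (map_mat u ?m) $$ (0, 0) = map_mat u ?m $$ (0, 0)" using mat_positiveD(2) by metis
    then have "star (u (?r *\<^sub>C 1 + a)) = u (?r *\<^sub>C 1 + a)" by (simp add: mat_star_def)
    then show ?thesis using a sys by (simp add: lin star_add star_scaleC)
  qed
  define a where "a = (1/2::complex) *\<^sub>C (x + star x)"
  define b where "b = (\<i>/2) *\<^sub>C (star x - x)"
  have ab: "a \<in> X" "b \<in> X" using x sys by (auto simp: a_def b_def)
  have "star a = a" by (simp add: a_def star_scaleC star_add add.commute)
  have "star b = b" by (simp add: b_def star_scaleC star_diff complex_vector.scale_right_diff_distrib)
  have half: "(1/2::complex) *\<^sub>C z + (1/2::complex) *\<^sub>C z = z" for z :: 'a
    by (simp flip: scaleC_add_left add: scaleC_one)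
  have "x = a + \<i> *\<^sub>C b" "star x = a - \<i> *\<^sub>C b"
    by (simp_all add: a_def b_def scaleC_scaleC scaleC_add_right complex_vector.scale_right_diff_distrib half algebra_simps)
  moreover have "u (a - \<i> *\<^sub>C b) = star (u (a + \<i> *\<^sub>C b))"
    using ab sa[OF ab(1) \<open>star a = a\<close>] sa[OF ab(2) \<open>star b = b\<close>] sys by (simp add: lin star_add star_scaleC)
  ultimately show ?thesis by metis
qed

text \<open>Scaled to norm at most 1, x is the corner of a positive matrix of size 2 n, and u maps
  this to the corresponding matrix with corner u x. The slack e keeps the scale t positive when x =
  0.\<close>

lemma completely_positive_contractive:
  assumes u: "linear_into X Y u" "completely_positive X Y u" and X: "operator_system X" and n: "n \<ge> 1" and x: "x \<in> mats n X"
  shows "mat_norm (map_mat u x) \<le> mat_norm x"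
proof (rule field_le_epsilon)
  fix e :: real assume "e > 0"
  note lin = linear_intoD[OF u(1) X]
  note sys = operator_systemD[OF X]
  have c: "x \<in> carrier_mat n n" using x by (simp add: mats_iff)
  define t where "t = mat_norm x + e"
  have t: "t > 0" using mat_norm_nonneg[OF c] \<open>e > 0\<close> by (simp add: t_def)
  define z where "z = mat_scaleC (complex_of_real (1/t)) x"
  have z: "z \<in> mats n X" using x sys by (auto simp: z_def mats_iff)
  then have zc: "z \<in> carrier_mat n n" by (simp add: mats_iff)
  let ?M = "four_block_mat (1\<^sub>m n) z (mat_star z) (1\<^sub>m n)"
  have "mat_norm z = (1/t) * mat_norm x"
    unfolding z_def mat_norm_scaleC[OF c] using t by (simp add: norm_divide)
  then have "mat_norm z \<le> 1" using t \<open>e > 0\<close> by (simp add: t_def divide_le_eq)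
  then have "mat_positive (n + n) ?M" using mat_norm_le_one_iff_positive[OF zc] by simp
  moreover have "?M \<in> mats (n + n) X"
    unfolding mats_iff
  proof (intro conjI allI impI)
    fix i j assume "i < n + n" "j < n + n"
    then show "?M $$ (i, j) \<in> X" using zc matsD(2)[OF z] sys by (auto simp: mat_star_index[OF zc])
  qed (use zc in simp)
  ultimately have "?M \<in> positive_cone (n + n) X" by (rule positive_coneI[rotated])
  moreover have "n + n \<ge> 1" using n by simp
  ultimately have "map_mat u ?M \<in> positive_cone (n + n) Y"
    using u(2) unfolding completely_positive_def by blast
  moreover have uz: "map_mat u z \<in> carrier_mat n n" using zc by simp
  moreover have "map_mat u ?M = four_block_mat (1\<^sub>m n) (map_mat u z) (mat_star (map_mat u z)) (1\<^sub>m n)"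
  proof -
    have "map_mat u (1\<^sub>m n) = 1\<^sub>m n" by (rule eq_matI) (auto simp: lin)
    then show ?thesis
      using map_four_block_mat[OF one_carrier_mat zc mat_star_carrier[OF zc] one_carrier_mat, of u]
        map_mat_star[of X u z n, OF completely_positive_star[OF u X] z] by simp
  qed
  ultimately have "mat_norm (map_mat u z) \<le> 1"
    using mat_norm_le_one_iff_positive[OF uz] by (simp add: positive_cone_def)
  moreover have "map_mat u z = mat_scaleC (complex_of_real (1/t)) (map_mat u x)"
    using x by (intro eq_matI) (auto simp: z_def mats_iff lin)
  then have "mat_norm (map_mat u z) = (1/t) * mat_norm (map_mat u x)"
    using mat_norm_scaleC[of "map_mat u x" n n "complex_of_real (1/t)"] c t by (simp add: norm_divide)
  ultimately show "mat_norm (map_mat u x) \<le> mat_norm x + e" using t by (simp add: t_def divide_le_eq)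
qed

lemma coi_inverse:
  assumes u: "complete_order_isomorphism X Y u" and X: "operator_system X"
  shows "complete_order_isomorphism Y X (inv_into X u)"
proof -
  let ?v = "inv_into X u"
  have bij: "bij_betw u X Y" using u by (simp add: complete_order_isomorphism_def)
  note lin = linear_intoD[OF coi_linear_into[OF u] X]
  note sys = operator_systemD[OF X]
  have v: "y \<in> Y \<Longrightarrow> ?v y \<in> X \<and> u (?v y) = y" for y
    using bij by (auto simp: bij_betw_def f_inv_into_f inv_into_into)
  have vu: "x \<in> X \<Longrightarrow> ?v (u x) = x" for x using bij by (simp add: bij_betw_def)
  have vu': "x \<in> X \<Longrightarrow> inv_into Y ?v x = u x" for x
    using bij bij_betw_inv_into[OF bij] by (metis bij_betw_def inv_into_f_f lin(1) vu)
  have "?v (x + y) = ?v x + ?v y" if "x \<in> Y" "y \<in> Y" for x y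
    using vu[of "?v x + ?v y"] v[OF that(1)] v[OF that(2)] sys by (simp add: lin)
  moreover have "?v (c *\<^sub>C x) = c *\<^sub>C ?v x" if "x \<in> Y" for c x
    using vu[of "c *\<^sub>C ?v x"] v[OF that(1)] sys by (simp add: lin)
  moreover have "?v 1 = 1" using vu[of 1] sys lin by simp
  moreover have "completely_positive X Y (inv_into Y ?v)"
  proof -
    have "map_mat (inv_into Y ?v) x = map_mat u x" if "x \<in> mats n X" for n x
      using that by (intro eq_matI) (auto simp: mats_iff vu')
    then show ?thesis using u unfolding complete_order_isomorphism_def completely_positive_def positive_cone_def
      by auto
  qed
  ultimately show ?thesis
    using u bij_betw_inv_into[OF bij] unfolding complete_order_isomorphism_def by auto
qed

lemma coi_complete_isometry:
  assumes u: "complete_order_isomorphism X Y u" and X: "operator_system X" and Y: "operator_system Y"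
  shows "complete_isometry X Y u"
proof -
  let ?v = "inv_into X u"
  note v = coi_inverse[OF u X]
  have cp: "completely_positive X Y u" "completely_positive Y X ?v"
    using u by (auto simp: complete_order_isomorphism_def)
  have bij: "bij_betw u X Y" using u by (simp add: complete_order_isomorphism_def)
  have "mat_norm (map_mat u x) = mat_norm x" if n: "n \<ge> 1" and x: "x \<in> mats n X" for n x
  proof (rule antisym)
    show "mat_norm (map_mat u x) \<le> mat_norm x"
      by (rule completely_positive_contractive[OF coi_linear_into[OF u] cp(1) X n x])
    have ux: "map_mat u x \<in> mats n Y" using bij by (intro map_mat_in_mats[OF x]) (auto simp: bij_betw_def)
    have "map_mat ?v (map_mat u x) = x"
      using x bij by (intro eq_matI) (auto simp: mats_iff bij_betw_def)
    then show "mat_norm x \<le> mat_norm (map_mat u x)"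
      using completely_positive_contractive[OF coi_linear_into[OF v] cp(2) Y n ux] by simp
  qed
  then show ?thesis
    unfolding complete_isometry_def
    using coi_linear_into[OF u] completely_positive_star[OF coi_linear_into[OF u] cp(1) X] by blast
qed

lemma complete_isometry_comp:
  assumes u: "complete_isometry X Y u" and v: "complete_isometry Y Z v" and X: "operator_system X" and Y: "operator_system Y"
  shows "complete_isometry X Z (v \<circ> u)"
proof -
  note lu = linear_intoD[OF complete_isometryD(1)[OF u] X]
  note lv = linear_intoD[OF complete_isometryD(1)[OF v] Y]
  have "map_mat (v \<circ> u) x = map_mat v (map_mat u x)" for x by (rule eq_matI) auto
  moreover have "map_mat u x \<in> mats n Y" if "x \<in> mats n X" for n x
    using lu by (intro map_mat_in_mats[OF that])
  ultimately show ?thesis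
    unfolding complete_isometry_def linear_into_def
    using lu lv complete_isometryD(2,3)[OF u] complete_isometryD(2,3)[OF v] by auto
qed

lemma completely_order_isomorphic_sym:
  "completely_order_isomorphic X Y \<Longrightarrow> operator_system X \<Longrightarrow> completely_order_isomorphic Y X"
  unfolding completely_order_isomorphic_def using coi_inverse by blast

text \<open>The composite of u and v is an isometry of X into itself, so it is onto X and v must be
  onto X too. The isomorphism obtained is the inverse of v, not u itself.\<close>

lemma completely_order_isomorphic_of_embeddings:
  assumes u: "complete_isometry X Y u" and v: "complete_isometry Y X v"
    and X: "operator_system X" "finite_dimensional X" and Y: "operator_system Y"
  shows "completely_order_isomorphic X Y"
proof -
  have vu: "complete_isometry X X (v \<circ> u)" by (rule complete_isometry_comp[OF u v X(1) Y])
  have "x \<in> (v \<circ> u) ` X" if "x \<in> X" for x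
  proof (rule isometry_into_finite_dimensional_surj[OF X(2)])
    show "0 \<in> X" using operator_systemD[OF X(1)] by simp
    show "(v \<circ> u) 0 = 0" "x \<in> X \<Longrightarrow> (v \<circ> u) x \<in> X" for x
      by (fact linear_intoD[OF complete_isometryD(1)[OF vu] X(1)])+
    show "x \<in> X \<Longrightarrow> y \<in> X \<Longrightarrow> dist ((v \<circ> u) x) ((v \<circ> u) y) = dist x y" for x y
      by (rule complete_isometry_dist[OF vu X(1)])
  qed fact
  then have "v ` Y = X"
    using linear_intoD(1)[OF complete_isometryD(1)[OF u] X(1)] linear_intoD(1)[OF complete_isometryD(1)[OF v] Y] by fastforce
  then have "complete_order_isomorphism Y X v" by (rule complete_isometry_imp_coi[OF v Y X(1)])
  then show ?thesis using coi_inverse[OF _ Y] unfolding completely_order_isomorphic_def by blast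
qed

section \<open>Words and matrix combinations of words\<close>

text \<open>The words of a sequence \<open>y\<close> enumerate \<open>1, y\<^sub>0, y\<^sub>0\<^sup>*, y\<^sub>1, y\<^sub>1\<^sup>*, \<dots>\<close>\<close>

definition word :: "(nat \<Rightarrow> 'a::cstar_algebra) \<Rightarrow> nat \<Rightarrow> 'a" where
  "word y k = (if k = 0 then 1 else if odd k then y (k div 2) else star (y (k div 2 - 1)))"

text \<open>The involution that the adjoint induces on indices. It preserves the initial segments of
  length \<open>Suc (2 * d)\<close>, which is why the spans of words are cut there.\<close>

definition word_swap :: "nat \<Rightarrow> nat" where
  "word_swap k = (if k = 0 then 0 else if odd k then Suc k else k - 1)"

lemma word_simps [simp]:
  "word y 0 = 1" "word y (Suc (2 * i)) = y i" "word y (Suc (Suc (2 * i))) = star (y i)"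
  by (auto simp: word_def)

lemma word_cases:
  obtains "k = 0" | i where "k = Suc (2 * i)" | i where "k = Suc (Suc (2 * i))"
proof (cases k)
  case (Suc j)
  then show ?thesis using that by (cases "even j") (auto elim!: evenE oddE)
qed (use that in blast)

lemma word_swap_simps [simp]:
  "word_swap 0 = 0" "word_swap (Suc (2 * i)) = Suc (Suc (2 * i))" "word_swap (Suc (Suc (2 * i))) = Suc (2 * i)"
  by (auto simp: word_swap_def)

lemma star_word: "star (word y k) = word y (word_swap k)"
  by (cases k rule: word_cases) auto

lemma word_swap_swap [simp]: "word_swap (word_swap k) = k"
  by (cases k rule: word_cases) auto

lemma word_swap_less: "k < Suc (2 * d) \<Longrightarrow> word_swap k < Suc (2 * d)"
  by (cases k rule: word_cases) auto

lemma range_word: "range (word y) = {1} \<union> range y \<union> star ` range y"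
proof (intro equalityI subsetI)
  fix x assume "x \<in> range (word y)"
  then obtain k where "x = word y k" by blast
  then show "x \<in> {1} \<union> range y \<union> star ` range y" by (cases k rule: word_cases) auto
next
  fix x assume "x \<in> {1} \<union> range y \<union> star ` range y"
  moreover have "1 \<in> range (word y)" "y i \<in> range (word y)" "star (y i) \<in> range (word y)" for i
    by (metis rangeI word_simps(1), metis rangeI word_simps(2), metis rangeI word_simps(3))
  ultimately show "x \<in> range (word y)" by auto
qed

lemma word_in: "operator_system X \<Longrightarrow> (\<And>i. y i \<in> X) \<Longrightarrow> word y k \<in> X"
  by (cases k rule: word_cases) (auto simp: operator_systemD)

text \<open>The crude bound i < k lets the number N of words in a combination double as a bound on
  the entries of the sequence that occur.\<close>

lemma word_cong: "(\<And>i. i < k \<Longrightarrow> y i = z i) \<Longrightarrow> word y k = word z k"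
  by (cases k rule: word_cases) auto

lemma tendsto_word: "(\<And>i. ((\<lambda>t. y t i) \<longlongrightarrow> l i) F) \<Longrightarrow> ((\<lambda>t. word (y t) k) \<longlongrightarrow> word l k) F"
  by (cases k rule: word_cases) (auto intro: tendsto_star)

definition comb :: "nat \<Rightarrow> (nat \<Rightarrow> complex) \<Rightarrow> (nat \<Rightarrow> 'a::cstar_algebra) \<Rightarrow> 'a" where
  "comb N c y = (\<Sum>k<N. c k *\<^sub>C word y k)"

text \<open>The entries of an \<open>n \<times> n\<close> matrix are numbered in row-major order.\<close>

definition mcomb :: "nat \<Rightarrow> nat \<Rightarrow> (nat \<Rightarrow> nat \<Rightarrow> complex) \<Rightarrow> (nat \<Rightarrow> 'a::cstar_algebra) \<Rightarrow> 'a mat" where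
  "mcomb n N c y = Matrix.mat n n (\<lambda>(i, j). comb N (c (i * n + j)) y)"

lemma mcomb_carrier [simp]: "mcomb n N c y \<in> carrier_mat n n"
  by (simp add: mcomb_def)

lemma comb_cong: "(\<And>i. i < N \<Longrightarrow> y i = z i) \<Longrightarrow> comb N c y = comb N c z"
  unfolding comb_def by (intro sum.cong refl arg_cong[of _ _ "scaleC _"] word_cong) auto

lemma mcomb_cong: "(\<And>i. i < N \<Longrightarrow> y i = z i) \<Longrightarrow> mcomb n N c y = mcomb n N c z"
  using comb_cong[of N y z] by (simp add: mcomb_def)

lemma comb_in: "operator_system X \<Longrightarrow> (\<And>i. y i \<in> X) \<Longrightarrow> comb N c y \<in> X"
  unfolding comb_def by (intro operator_systemD(8) operator_systemD(4) word_in) auto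

lemma mcomb_in: "operator_system X \<Longrightarrow> (\<And>i. y i \<in> X) \<Longrightarrow> mcomb n N c y \<in> mats n X"
  by (auto simp: mats_iff mcomb_def intro!: comb_in)

lemma tendsto_comb:
  assumes "\<And>k. ((\<lambda>t. c t k) \<longlongrightarrow> C k) F" "\<And>i. ((\<lambda>t. y t i) \<longlongrightarrow> l i) F"
  shows "((\<lambda>t. comb N (c t) (y t)) \<longlongrightarrow> comb N C l) F"
  unfolding comb_def by (intro tendsto_sum tendsto_scaleC tendsto_word assms)

lemma tendsto_mat_norm_mcomb:
  assumes "\<And>p k. ((\<lambda>t. c t p k) \<longlongrightarrow> C p k) F" "\<And>i. ((\<lambda>t. y t i) \<longlongrightarrow> l i) F"
  shows "((\<lambda>t. mat_norm (mcomb n N (c t) (y t))) \<longlongrightarrow> mat_norm (mcomb n N C l)) F"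
proof (rule tendsto_mat_norm)
  fix i j assume "i < n" "j < n"
  then show "((\<lambda>t. mcomb n N (c t) (y t) $$ (i, j)) \<longlongrightarrow> mcomb n N C l $$ (i, j)) F"
    using tendsto_comb[of "\<lambda>t. c t (i * n + j)" "C (i * n + j)", OF assms] by (simp add: mcomb_def)
qed auto

lemma comb_add: "comb N (\<lambda>k. c k + d k) y = comb N c y + comb N d y"
  by (simp add: comb_def scaleC_add_left sum.distrib)

lemma comb_scaleC: "comb N (\<lambda>k. a * c k) y = a *\<^sub>C comb N c y"
  by (simp add: comb_def complex_vector.scale_sum_right scaleC_scaleC)

lemma comb_diff: "comb N (\<lambda>k. c k - d k) y = comb N c y - comb N d y"
  by (simp add: comb_def complex_vector.scale_left_diff_distrib sum_subtractf)

lemma comb_single: "k < N \<Longrightarrow> comb N (\<lambda>i. if i = k then a else 0) y = a *\<^sub>C word y k"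
  by (simp add: comb_def if_distrib[of "\<lambda>c. c *\<^sub>C _"] cong: if_cong)

lemma star_comb: "star (comb (Suc (2 * d)) c y) = comb (Suc (2 * d)) (\<lambda>k. cnj (c (word_swap k))) y"
  unfolding comb_def star_sum star_scaleC star_word
  by (rule sum.reindex_bij_witness[of _ word_swap word_swap]) (auto simp: word_swap_less simp del: lessThan_Suc)

lemma span_words: "complex_vector.span (word y ` {..<N}) = {comb N c y | c. True}"
proof (intro equalityI complex_vector.span_minimal)
  show "word y ` {..<N} \<subseteq> {comb N c y |c. True}"
    using comb_single[of _ N 1 y] by (auto simp: scaleC_one) metis
  show "complex_vector.subspace {comb N c y |c. True}"
    unfolding complex_vector.subspace_def
  proof (intro conjI ballI allI)
    show "0 \<in> {comb N c y |c. True}" using comb_scaleC[of N 0 "\<lambda>_. 0" y] by auto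
    show "a + b \<in> {comb N c y |c. True}" if "a \<in> {comb N c y |c. True}" "b \<in> {comb N c y |c. True}" for a b
      using that comb_add[of N _ _ y, symmetric] by auto
    show "s *\<^sub>C a \<in> {comb N c y |c. True}" if "a \<in> {comb N c y |c. True}" for s a
      using that comb_scaleC[of N s _ y, symmetric] by auto
  qed
  show "{comb N c y |c. True} \<subseteq> complex_vector.span (word y ` {..<N})"
    unfolding comb_def
    by (auto intro!: complex_vector.span_sum complex_vector.span_scale intro: complex_vector.span_base)
qed

section \<open>A countable dense family of coefficients\<close>

text \<open>Finitely supported sequences of Gaussian rationals coded by single numbers. The codes
  make the norm conditions a countable type while the coefficients remain legal in terms of the
  language.\<close>

definition gcoef :: "nat \<Rightarrow> nat \<Rightarrow> complex" where
  "gcoef s p = (let l = (from_nat s :: (rat \<times> rat) list) in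
     if p < length l then Complex (of_rat (fst (l ! p))) (of_rat (snd (l ! p))) else 0)"

definition gcoef2 :: "nat \<Rightarrow> nat \<Rightarrow> nat \<Rightarrow> complex" where
  "gcoef2 s p k = gcoef s (prod_encode (p, k))"

lemma gcoef_gaussian: "gcoef s p \<in> gaussian_rationals"
  by (auto simp: gcoef_def gaussian_rationals_def Let_def)

lemma of_rat_approx: "\<delta> > 0 \<Longrightarrow> \<exists>q. \<bar>of_rat q - (x::real)\<bar> < \<delta>"
  using of_rat_dense[of "x - \<delta>" "x + \<delta>"] by (auto simp: abs_less_iff algebra_simps)

lemma gcoef_dense:
  assumes "\<delta> > 0"
  shows "\<exists>s. \<forall>p<K. cmod (gcoef s p - C p) < \<delta>"
proof -
  have "\<delta> / 2 > 0" using assms by simp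
  note ap = of_rat_approx[OF this]
  have "\<forall>p. \<exists>q. \<bar>of_rat q - Re (C p)\<bar> < \<delta> / 2" "\<forall>p. \<exists>q. \<bar>of_rat q - Im (C p)\<bar> < \<delta> / 2" using ap by blast+
  then obtain a b where a: "\<And>p. \<bar>of_rat (a p) - Re (C p)\<bar> < \<delta> / 2" and b: "\<And>p. \<bar>of_rat (b p) - Im (C p)\<bar> < \<delta> / 2"
    by metis
  let ?l = "map (\<lambda>p. (a p, b p)) [0..<K]"
  have "cmod (gcoef (to_nat ?l) p - C p) < \<delta>" if "p < K" for p
  proof -
    have "gcoef (to_nat ?l) p - C p = Complex (of_rat (a p) - Re (C p)) (of_rat (b p) - Im (C p))"
      using that by (simp add: gcoef_def complex_eq_iff)
    then have "cmod (gcoef (to_nat ?l) p - C p) \<le> \<bar>of_rat (a p) - Re (C p)\<bar> + \<bar>of_rat (b p) - Im (C p)\<bar>"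
      using cmod_le[of "Complex (of_rat (a p) - Re (C p)) (of_rat (b p) - Im (C p))"] by simp
    then show ?thesis using a[of p] b[of p] by simp
  qed
  then show ?thesis by blast
qed

lemma gcoef_dense_seq: "\<exists>s. \<forall>p. (\<lambda>t. gcoef (s t) p) \<longlonglongrightarrow> C p"
proof -
  \<comment> \<open>Accuracy 1 / (t + 1) on the first t coordinates only is enough for convergence
    in each coordinate.\<close>
  have "\<exists>s. \<forall>p<t. cmod (gcoef s p - C p) < inverse (real (Suc t))" for t by (rule gcoef_dense) simp
  then obtain s where s: "\<And>t p. p < t \<Longrightarrow> cmod (gcoef (s t) p - C p) < inverse (real (Suc t))" by metis
  have "(\<lambda>t. gcoef (s t) p - C p) \<longlonglongrightarrow> 0" for p
  proof (rule Lim_null_comparison[OF _ LIMSEQ_inverse_real_of_nat])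
    show "\<forall>\<^sub>F t in sequentially. norm (gcoef (s t) p - C p) \<le> inverse (real (Suc t))"
      using eventually_gt_at_top[of p] by eventually_elim (rule less_imp_le, rule s)
  qed
  then show ?thesis by (auto simp: LIM_zero_iff)
qed

lemma gcoef2_dense_seq: "\<exists>s. \<forall>p k. (\<lambda>t. gcoef2 (s t) p k) \<longlonglongrightarrow> C p k"
proof -
  obtain s where s: "\<And>q. (\<lambda>t. gcoef (s t) q) \<longlonglongrightarrow> (\<lambda>(p, k). C p k) (prod_decode q)"
    using gcoef_dense_seq[of "\<lambda>q. (\<lambda>(p, k). C p k) (prod_decode q)"] by blast
  have "(\<lambda>t. gcoef2 (s t) p k) \<longlonglongrightarrow> C p k" for p k
    using s[of "prod_encode (p, k)"] by (simp add: gcoef2_def)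
  then show ?thesis by blast
qed

section \<open>Approximate realization of matrix norms determines a finite-dimensional operator system\<close>

text \<open>A condition \<open>(n, N, s, r)\<close> on a sequence \<open>y\<close> asks that the norm of a matrix of size \<open>n + 1\<close> over the first
  \<open>N\<close> words of \<open>y\<close>, with coefficients coded by \<open>s\<close>, be close to \<open>r\<close>.\<close>

type_synonym norm_conditions = "(nat \<times> nat \<times> nat \<times> rat) list"

definition condition_norm :: "nat \<times> nat \<times> nat \<times> rat \<Rightarrow> (nat \<Rightarrow> 'a::cstar_algebra) \<Rightarrow> real" where
  "condition_norm q y = (case q of (n, N, s, r) \<Rightarrow> mat_norm (mcomb (Suc n) N (gcoef2 s) y))"

definition condition_value :: "nat \<times> nat \<times> nat \<times> rat \<Rightarrow> real" where
  "condition_value q = (case q of (n, N, s, r) \<Rightarrow> of_rat r)"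

definition condition_bound :: "nat \<times> nat \<times> nat \<times> rat \<Rightarrow> nat" where
  "condition_bound q = (case q of (n, N, s, r) \<Rightarrow> N)"

definition defect :: "norm_conditions \<Rightarrow> (nat \<Rightarrow> 'a::cstar_algebra) \<Rightarrow> real" where
  "defect S y = (\<Sum>j<length S. \<bar>condition_norm (S ! j) y - condition_value (S ! j)\<bar>)"

text \<open>Strict inequalities throughout, so that a realization survives small perturbations and
  can be sought among rational combinations.\<close>

definition realizes_open :: "'a::cstar_algebra set \<Rightarrow> norm_conditions \<Rightarrow> nat \<Rightarrow> bool" where
  "realizes_open X S a \<longleftrightarrow> (\<exists>y. (\<forall>i. y i \<in> X \<and> norm (y i) < 1) \<and> defect S y < inverse (real (Suc a)))"

text \<open>The closed ball is the quantifier domain of the sentences, and its compactness in finite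
  dimension gives the exact realization.\<close>

definition realizes_closed :: "'a::cstar_algebra set \<Rightarrow> norm_conditions \<Rightarrow> nat \<Rightarrow> bool" where
  "realizes_closed X S a \<longleftrightarrow> (\<exists>y. (\<forall>i. y i \<in> X \<and> norm (y i) \<le> 1) \<and> defect S y < inverse (real (Suc a)))"

lemma realizes_open_imp_closed: "realizes_open X S a \<Longrightarrow> realizes_closed X S a"
  unfolding realizes_open_def realizes_closed_def by (meson less_imp_le)

lemma defect_cong:
  assumes "\<And>i. i < Max (insert 0 (condition_bound ` set S)) \<Longrightarrow> y i = z i"
  shows "defect S y = defect S z"
  unfolding defect_def
proof (intro sum.cong refl)
  fix j assume "j \<in> {..<length S}"
  then have "condition_bound (S ! j) \<le> Max (insert 0 (condition_bound ` set S))"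
    by (intro Max_ge) auto
  then have "y i = z i" if "i < condition_bound (S ! j)" for i
    using assms that by (meson less_le_trans)
  then have "condition_norm (S ! j) y = condition_norm (S ! j) z"
    unfolding condition_norm_def condition_bound_def
    by (cases "S ! j") (auto intro!: arg_cong[of _ _ mat_norm] mcomb_cong)
  then show "\<bar>condition_norm (S ! j) y - condition_value (S ! j)\<bar> = \<bar>condition_norm (S ! j) z - condition_value (S ! j)\<bar>" by simp
qed

lemma tendsto_defect:
  assumes "\<And>i. ((\<lambda>t. y t i) \<longlongrightarrow> l i) F"
  shows "((\<lambda>t. defect S (y t)) \<longlongrightarrow> defect S l) F"
  unfolding defect_def
proof (intro tendsto_sum tendsto_rabs tendsto_diff tendsto_const)
  fix j
  show "((\<lambda>t. condition_norm (S ! j) (y t)) \<longlongrightarrow> condition_norm (S ! j) l) F"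
    unfolding condition_norm_def by (cases "S ! j") (auto intro!: tendsto_mat_norm_mcomb assms)
qed

lemma complete_isometry_word:
  assumes u: "complete_isometry X Y u" and X: "operator_system X" and y: "\<And>i. y i \<in> X"
  shows "word (\<lambda>i. u (y i)) k = u (word y k)"
  by (cases k rule: word_cases)
    (simp_all add: linear_intoD[OF complete_isometryD(1)[OF u] X] complete_isometryD(2)[OF u] y)

lemma complete_isometry_comb:
  assumes u: "complete_isometry X Y u" and X: "operator_system X" and y: "\<And>i. y i \<in> X"
  shows "comb N c (\<lambda>i. u (y i)) = u (comb N c y)"
proof -
  note lin = linear_intoD[OF complete_isometryD(1)[OF u] X]
  have "u (comb N c y) = (\<Sum>k<N. u (c k *\<^sub>C word y k))"
    unfolding comb_def by (intro lin(8) operator_systemD(4)[OF X] word_in[OF X] y)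
  then show ?thesis
    by (simp add: comb_def complete_isometry_word[OF assms] lin(4)[OF word_in[OF X y]])
qed

lemma complete_isometry_mcomb_norm:
  assumes u: "complete_isometry X Y u" and X: "operator_system X" and y: "\<And>i. y i \<in> X" and n: "n \<ge> 1"
  shows "mat_norm (mcomb n N c (\<lambda>i. u (y i))) = mat_norm (mcomb n N c y)"
proof -
  have "mcomb n N c (\<lambda>i. u (y i)) = map_mat u (mcomb n N c y)"
    by (rule eq_matI) (auto simp: mcomb_def complete_isometry_comb[OF u X y])
  then show ?thesis using complete_isometryD(3)[OF u n mcomb_in[OF X y]] by simp
qed

lemma complete_isometry_defect:
  assumes u: "complete_isometry X Y u" and X: "operator_system X" and y: "\<And>i. y i \<in> X"
  shows "defect S (\<lambda>i. u (y i)) = defect S y"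
  unfolding defect_def condition_norm_def
  by (auto split: prod.splits simp: complete_isometry_mcomb_norm[OF assms] intro!: sum.cong)

lemma complete_isometry_realizes_open:
  assumes u: "complete_isometry X Y u" and X: "operator_system X" and r: "realizes_open X S a"
  shows "realizes_open Y S a"
proof -
  obtain y where y: "\<And>i. y i \<in> X" "\<And>i. norm (y i) < 1" "defect S y < inverse (real (Suc a))"
    using r by (auto simp: realizes_open_def)
  show ?thesis
    unfolding realizes_open_def
    by (rule exI[of _ "\<lambda>i. u (y i)"])
      (use y in \<open>auto simp: complete_isometry_defect[OF u X y(1)] complete_isometry_norm[OF u X y(1)]
        linear_intoD(1)[OF complete_isometryD(1)[OF u] X]\<close>)
qed

lemma finite_dimensional_words:
  assumes X: "operator_system X" "finite_dimensional X"
  obtains e d where "\<And>i. e i \<in> X" "\<And>i. norm (e i) < 1" "X = {comb (Suc (2 * d)) c e | c. True}"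
proof -
  obtain B where B: "finite B" "X = complex_vector.span B" using X by (auto simp: finite_dimensional_def)
  obtain l where l: "set l = B" using finite_list[OF B(1)] by blast
  define d where "d = length l"
  \<comment> \<open>Division by 1 + norm, instead of the norm, lands in the open ball and also
    covers the zero vector.\<close>
  define e where "e i = (if i < d then inverse (1 + norm (l ! i)) *\<^sub>R (l ! i) else 0)" for i
  note sys = operator_systemD[OF X(1)]
  have lX: "l ! i \<in> X" if "i < d" for i
    using that l B(2) by (auto simp: d_def intro: complex_vector.span_base)
  have eX: "e i \<in> X" for i using lX sys by (auto simp: e_def)
  have ne: "norm (e i) < 1" for i
  proof (cases "i < d")
    case True
    have "norm (e i) = norm (l ! i) / (1 + norm (l ! i))"
      using True by (simp add: e_def divide_inverse mult.commute)
    then show ?thesis by (simp add: divide_less_eq add_pos_nonneg)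
  qed (simp add: e_def)
  have "X \<subseteq> complex_vector.span (word e ` {..<Suc (2 * d)})"
    unfolding B(2)
  proof (rule complex_vector.span_minimal)
    show "B \<subseteq> complex_vector.span (word e ` {..<Suc (2 * d)})"
    proof
      fix b assume "b \<in> B"
      then obtain i where i: "i < d" "b = l ! i" using l by (auto simp: d_def in_set_conv_nth)
      have "1 + norm b \<noteq> 0" by (metis add_pos_nonneg less_numeral_extra(1) norm_ge_zero order_less_irrefl)
      then have "b = complex_of_real (1 + norm b) *\<^sub>C word e (Suc (2 * i))"
        unfolding scaleR_scaleC[symmetric] using i by (simp add: e_def)
      also have "\<dots> \<in> complex_vector.span (word e ` {..<Suc (2 * d)})"
        using i by (intro complex_vector.span_scale complex_vector.span_base imageI) simp
      finally show "b \<in> complex_vector.span (word e ` {..<Suc (2 * d)})" .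
    qed
  qed (rule complex_vector.subspace_span)
  then have "X = {comb (Suc (2 * d)) c e | c. True}"
    unfolding span_words using comb_in[OF X(1), of e] eX by blast
  then show ?thesis using that eX ne by blast
qed

text \<open>Compactness turns approximate realizations of all conditions satisfied by a spanning sequence of
  \<open>X\<close> into an exact one.\<close>

lemma exists_complete_isometry:
  fixes X :: "'a::cstar_algebra set" and Y :: "'b::cstar_algebra set"
  assumes X: "operator_system X" "finite_dimensional X" and Y: "operator_system Y" "finite_dimensional Y"
    and R: "\<And>S a. realizes_open X S a \<Longrightarrow> realizes_closed Y S a"
  shows "\<exists>u. complete_isometry X Y u"
proof -
  obtain e d where e: "\<And>i. e i \<in> X" "\<And>i. norm (e i) < 1" and Xe: "X = {comb (Suc (2 * d)) c e | c. True}"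
    using finite_dimensional_words[OF X] by metis
  let ?N = "Suc (2 * d)"
  define q :: "nat \<Rightarrow> nat \<times> nat \<times> nat" where "q = from_nat"
  define cond where "cond j r = (case q j of (n, N, s) \<Rightarrow> (n, N, s, r))" for j and r :: rat
  \<comment> \<open>The prescribed value does not enter the norm, so 0 is a dummy.\<close>
  define Q :: "nat \<Rightarrow> (nat \<Rightarrow> 'a) \<Rightarrow> real" where "Q j = condition_norm (cond j 0)" for j
  define Q' :: "nat \<Rightarrow> (nat \<Rightarrow> 'b) \<Rightarrow> real" where "Q' j = condition_norm (cond j 0)" for j
  have cn: "condition_norm (cond j r) = Q j" "condition_norm (cond j r) = Q' j" "condition_value (cond j r) = of_rat r" for j r
    by (auto simp: Q_def Q'_def cond_def condition_norm_def condition_value_def split: prod.splits)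
  have "\<exists>y. (\<forall>i. y i \<in> Y \<inter> cball 0 1) \<and> (\<forall>j<J. \<bar>Q' j y - Q j e\<bar> < 2 * inverse (real (Suc J)))" for J
  proof -
    \<comment> \<open>Each of the J targets is chosen within \<delta>^2, so the defect of e is at
      most J \<delta>^2 < \<delta>, because J \<delta> < 1.\<close>
    define \<delta> where "\<delta> = inverse (real (Suc J))"
    have \<delta>: "\<delta> > 0" by (simp add: \<delta>_def)
    have "\<forall>j. \<exists>r. \<bar>of_rat r - Q j e\<bar> < \<delta> * \<delta>" using of_rat_approx[OF mult_pos_pos[OF \<delta> \<delta>]] by blast
    then obtain r where r: "\<And>j. \<bar>of_rat (r j) - Q j e\<bar> < \<delta> * \<delta>" by metis
    define S where "S = map (\<lambda>j. cond j (r j)) [0..<J]"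
    have "defect S e = (\<Sum>j<J. \<bar>of_rat (r j) - Q j e\<bar>)"
      by (simp add: defect_def S_def cn abs_minus_commute)
    also have "\<dots> \<le> (\<Sum>j<J. \<delta> * \<delta>)" by (intro sum_mono less_imp_le r)
    also have "\<dots> = (real J * \<delta>) * \<delta>" by simp
    also have "\<dots> < 1 * \<delta>" using \<delta> by (intro mult_strict_right_mono) (auto simp: \<delta>_def field_simps)
    finally have "realizes_open X S J" unfolding realizes_open_def using e by (auto simp: \<delta>_def)
    from R[OF this] obtain y where y: "\<And>i. y i \<in> Y \<and> norm (y i) \<le> 1" "defect S y < \<delta>"
      by (auto simp: realizes_closed_def \<delta>_def)
    have "\<bar>Q' j y - Q j e\<bar> < 2 * \<delta>" if "j < J" for j
    proof -
      have "\<bar>Q' j y - of_rat (r j)\<bar> \<le> (\<Sum>j<J. \<bar>Q' j y - of_rat (r j)\<bar>)"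
        by (rule member_le_sum) (use that in auto)
      also have "\<dots> = defect S y" by (simp add: defect_def S_def cn)
      finally have "\<bar>Q' j y - of_rat (r j)\<bar> < \<delta>" using y by simp
      moreover have "\<bar>of_rat (r j) - Q j e\<bar> < \<delta>"
      proof -
        have "\<delta> * \<delta> \<le> 1 * \<delta>" using \<delta> by (intro mult_right_mono) (auto simp: \<delta>_def field_simps)
        then show ?thesis using r[of j] by simp
      qed
      ultimately show ?thesis by (simp add: abs_if split: if_splits)
    qed
    then show ?thesis using y by (auto simp: \<delta>_def intro!: exI[of _ y])
  qed
  then obtain y where y: "\<And>J i. y J i \<in> Y \<inter> cball 0 1"
      "\<And>J j. j < J \<Longrightarrow> \<bar>Q' j (y J) - Q j e\<bar> < 2 * inverse (real (Suc J))" by metis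
  \<comment> \<open>A countable product of compact balls is compact by Tychonoff's theorem, so one
    subsequence makes all coordinates of y converge simultaneously.\<close>
  have "compact (Y \<inter> cball 0 1)" by (rule finite_dimensional_compact_cball[OF Y(2)])
  then have "compactin euclidean (PiE UNIV (\<lambda>_::nat. Y \<inter> cball 0 1))"
    unfolding euclidean_product_topology[symmetric] compactin_PiE by simp
  then have "compact (PiE UNIV (\<lambda>_::nat. Y \<inter> cball 0 1))" by simp
  moreover have "y J \<in> PiE UNIV (\<lambda>_::nat. Y \<inter> cball 0 1)" for J using y(1) by auto
  ultimately obtain l r where lr: "l \<in> PiE UNIV (\<lambda>_::nat. Y \<inter> cball 0 1)" "strict_mono (r :: nat \<Rightarrow> nat)" "(y \<circ> r) \<longlonglongrightarrow> l"
    unfolding compact_def by metis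
  have l: "l i \<in> Y" for i using lr(1) by auto
  have lim: "(\<lambda>J. y (r J) i) \<longlonglongrightarrow> l i" for i
    using continuous_on_tendsto_compose[OF continuous_on_product_coordinates lr(3), of i] by (simp add: o_def)
  have Qeq: "Q' j l = Q j e" for j
  proof (rule LIMSEQ_unique)
    show "(\<lambda>J. Q' j (y (r J))) \<longlonglongrightarrow> Q' j l"
      unfolding Q'_def condition_norm_def by (auto split: prod.split intro!: tendsto_mat_norm_mcomb lim)
    have "(\<lambda>J. Q' j (y J) - Q j e) \<longlonglongrightarrow> 0"
    proof (rule Lim_null_comparison)
      show "\<forall>\<^sub>F J in sequentially. norm (Q' j (y J) - Q j e) \<le> 2 * inverse (real (Suc J))"
        using eventually_gt_at_top[of j] by eventually_elim (unfold real_norm_def, rule less_imp_le, rule y(2))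
      show "(\<lambda>J. 2 * inverse (real (Suc J))) \<longlonglongrightarrow> 0"
        using tendsto_mult[OF tendsto_const[of 2] LIMSEQ_inverse_real_of_nat] by simp
    qed
    then have "(\<lambda>J. Q' j (y J)) \<longlonglongrightarrow> Q j e" by (simp add: LIM_zero_iff)
    then show "(\<lambda>J. Q' j (y (r J))) \<longlonglongrightarrow> Q j e"
      using LIMSEQ_subseq_LIMSEQ[OF _ lr(2)] by (simp add: o_def)
  qed
  have norm_g: "mat_norm (mcomb (Suc n) N (gcoef2 s) l) = mat_norm (mcomb (Suc n) N (gcoef2 s) e)" for n N s
    using Qeq[of "to_nat (n, N, s)"] by (simp add: Q_def Q'_def cond_def q_def condition_norm_def)
  have norm_C: "mat_norm (mcomb (Suc n) N C l) = mat_norm (mcomb (Suc n) N C e)" for n N C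
  proof -
    obtain s where s: "\<And>p k. (\<lambda>t. gcoef2 (s t) p k) \<longlonglongrightarrow> C p k" using gcoef2_dense_seq by metis
    have "(\<lambda>t. mat_norm (mcomb (Suc n) N (gcoef2 (s t)) l)) \<longlonglongrightarrow> mat_norm (mcomb (Suc n) N C l)"
      by (intro tendsto_mat_norm_mcomb s tendsto_const)
    moreover have "(\<lambda>t. mat_norm (mcomb (Suc n) N (gcoef2 (s t)) l)) \<longlonglongrightarrow> mat_norm (mcomb (Suc n) N C e)"
      unfolding norm_g by (intro tendsto_mat_norm_mcomb s tendsto_const)
    ultimately show ?thesis by (rule LIMSEQ_unique)
  qed
  have norm_comb: "norm (comb N c l) = norm (comb N c e)" for N c
    using norm_C[of 0 N "\<lambda>_. c"] by (simp add: mat_norm_1x1 mcomb_def)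
  \<comment> \<open>The choice of c is harmless: two choices differ by a combination that vanishes
    at e, and hence, the norms being equal, also at l.\<close>
  define u where "u x = comb ?N (SOME c. x = comb ?N c e) l" for x
  have u: "u (comb ?N c e) = comb ?N c l" for c
  proof -
    define c' where "c' = (SOME c'. comb ?N c e = comb ?N c' e)"
    have "comb ?N c e = comb ?N c' e" unfolding c'_def by (rule someI[of _ c]) simp
    then have "comb ?N (\<lambda>k. c k - c' k) e = 0" by (simp add: comb_diff)
    then have "comb ?N (\<lambda>k. c k - c' k) l = 0" using norm_comb by (metis norm_eq_zero)
    then show ?thesis by (simp add: comb_diff u_def c'_def)
  qed
  have one: "comb ?N (\<lambda>k. if k = 0 then 1 else 0) y = 1" for y :: "nat \<Rightarrow> 'c::cstar_algebra"
    using comb_single[of 0 ?N 1 y] by (simp add: scaleC_one)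
  have "linear_into X Y u"
    unfolding linear_into_def
  proof (intro conjI ballI allI subsetI)
    show "x \<in> Y" if "x \<in> u ` X" for x using that comb_in[OF Y(1) l] by (auto simp: Xe u)
    show "u 1 = 1" using u[of "\<lambda>k. if k = 0 then 1 else 0"] by (simp add: one)
    show "u (x + z) = u x + u z" if "x \<in> X" "z \<in> X" for x z
      using that unfolding Xe by (auto simp: u simp flip: comb_add)
    show "u (c *\<^sub>C x) = c *\<^sub>C u x" if "x \<in> X" for c x
      using that unfolding Xe by (auto simp: u simp flip: comb_scaleC)
  qed
  moreover have "u (star x) = star (u x)" if "x \<in> X" for x
    using that unfolding Xe by (auto simp: u star_comb)
  moreover have "mat_norm (map_mat u x) = mat_norm x" if n: "n \<ge> 1" and x: "x \<in> mats n X" for n x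
  proof -
    have "\<forall>i j. \<exists>c. i < n \<longrightarrow> j < n \<longrightarrow> x $$ (i, j) = comb ?N c e"
      using matsD(2)[OF x] unfolding Xe by blast
    then obtain c where c: "\<And>i j. i < n \<Longrightarrow> j < n \<Longrightarrow> x $$ (i, j) = comb ?N (c i j) e" by metis
    define C where "C p = c (p div n) (p mod n)" for p
    have C: "C (i * n + j) = c i j" if "j < n" for i j using that by (simp add: C_def)
    have "x = mcomb n ?N C e" "map_mat u x = mcomb n ?N C l"
      using matsD(1)[OF x] by (auto intro!: eq_matI simp: mcomb_def c C u)
    moreover obtain m where "n = Suc m" using n by (cases n) auto
    ultimately show ?thesis using norm_C by metis
  qed
  ultimately show ?thesis unfolding complete_isometry_def by blast
qed

lemma completely_order_isomorphic_iff_realizes: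
  assumes X: "operator_system X" "finite_dimensional X" and Y: "operator_system Y" "finite_dimensional Y"
  shows "completely_order_isomorphic X Y \<longleftrightarrow> (\<forall>S a. realizes_open X S a \<longleftrightarrow> realizes_open Y S a)"
proof
  assume iso: "completely_order_isomorphic X Y"
  then obtain u v where "complete_order_isomorphism X Y u" "complete_order_isomorphism Y X v"
    using completely_order_isomorphic_sym[OF iso X(1)] unfolding completely_order_isomorphic_def by blast
  then show "\<forall>S a. realizes_open X S a \<longleftrightarrow> realizes_open Y S a"
    using complete_isometry_realizes_open coi_complete_isometry X(1) Y(1) by metis
next
  assume "\<forall>S a. realizes_open X S a \<longleftrightarrow> realizes_open Y S a"
  then obtain u v where "complete_isometry X Y u" "complete_isometry Y X v"
    using exists_complete_isometry[OF X Y] exists_complete_isometry[OF Y X] realizes_open_imp_closed by metis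
  then show "completely_order_isomorphic X Y"
    using completely_order_isomorphic_of_embeddings X Y(1) by blast
qed

section \<open>Complete order isomorphisms preserve the values of sentences\<close>

lemma scalar_mat_carrier: "a \<in> carrier_mat m n \<Longrightarrow> scalar_mat a \<in> carrier_mat m n"
  by (simp add: scalar_mat_def)

lemma sandwich_index:
  fixes t :: "'a::cstar_algebra mat"
  assumes a: "a \<in> carrier_mat n k" and t: "t \<in> carrier_mat k k" and b: "b \<in> carrier_mat k n"
    and ij: "i < n" "j < n"
  shows "(scalar_mat a * t * scalar_mat b) $$ (i, j) = (\<Sum>q<k. \<Sum>p<k. (a $$ (i, p) * b $$ (q, j)) *\<^sub>C t $$ (p, q))"
proof -
  note sa = scalar_mat_carrier[OF a] and sb = scalar_mat_carrier[OF b]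
  have "(scalar_mat a * t * scalar_mat b) $$ (i, j) = (\<Sum>q<k. (\<Sum>p<k. scalar_mat a $$ (i, p) * t $$ (p, q)) * scalar_mat b $$ (q, j))"
    by (simp add: index_mult_mat_sum[OF mult_carrier_mat[OF sa t] sb ij] index_mult_mat_sum[OF sa t] ij del: index_mult_mat)
  also have "\<dots> = (\<Sum>q<k. (\<Sum>p<k. (a $$ (i, p) *\<^sub>C 1) * t $$ (p, q)) * (b $$ (q, j) *\<^sub>C 1))"
    using a b ij by (intro sum.cong) (auto simp: scalar_mat_def)
  finally show ?thesis
    by (simp add: mult_scaleC_left mult_scaleC_right sum_distrib_right scaleC_scaleC complex_vector.scale_sum_right mult.commute)
qed

lemma sandwich_carrier:
  "a \<in> carrier_mat n k \<Longrightarrow> b \<in> carrier_mat k n \<Longrightarrow> scalar_mat a * t * scalar_mat b \<in> carrier_mat n n"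
  by (rule carrier_matI) (auto simp: scalar_mat_def)

lemma term_value_mats:
  assumes X: "operator_system X" and e: "\<And>n i. e n i \<in> mats n X"
  shows "has_sort t n \<Longrightarrow> term_value e t \<in> mats n X"
proof (induction t arbitrary: n)
  case (Variable m i)
  then show ?case using e by simp
next
  case One
  then show ?case using operator_systemD[OF X] by (auto simp: mats_iff)
next
  case (Add s t)
  then have "term_value e s \<in> mats n X" "term_value e t \<in> mats n X" by auto
  then show ?case using operator_systemD[OF X] by (auto simp: mats_iff)
next
  case (Scale c t)
  then have "term_value e t \<in> mats n X" by auto
  then show ?case using operator_systemD[OF X] by (auto simp: mats_iff)
next
  case (Adjoint t)
  then have "term_value e t \<in> mats n X" by auto
  then show ?case using operator_systemD[OF X] by (auto simp: mats_iff mat_star_def)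
next
  case (Sandwich a t b)
  then obtain k where k: "a \<in> carrier_mat n k" "b \<in> carrier_mat k n" "has_sort t k" by auto
  then have t: "term_value e t \<in> mats k X" using Sandwich.IH by blast
  show ?case
    unfolding mats_iff
  proof (intro conjI allI impI)
    fix i j assume ij: "i < n" "j < n"
    show "term_value e (Sandwich a t b) $$ (i, j) \<in> X"
      unfolding term_value.simps sandwich_index[OF k(1) matsD(1)[OF t] k(2) ij]
      by (intro operator_systemD(8)[OF X] operator_systemD(4)[OF X] matsD(2)[OF t]) auto
  qed (simp add: sandwich_carrier[OF k(1,2)])
qed

lemma term_value_map:
  fixes e :: "nat \<Rightarrow> nat \<Rightarrow> 'a::cstar_algebra mat"
  assumes u: "complete_isometry X Y u" and X: "operator_system X" and e: "\<And>n i. e n i \<in> mats n X"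
  shows "has_sort t n \<Longrightarrow> term_value (\<lambda>n i. map_mat u (e n i)) t = map_mat u (term_value e t)"
proof (induction t arbitrary: n)
  case (Variable m i)
  then show ?case by simp
next
  case One
  show ?case by (rule eq_matI) (auto simp: linear_intoD[OF complete_isometryD(1)[OF u] X])
next
  case (Add s t)
  then have "term_value e s \<in> mats n X" "term_value e t \<in> mats n X" using term_value_mats[OF X, of e] e by auto
  then have "map_mat u (term_value e s) + map_mat u (term_value e t) = map_mat u (term_value e s + term_value e t)"
    by (intro eq_matI) (auto simp: mats_iff linear_intoD[OF complete_isometryD(1)[OF u] X])
  then show ?case using Add by auto
next
  case (Scale c t)
  then have "term_value e t \<in> mats n X" using term_value_mats[OF X, of e] e by auto
  then have "mat_scaleC c (map_mat u (term_value e t)) = map_mat u (mat_scaleC c (term_value e t))"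
    by (intro eq_matI) (auto simp: mats_iff linear_intoD[OF complete_isometryD(1)[OF u] X])
  then show ?case using Scale by auto
next
  case (Adjoint t)
  then have "term_value e t \<in> mats n X" using term_value_mats[OF X, of e] e by auto
  then show ?case using Adjoint map_mat_star[of X u, OF complete_isometryD(2)[OF u]] by auto
next
  case (Sandwich a t b)
  then obtain k where k: "a \<in> carrier_mat n k" "b \<in> carrier_mat k n" "has_sort t k" by auto
  then have t: "term_value e t \<in> mats k X" using term_value_mats[OF X, of e] e by blast
  let ?t = "term_value e t"
  have ut: "map_mat u ?t \<in> carrier_mat k k" using matsD(1)[OF t] by simp
  have c: "scalar_mat a * ?t * scalar_mat b \<in> carrier_mat n n" by (rule sandwich_carrier[OF k(1,2)])
  have "scalar_mat a * map_mat u ?t * scalar_mat b = map_mat u (scalar_mat a * ?t * scalar_mat b)"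
  proof (rule eq_matI)
    fix i j assume "i < dim_row (map_mat u (scalar_mat a * ?t * scalar_mat b))"
       "j < dim_col (map_mat u (scalar_mat a * ?t * scalar_mat b))"
    then have ij: "i < n" "j < n" using c by auto
    have "(scalar_mat a * map_mat u ?t * scalar_mat b) $$ (i, j) = (\<Sum>q<k. \<Sum>p<k. (a $$ (i, p) * b $$ (q, j)) *\<^sub>C u (?t $$ (p, q)))"
      using matsD(1)[OF t] by (simp add: sandwich_index[OF k(1) ut k(2) ij])
    also have "\<dots> = (\<Sum>q<k. \<Sum>p<k. u ((a $$ (i, p) * b $$ (q, j)) *\<^sub>C ?t $$ (p, q)))"
      by (intro sum.cong refl linear_intoD(4)[OF complete_isometryD(1)[OF u] X, symmetric] matsD(2)[OF t]) auto
    also have "\<dots> = u (\<Sum>q<k. \<Sum>p<k. (a $$ (i, p) * b $$ (q, j)) *\<^sub>C ?t $$ (p, q))"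
    proof -
      have in1: "(a $$ (i, p) * b $$ (q, j)) *\<^sub>C ?t $$ (p, q) \<in> X" if "p < k" "q < k" for p q
        using operator_systemD(4)[OF X matsD(2)[OF t that]] .
      have "u (\<Sum>q<k. \<Sum>p<k. (a $$ (i, p) * b $$ (q, j)) *\<^sub>C ?t $$ (p, q))
          = (\<Sum>q<k. u (\<Sum>p<k. (a $$ (i, p) * b $$ (q, j)) *\<^sub>C ?t $$ (p, q)))"
        by (rule linear_intoD(8)[OF complete_isometryD(1)[OF u] X]) (intro operator_systemD(8)[OF X] in1, auto)
      also have "\<dots> = (\<Sum>q<k. \<Sum>p<k. u ((a $$ (i, p) * b $$ (q, j)) *\<^sub>C ?t $$ (p, q)))"
        by (intro sum.cong refl linear_intoD(8)[OF complete_isometryD(1)[OF u] X] in1) auto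
      finally show ?thesis ..
    qed
    also have "\<dots> = map_mat u (scalar_mat a * ?t * scalar_mat b) $$ (i, j)"
      using ij carrier_matD[OF c] unfolding sandwich_index[OF k(1) matsD(1)[OF t] k(2) ij, symmetric] by (simp only: index_map_mat)
    finally show "(scalar_mat a * map_mat u ?t * scalar_mat b) $$ (i, j) = map_mat u (scalar_mat a * ?t * scalar_mat b) $$ (i, j)" .
  qed (use k in \<open>auto simp: scalar_mat_def\<close>)
  moreover have "term_value (\<lambda>n i. map_mat u (e n i)) t = map_mat u ?t" by (rule Sandwich.IH[OF k(3)])
  ultimately show ?case by simp
qed

lemma map_mat_mats_image:
  assumes surj: "u ` X = Y"
  shows "map_mat u ` mats n X = mats n Y"
proof (intro equalityI subsetI)
  fix y assume y: "y \<in> mats n Y"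
  let ?x = "map_mat (inv_into X u) y"
  have "?x \<in> mats n X" using surj by (intro map_mat_in_mats[OF y]) (auto intro: inv_into_into)
  moreover have "y = map_mat u ?x" using matsD[OF y] surj by (intro eq_matI) (auto simp: f_inv_into_f)
  ultimately show "y \<in> map_mat u ` mats n X" by blast
next
  fix y assume "y \<in> map_mat u ` mats n X"
  then show "y \<in> mats n Y" using surj map_mat_in_mats[of _ n X u Y] by blast
qed

lemma map_mat_positive_cone_image:
  assumes "complete_isometry X Y u" "operator_system X" "u ` X = Y" "n \<ge> 1"
  shows "map_mat u ` positive_cone n X = positive_cone n Y"
  unfolding positive_cone_def map_mat_mats_image[OF assms(3), symmetric]
  using complete_isometry_mat_positive[OF assms(1,2,4)] by auto

lemma map_mat_mat_ball_image:
  assumes "complete_isometry X Y u" "u ` X = Y" "n \<ge> 1"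
  shows "map_mat u ` mat_ball n k X = mat_ball n k Y"
  unfolding mat_ball_def map_mat_mats_image[OF assms(2), symmetric]
  using complete_isometryD(3)[OF assms(1,3)] by auto

lemma mat_norm_map_mat_diff:
  assumes u: "complete_isometry X Y u" and X: "operator_system X" and n: "n \<ge> 1" and x: "x \<in> mats n X" "y \<in> mats n X"
  shows "mat_norm (map_mat u x - map_mat u y) = mat_norm (x - y)"
proof -
  have "map_mat u x - map_mat u y = map_mat u (x - y)"
    using x by (intro eq_matI) (auto simp: mats_iff linear_intoD[OF complete_isometryD(1)[OF u] X])
  moreover have "x - y \<in> mats n X" using x operator_systemD[OF X] by (auto simp: mats_iff)
  ultimately show ?thesis using complete_isometryD(3)[OF u n] by simp
qed

text \<open>Since u is onto, the balls and cones of Y are the entrywise images of those of X.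
  Suprema and infima thus run over the same values, so formulas with infima are covered as
  well.\<close>

lemma formula_value_map:
  fixes e :: "nat \<Rightarrow> nat \<Rightarrow> 'a::cstar_algebra mat"
  assumes u: "complete_isometry X Y u" and surj: "u ` X = Y" and X: "operator_system X"
  shows "wf_formula \<phi> \<Longrightarrow> (\<And>n i. e n i \<in> mats n X) \<Longrightarrow>
    formula_value Y (\<lambda>n i. map_mat u (e n i)) \<phi> = formula_value X e \<phi>"
proof (induction \<phi> arbitrary: e)
  case (Dist s t)
  then obtain n where n: "n \<ge> 1" "has_sort s n" "has_sort t n" by auto
  have "term_value e s \<in> mats n X" "term_value e t \<in> mats n X"
    using term_value_mats[OF X Dist.prems(2)] n by auto
  then show ?case
    using term_value_map[OF u X Dist.prems(2)] n mat_norm_map_mat_diff[OF u X n(1)] by simp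
next
  case (DistCone t)
  then obtain n where n: "n \<ge> 1" "has_sort t n" by auto
  have t: "term_value e t \<in> mats n X" using term_value_mats[OF X DistCone.prems(2)] n by auto
  have d: "dim_row (term_value e t) = n" using matsD(1)[OF t] by auto
  have "(INF p \<in> positive_cone n Y. mat_norm (map_mat u (term_value e t) - p)) =
      (INF p \<in> positive_cone n X. mat_norm (map_mat u (term_value e t) - map_mat u p))"
    unfolding map_mat_positive_cone_image[OF u X surj n(1), symmetric] by (simp add: image_image)
  also have "\<dots> = (INF p \<in> positive_cone n X. mat_norm (term_value e t - p))"
    using mat_norm_map_mat_diff[OF u X n(1) t] by (intro INF_cong) (auto simp: positive_cone_def)
  finally show ?case
    using term_value_map[OF u X DistCone.prems(2)] n d by (simp add: dist_cone_def)
next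
  case (Connective f \<phi>s)
  have "map (formula_value Y (\<lambda>n i. map_mat u (e n i))) \<phi>s = map (formula_value X e) \<phi>s"
    using Connective by auto
  then show ?case unfolding formula_value.simps by (simp only:)
next
  case (SupD n k i \<phi>)
  have eq: "(\<lambda>n i. map_mat u (e n i))(n := ((\<lambda>i. map_mat u (e n i)))(i := map_mat u x)) =
      (\<lambda>m j. map_mat u ((e(n := (e n)(i := x))) m j))" for x by (auto simp: fun_eq_iff)
  have "formula_value Y ((\<lambda>n i. map_mat u (e n i))(n := ((\<lambda>i. map_mat u (e n i)))(i := map_mat u x))) \<phi>
      = formula_value X (e(n := (e n)(i := x))) \<phi>" if "x \<in> mat_ball n k X" for x
    unfolding eq using SupD.prems that by (intro SupD.IH) (auto simp: mat_ball_def)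
  then show ?case
    using SupD.prems map_mat_mat_ball_image[OF u surj, of n k, symmetric] by (simp add: image_image)
next
  case (InfD n k i \<phi>)
  have eq: "(\<lambda>n i. map_mat u (e n i))(n := ((\<lambda>i. map_mat u (e n i)))(i := map_mat u x)) =
      (\<lambda>m j. map_mat u ((e(n := (e n)(i := x))) m j))" for x by (auto simp: fun_eq_iff)
  have "formula_value Y ((\<lambda>n i. map_mat u (e n i))(n := ((\<lambda>i. map_mat u (e n i)))(i := map_mat u x))) \<phi>
      = formula_value X (e(n := (e n)(i := x))) \<phi>" if "x \<in> mat_ball n k X" for x
    unfolding eq using InfD.prems that by (intro InfD.IH) (auto simp: mat_ball_def)
  then show ?case
    using InfD.prems map_mat_mat_ball_image[OF u surj, of n k, symmetric] by (simp add: image_image)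
qed

lemma sentence_value_eq:
  assumes "completely_order_isomorphic X Y" "operator_system X" "operator_system Y" "wf_formula \<phi>"
  shows "sentence_value X \<phi> = sentence_value Y \<phi>"
proof -
  obtain u where u: "complete_order_isomorphism X Y u" using assms(1) by (auto simp: completely_order_isomorphic_def)
  then have surj: "u ` X = Y" by (auto simp: complete_order_isomorphism_def bij_betw_def)
  note iso = coi_complete_isometry[OF u assms(2,3)]
  have "map_mat u (0\<^sub>m n n) = 0\<^sub>m n n" for n
    by (rule eq_matI) (auto simp: linear_intoD[OF complete_isometryD(1)[OF iso] assms(2)])
  then show ?thesis
    using formula_value_map[OF iso surj assms(2,4), of "\<lambda>n i. 0\<^sub>m n n"] operator_systemD[OF assms(2)]
    by (simp add: sentence_value_def mats_iff)
qed

section \<open>Sentences expressing approximate realizability\<close>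

definition word_term :: "nat \<Rightarrow> osy_term" where
  "word_term k = (if k = 0 then One else if odd k then Variable 1 (k div 2) else Adjoint (Variable 1 (k div 2 - 1)))"

text \<open>The language has no constant 0; \<open>Scale 0 One\<close> is a term of sort 1 that
  denotes it.\<close>

primrec comb_term :: "nat \<Rightarrow> (nat \<Rightarrow> complex) \<Rightarrow> osy_term" where
  "comb_term 0 c = Scale 0 One"
| "comb_term (Suc N) c = Add (comb_term N c) (Scale (c N) (word_term N))"

text \<open>Between this column and the corresponding row, \<open>Sandwich\<close> places an element
  of sort 1 into entry (i, j) of an otherwise zero matrix. \<open>Sandwich\<close> is the only term
  constructor that changes the sort.\<close>

definition unit_col :: "nat \<Rightarrow> nat \<Rightarrow> complex mat" where
  "unit_col n i = Matrix.mat n 1 (\<lambda>(p, q). if p = i then 1 else 0)"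

definition unit_row :: "nat \<Rightarrow> nat \<Rightarrow> complex mat" where
  "unit_row n j = Matrix.mat 1 n (\<lambda>(p, q). if q = j then 1 else 0)"

text \<open>The base case is a closed term for the zero matrix of sort n; the entries are then added
  in row-major order.\<close>

primrec assemble_term :: "nat \<Rightarrow> (nat \<Rightarrow> osy_term) \<Rightarrow> nat \<Rightarrow> osy_term" where
  "assemble_term n t 0 = Scale 0 (Sandwich (unit_col n 0) One (unit_row n 0))"
| "assemble_term n t (Suc p) = Add (assemble_term n t p) (Sandwich (unit_col n (p div n)) (t p) (unit_row n (p mod n)))"

definition mcomb_term :: "nat \<Rightarrow> nat \<Rightarrow> (nat \<Rightarrow> nat \<Rightarrow> complex) \<Rightarrow> osy_term" where
  "mcomb_term n N c = assemble_term n (\<lambda>p. comb_term N (c p)) (n * n)"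

lemma zero_one_gaussian: "0 \<in> gaussian_rationals" "1 \<in> gaussian_rationals"
  by (auto simp: gaussian_rationals_def)

lemma word_term_sort: "has_sort (word_term k) 1"
  by (auto simp: word_term_def)

lemma comb_term_sort: "(\<And>k. c k \<in> gaussian_rationals) \<Longrightarrow> has_sort (comb_term N c) 1"
  by (induction N) (simp_all add: zero_one_gaussian word_term_sort del: One_nat_def)

lemma sandwich_unit_sort:
  "n \<ge> 1 \<Longrightarrow> has_sort t 1 \<Longrightarrow> has_sort (Sandwich (unit_col n i) t (unit_row n j)) n"
  by (auto simp: unit_col_def unit_row_def zero_one_gaussian dest!: elements_matD intro!: exI[of _ 1] split: if_splits)

lemma assemble_term_sort:
  assumes "n \<ge> 1" "\<And>p. has_sort (t p) 1"
  shows "has_sort (assemble_term n t K) n"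
proof (induction K)
  case 0
  have "has_sort (Sandwich (unit_col n 0) One (unit_row n 0)) n"
    by (rule sandwich_unit_sort[OF assms(1)]) simp
  then show ?case by (simp add: zero_one_gaussian del: has_sort.simps(6))
next
  case (Suc K)
  then show ?case using sandwich_unit_sort[OF assms(1) assms(2)] by (simp del: has_sort.simps(6))
qed

lemma word_term_vars: "term_vars (word_term k) \<subseteq> {1} \<times> {..<k}"
  by (auto simp: word_term_def elim!: oddE evenE)

lemma comb_term_vars: "term_vars (comb_term N c) \<subseteq> {1} \<times> {..<N}"
proof (induction N)
  case (Suc N)
  then show ?case using word_term_vars[of N] by fastforce
qed simp

lemma assemble_term_vars: "(\<And>p. term_vars (t p) \<subseteq> V) \<Longrightarrow> term_vars (assemble_term n t K) \<subseteq> V"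
  by (induction K) auto

definition seq_of :: "(nat \<Rightarrow> nat \<Rightarrow> 'a::cstar_algebra mat) \<Rightarrow> nat \<Rightarrow> 'a" where
  "seq_of e i = e 1 i $$ (0, 0)"

lemma word_term_value:
  assumes "\<And>i. e 1 i \<in> carrier_mat 1 1"
  shows "term_value e (word_term k) = Matrix.mat 1 1 (\<lambda>_. word (seq_of e) k)"
proof -
  have "dim_row (e 1 i) = 1" "dim_col (e 1 i) = 1" for i using assms[of i] by auto
  then show ?thesis by (intro eq_matI) (auto simp: word_term_def word_def seq_of_def mat_star_def)
qed

lemma comb_term_value:
  assumes "\<And>i. e 1 i \<in> carrier_mat 1 1"
  shows "term_value e (comb_term N c) = Matrix.mat 1 1 (\<lambda>_. comb N c (seq_of e))"
proof (induction N)
  case 0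
  show ?case by (rule eq_matI) (auto simp: comb_def)
next
  case (Suc N)
  then show ?case by (intro eq_matI) (auto simp: comb_def word_term_value[of e, OF assms])
qed

lemma sandwich_unit_value:
  "scalar_mat (unit_col n i) * Matrix.mat 1 1 (\<lambda>_. x) * scalar_mat (unit_row n j)
    = Matrix.mat n n (\<lambda>(p, q). if p = i \<and> q = j then x else 0)" (is "?l = ?r")
proof (rule eq_matI)
  fix p q assume "p < dim_row ?r" "q < dim_col ?r"
  then have pq: "p < n" "q < n" by auto
  have u: "unit_col n i \<in> carrier_mat n 1" "unit_row n j \<in> carrier_mat 1 n" by (auto simp: unit_col_def unit_row_def)
  have "?l $$ (p, q) = (unit_col n i $$ (p, 0) * unit_row n j $$ (0, q)) *\<^sub>C x"
    using sandwich_index[OF u(1) _ u(2) pq, of "Matrix.mat 1 1 (\<lambda>_. x)"] by simp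
  then show "?l $$ (p, q) = ?r $$ (p, q)"
    using pq by (simp add: unit_col_def unit_row_def scaleC_one)
qed (auto simp: scalar_mat_def unit_col_def unit_row_def)

lemma assemble_term_value:
  assumes t: "\<And>p. term_value e (t p) = Matrix.mat 1 1 (\<lambda>_. x p)"
  shows "term_value e (assemble_term n t K) = Matrix.mat n n (\<lambda>(i, j). if i * n + j < K then x (i * n + j) else 0)"
proof (induction K)
  case 0
  have "term_value e One = Matrix.mat 1 1 (\<lambda>_. 1)" by (rule eq_matI) auto
  then have "term_value e (assemble_term n t 0) = mat_scaleC 0 (Matrix.mat n n (\<lambda>(p, q). if p = 0 \<and> q = 0 then 1 else 0))"
    unfolding assemble_term.simps term_value.simps(4,6) by (simp only: sandwich_unit_value)
  then show ?case by (auto intro!: eq_matI)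
next
  case (Suc K)
  have iff: "i = K div n \<and> j = K mod n \<longleftrightarrow> i * n + j = K" if "i < n" "j < n" for i j
    using that by auto
  have "term_value e (assemble_term n t (Suc K)) =
      Matrix.mat n n (\<lambda>(i, j). if i * n + j < K then x (i * n + j) else 0) + Matrix.mat n n (\<lambda>(i, j). if i = K div n \<and> j = K mod n then x K else 0)"
    unfolding assemble_term.simps term_value.simps(3,6) Suc t sandwich_unit_value ..
  also have "\<dots> = Matrix.mat n n (\<lambda>(i, j). if i * n + j < Suc K then x (i * n + j) else 0)"
    by (rule eq_matI) (auto simp: iff simp del: split_paired_All)
  finally show ?case .
qed

lemma mcomb_term_value:
  assumes "\<And>i. e 1 i \<in> carrier_mat 1 1"
  shows "term_value e (mcomb_term n N c) = mcomb n N c (seq_of e)"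
proof -
  have "i * n + j < n * n" if "i < n" "j < n" for i j
  proof -
    have "i * n + j < Suc i * n" using that by simp
    also have "\<dots> \<le> n * n" using that by (intro mult_le_mono1) simp
    finally show ?thesis .
  qed
  then show ?thesis
    unfolding mcomb_term_def assemble_term_value[of e "\<lambda>p. comb_term N (c p)", OF comb_term_value[of e, OF assms]]
    by (intro eq_matI) (auto simp: mcomb_def)
qed

text \<open>The atomic formulas include distances but no norms, so the norm of a term is written as
  its distance to 0 times itself.\<close>

definition condition_formula :: "nat \<times> nat \<times> nat \<times> rat \<Rightarrow> osy_formula" where
  "condition_formula q = (case q of (n, N, s, r) \<Rightarrow>
     Dist (mcomb_term (Suc n) N (gcoef2 s)) (Scale 0 (mcomb_term (Suc n) N (gcoef2 s))))"

text \<open>The minus sign turns the search for the smallest defect into a supremum, which keeps the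
  sentence prenex universal.\<close>

definition defect_formula :: "norm_conditions \<Rightarrow> osy_formula" where
  "defect_formula S = Connective (\<lambda>v. - (\<Sum>j<length S. \<bar>v j - condition_value (S ! j)\<bar>)) (map condition_formula S)"

primrec sup_unit_balls :: "nat \<Rightarrow> osy_formula \<Rightarrow> osy_formula" where
  "sup_unit_balls 0 \<phi> = \<phi>"
| "sup_unit_balls (Suc m) \<phi> = SupD 1 1 m (sup_unit_balls m \<phi>)"

definition defect_bound :: "norm_conditions \<Rightarrow> nat" where
  "defect_bound S = Max (insert 0 (condition_bound ` set S))"

definition defect_sentence :: "norm_conditions \<Rightarrow> osy_formula" where
  "defect_sentence S = sup_unit_balls (defect_bound S) (defect_formula S)"

lemma condition_formula_value:
  assumes "\<And>i. e 1 i \<in> carrier_mat 1 1"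
  shows "formula_value X e (condition_formula q) = condition_norm q (seq_of e)"
proof -
  have "A - mat_scaleC 0 A = A" for A :: "'a mat" by (rule eq_matI) auto
  then show ?thesis by (simp add: condition_formula_def condition_norm_def mcomb_term_value[of e, OF assms] split: prod.split)
qed

lemma defect_formula_value:
  assumes "\<And>i. e 1 i \<in> carrier_mat 1 1"
  shows "formula_value X e (defect_formula S) = - defect S (seq_of e)"
  by (simp add: defect_formula_def defect_def condition_formula_value[of e, OF assms])

lemma defect_formula_value_le: "formula_value X e (defect_formula S) \<le> 0"
  by (simp add: defect_formula_def sum_nonneg)

lemma mcomb_term_sort: "n \<ge> 1 \<Longrightarrow> has_sort (mcomb_term n N (gcoef2 s)) n"
  unfolding mcomb_term_def by (intro assemble_term_sort comb_term_sort) (auto simp: gcoef2_def gcoef_gaussian)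

lemma defect_formula_wf: "wf_formula (defect_formula S)"
proof -
  have "continuous_map (product_topology (\<lambda>_. euclideanreal) {..<length S}) euclideanreal
     (\<lambda>v. - (\<Sum>j<length S. \<bar>v j - condition_value (S ! j)\<bar>))"
    by (intro continuous_map_minus continuous_map_sum continuous_map_real_abs continuous_map_diff continuous_map_product_projection) auto
  moreover have "wf_formula (condition_formula q)" for q
  proof -
    obtain n N s r where q: "q = (n, N, s, r)" by (cases q)
    show ?thesis
      using mcomb_term_sort[of "Suc n" N s] by (auto simp: q condition_formula_def zero_one_gaussian intro!: exI[of _ "Suc n"])
  qed
  ultimately show ?thesis by (auto simp: defect_formula_def)
qed

lemma defect_formula_vars: "free_vars (defect_formula S) \<subseteq> {1} \<times> {..<defect_bound S}"
proof -
  have "free_vars (condition_formula q) \<subseteq> {1} \<times> {..<defect_bound S}" if "q \<in> set S" for q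
  proof -
    obtain n N s r where q: "q = (n, N, s, r)" by (cases q)
    have "N \<le> defect_bound S" unfolding defect_bound_def using that by (intro Max_ge) (auto simp: q condition_bound_def image_iff intro!: bexI)
    then have "{1::nat} \<times> {..<N} \<subseteq> {1} \<times> {..<defect_bound S}" by auto
    then have "term_vars (mcomb_term (Suc n) N (gcoef2 s)) \<subseteq> {1} \<times> {..<defect_bound S}"
      unfolding mcomb_term_def by (intro assemble_term_vars order_trans[OF comb_term_vars])
    then show ?thesis by (simp add: q condition_formula_def)
  qed
  moreover have "free_vars (defect_formula S) = (\<Union>q\<in>set S. free_vars (condition_formula q))"
    by (simp add: defect_formula_def)
  ultimately show ?thesis by (simp only: UN_least)
qed

lemma sup_unit_balls_properties:
  shows "wf_formula \<phi> \<Longrightarrow> wf_formula (sup_unit_balls m \<phi>)"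
    and "quantifier_free \<phi> \<Longrightarrow> prenex_universal (sup_unit_balls m \<phi>)"
    and "free_vars (sup_unit_balls m \<phi>) = free_vars \<phi> - {1} \<times> {..<m}"
proof -
  show "wf_formula \<phi> \<Longrightarrow> wf_formula (sup_unit_balls m \<phi>)" by (induction m) simp_all
  show "quantifier_free \<phi> \<Longrightarrow> prenex_universal (sup_unit_balls m \<phi>)"
    by (induction m) (simp_all add: prenex_universal.intros)
  show "free_vars (sup_unit_balls m \<phi>) = free_vars \<phi> - {1} \<times> {..<m}"
    by (induction m) (auto simp: lessThan_Suc)
qed

lemma defect_sentence: "sentence (defect_sentence S)" "prenex_universal (defect_sentence S)"
proof -
  show "sentence (defect_sentence S)"
    unfolding sentence_def defect_sentence_def sup_unit_balls_properties(3)
    using sup_unit_balls_properties(1)[OF defect_formula_wf] defect_formula_vars by blast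
  have "quantifier_free (defect_formula S)"
    by (auto simp: defect_formula_def condition_formula_def split: prod.split)
  then show "prenex_universal (defect_sentence S)"
    unfolding defect_sentence_def by (rule sup_unit_balls_properties(2))
qed

lemma prenex_universal_imp_universal: "prenex_universal \<phi> \<Longrightarrow> universal \<phi>"
proof (induction rule: prenex_universal.induct)
  case (1 \<phi>)
  then show ?case by (induction \<phi>) auto
qed simp

text \<open>A supremum need not be attained, but it exceeds a exactly when some value does. That
  requires a set bounded above, so the bound 0 is carried along in the induction.\<close>

lemma sup_unit_balls_value:
  assumes X: "operator_system X" and F: "\<And>e. formula_value X e \<phi> \<le> 0"
  shows "formula_value X e (sup_unit_balls m \<phi>) \<le> 0 \<and>
    (a < formula_value X e (sup_unit_balls m \<phi>) \<longleftrightarrow>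
      (\<exists>e'. (\<forall>n i. n \<noteq> 1 \<or> i \<ge> m \<longrightarrow> e' n i = e n i) \<and> (\<forall>i<m. e' 1 i \<in> mat_ball 1 1 X) \<and> a < formula_value X e' \<phi>))"
proof (induction m arbitrary: e)
  case 0
  have "(\<forall>n i. e' n i = e n i) \<longleftrightarrow> e' = e" for e' by auto
  then show ?case using F by simp
next
  case (Suc m)
  let ?B = "mat_ball 1 1 X"
  let ?f = "\<lambda>x. formula_value X (e(1 := (e 1)(m := x))) (sup_unit_balls m \<phi>)"
  have ne: "?B \<noteq> {}"
    using operator_systemD[OF X] mat_norm_zero[of 1 1] by (auto simp: mat_ball_def mats_iff intro!: exI[of _ "0\<^sub>m 1 1"])
  have bdd: "bdd_above (?f ` ?B)" using Suc by (intro bdd_aboveI2[where M = 0]) auto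
  have "(SUP x\<in>?B. ?f x) \<le> 0" using ne Suc by (intro cSUP_least) auto
  moreover have "a < (SUP x\<in>?B. ?f x) \<longleftrightarrow> (\<exists>x\<in>?B. a < ?f x)"
    by (rule less_cSUP_iff[OF ne bdd])
  moreover have "(\<exists>x\<in>?B. a < ?f x) \<longleftrightarrow>
     (\<exists>e'. (\<forall>n i. n \<noteq> 1 \<or> i \<ge> Suc m \<longrightarrow> e' n i = e n i) \<and> (\<forall>i<Suc m. e' 1 i \<in> ?B) \<and> a < formula_value X e' \<phi>)" (is "?L \<longleftrightarrow> ?R")
  proof
    assume ?L
    then obtain x where x: "x \<in> ?B" "a < ?f x" by blast
    from conjunct2[OF Suc, THEN iffD1, OF x(2)]
    obtain e' where e': "\<forall>n i. n \<noteq> 1 \<or> i \<ge> m \<longrightarrow> e' n i = (e(1 := (e 1)(m := x))) n i"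
      "\<forall>i<m. e' 1 i \<in> ?B" "a < formula_value X e' \<phi>" by blast
    have "e' 1 m = x" using e'(1) by auto
    then show ?R using x e' by (intro exI[of _ e']) (auto simp: less_Suc_eq)
  next
    assume ?R
    then obtain e' where e': "\<forall>n i. n \<noteq> 1 \<or> i \<ge> Suc m \<longrightarrow> e' n i = e n i"
      "\<forall>i<Suc m. e' 1 i \<in> ?B" "a < formula_value X e' \<phi>" by blast
    have "a < ?f (e' 1 m)"
    proof (rule conjunct2[OF Suc, THEN iffD2], intro exI[of _ e'] conjI allI impI)
      fix n i :: nat assume "n \<noteq> 1 \<or> m \<le> i"
      then show "e' n i = (e(1 := (e 1)(m := e' 1 m))) n i"
        using e'(1) by (cases "n = 1"; cases "i = m") auto
    qed (use e' in auto)
    then show ?L using e'(2) by blast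
  qed
  ultimately show ?case by simp
qed

lemma realizes_of_sentence_value:
  fixes X :: "'a::cstar_algebra set"
  assumes X: "operator_system X" and val: "- inverse (real (Suc a)) < sentence_value X (defect_sentence S)"
  shows "realizes_closed X S a"
proof -
  obtain e where e: "\<And>n i. n \<noteq> 1 \<or> i \<ge> defect_bound S \<Longrightarrow> e n i = 0\<^sub>m n n"
    "\<And>i. i < defect_bound S \<Longrightarrow> e 1 i \<in> mat_ball 1 1 X" "- inverse (real (Suc a)) < formula_value X e (defect_formula S)"
    using val sup_unit_balls_value[OF X defect_formula_value_le[of X _ S], where a = "- inverse (real (Suc a))" and e = "\<lambda>n i. 0\<^sub>m n n" and m = "defect_bound S"]
    unfolding sentence_value_def defect_sentence_def by blast
  have b: "e 1 i \<in> mat_ball 1 1 X" for i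
  proof (cases "i < defect_bound S")
    case False
    then show ?thesis using e(1)[of 1 i] operator_systemD[OF X] by (simp add: mat_ball_def mats_iff)
  qed (rule e(2))
  then have c: "e 1 i \<in> carrier_mat 1 1" for i by (auto simp: mat_ball_def mats_iff)
  have "seq_of e i \<in> X \<and> norm (seq_of e i) \<le> 1" for i
    using b[of i] mat_norm_1x1[OF c[of i]] by (auto simp: mat_ball_def mats_iff seq_of_def)
  moreover have "defect S (seq_of e) < inverse (real (Suc a))"
    using e(3) unfolding defect_formula_value[of e, OF c] by simp
  ultimately show ?thesis unfolding realizes_closed_def by blast
qed

lemma sentence_value_of_realizes:
  fixes X :: "'a::cstar_algebra set"
  assumes X: "operator_system X" and r: "realizes_open X S a"
  shows "- inverse (real (Suc a)) < sentence_value X (defect_sentence S)"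
proof -
  obtain y where y: "\<And>i. y i \<in> X" "\<And>i. norm (y i) < 1" "defect S y < inverse (real (Suc a))"
    using r by (auto simp: realizes_open_def)
  let ?m = "defect_bound S"
  \<comment> \<open>Only the quantified entries of y are stored; elsewhere e must agree with the
    zero assignment of \<open>sentence_value\<close>, and \<open>defect_cong\<close> shows that the
    defect does not notice.\<close>
  define e :: "nat \<Rightarrow> nat \<Rightarrow> 'a mat" where "e n i = (if n = 1 \<and> i < ?m then Matrix.mat 1 1 (\<lambda>_. y i) else 0\<^sub>m n n)" for n i
  have c: "e 1 i \<in> carrier_mat 1 1" for i by (simp add: e_def)
  have "e 1 i \<in> mat_ball 1 1 X" if "i < ?m" for i
    using mat_norm_1x1[OF c[of i]] that y(1,2)[of i] by (auto simp: mat_ball_def mats_iff e_def less_imp_le)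
  moreover have "defect S (seq_of e) = defect S y"
    by (rule defect_cong) (auto simp: seq_of_def e_def defect_bound_def)
  then have "- inverse (real (Suc a)) < formula_value X e (defect_formula S)"
    using y(3) unfolding defect_formula_value[of e, OF c] by simp
  moreover have "e n i = 0\<^sub>m n n" if "n \<noteq> 1 \<or> i \<ge> ?m" for n i
    using that by (auto simp: e_def)
  ultimately show ?thesis
    using sup_unit_balls_value[OF X defect_formula_value_le[of X _ S], where a = "- inverse (real (Suc a))" and e = "\<lambda>n i. 0\<^sub>m n n" and m = ?m]
    unfolding sentence_value_def defect_sentence_def by blast
qed

lemma completely_order_isomorphic_of_sentences:
  fixes X :: "'a::cstar_algebra set" and Y :: "'b::cstar_algebra set"
  assumes X: "operator_system X" "finite_dimensional X" and Y: "operator_system Y" "finite_dimensional Y"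
    and eq: "\<And>\<phi>. sentence \<phi> \<Longrightarrow> prenex_universal \<phi> \<Longrightarrow> sentence_value X \<phi> = sentence_value Y \<phi>"
  shows "completely_order_isomorphic X Y"
proof -
  have "sentence_value X (defect_sentence S) = sentence_value Y (defect_sentence S)" for S
    by (intro eq defect_sentence)
  \<comment> \<open>A realization in one open ball pushes the common value above - 1 / (a + 1), and
    a value above that threshold yields a realization in the other closed ball.\<close>
  then have "realizes_open X S a \<Longrightarrow> realizes_closed Y S a" "realizes_open Y S a \<Longrightarrow> realizes_closed X S a" for S a
    using sentence_value_of_realizes[OF X(1), of S a] realizes_of_sentence_value[OF Y(1), of a S]
      sentence_value_of_realizes[OF Y(1), of S a] realizes_of_sentence_value[OF X(1), of a S] by auto
  then obtain u v where "complete_isometry X Y u" "complete_isometry Y X v"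
    using exists_complete_isometry[OF X Y] exists_complete_isometry[OF Y X] by metis
  then show ?thesis using completely_order_isomorphic_of_embeddings X Y(1) by blast
qed

lemma completely_order_isomorphic_iff_sentences:
  fixes X :: "'a::cstar_algebra set" and Y :: "'b::cstar_algebra set"
  assumes X: "operator_system X" "finite_dimensional X" and Y: "operator_system Y" "finite_dimensional Y"
  shows "completely_order_isomorphic X Y \<longleftrightarrow> (\<forall>\<phi>. sentence \<phi> \<and> universal \<phi> \<longrightarrow> sentence_value X \<phi> = sentence_value Y \<phi>)"
    and "completely_order_isomorphic X Y \<longleftrightarrow> (\<forall>\<phi>. sentence \<phi> \<and> prenex_universal \<phi> \<longrightarrow> sentence_value X \<phi> = sentence_value Y \<phi>)"
  using completely_order_isomorphic_of_sentences[OF assms] sentence_value_eq[of X Y] X(1) Y(1) prenex_universal_imp_universal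
  by (auto simp: sentence_def)

section \<open>Matrices over \<open>B(H)\<close> as operators on \<open>H\<^sup>n\<close>\<close>

lemma bounded_bilinear_cinner: "bounded_bilinear (cinner :: 'h::complex_hilbert_space \<Rightarrow> 'h \<Rightarrow> complex)"
proof
  show "\<exists>K. \<forall>x y :: 'h. norm (cinner x y) \<le> norm x * norm y * K"
    by (rule exI[of _ 1]) (simp add: cmod_cinner_le)
qed (simp_all add: cinner_add_left cinner_add_right cinner_scaleR_left cinner_scaleR_right scaleR_conv_of_real)

lemmas tendsto_cinner = bounded_bilinear.tendsto[OF bounded_bilinear_cinner]
lemmas cinner_sum_right = bounded_bilinear.sum_right[OF bounded_bilinear_cinner]
lemmas cinner_zero_right = bounded_bilinear.zero_right[OF bounded_bilinear_cinner]
lemmas tendsto_op_apply = bounded_linear.tendsto[OF bounded_linear_op_apply]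

lemma op_apply_0 [simp]: "op_apply 0 x = 0"
  by transfer simp

lemma op_apply_sum: "op_apply (\<Sum>i\<in>I. F i) x = (\<Sum>i\<in>I. op_apply (F i) x)"
  by (induction I rule: infinite_finite_induct) (auto simp: op_apply_add)

lemma cinner_star_right: "cinner x (op_apply (star T) y) = cinner (op_apply T x) y"
  for T :: "'h::separable_hilbert_space bounded_op"
  by (simp add: star_bounded_op_def op_adjoint_right)

lemma norm_op_le_iff:
  fixes T :: "'h::complex_hilbert_space bounded_op"
  assumes "r \<ge> 0"
  shows "norm T \<le> r \<longleftrightarrow> (\<forall>x y. cmod (cinner x (op_apply T y)) \<le> r * norm x * norm y)"
proof (intro iffI allI)
  fix x y assume r: "norm T \<le> r"
  have "cmod (cinner x (op_apply T y)) \<le> norm x * (norm T * norm y)"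
    by (rule order_trans[OF cmod_cinner_le mult_left_mono[OF norm_op_apply]]) simp
  also have "\<dots> \<le> norm x * (r * norm y)" using r by (intro mult_left_mono mult_right_mono) auto
  finally show "cmod (cinner x (op_apply T y)) \<le> r * norm x * norm y" by (simp add: mult_ac)
next
  assume le: "\<forall>x y. cmod (cinner x (op_apply T y)) \<le> r * norm x * norm y"
  show "norm T \<le> r"
  proof (rule norm_op_bound[OF assms])
    fix y
    have "norm (op_apply T y) * norm (op_apply T y) = cmod (cinner (op_apply T y) (op_apply T y))"
      by (simp add: cinner_self power2_eq_square norm_mult)
    also have "\<dots> \<le> r * norm (op_apply T y) * norm y" using le by blast
    finally have "norm (op_apply T y) * norm (op_apply T y) \<le> (r * norm y) * norm (op_apply T y)" by (simp add: mult_ac)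
    then show "norm (op_apply T y) \<le> r * norm y"
      using assms by (cases "op_apply T y = 0") auto
  qed
qed

lemma cinner_cip:
  fixes X :: "'h::separable_hilbert_space bounded_op Matrix.vec"
  shows "cinner k (op_apply (cip X X) h) =
    (\<Sum>i<dim_vec X. cinner (op_apply (vec_index X i) k) (op_apply (vec_index X i) h))"
  by (simp add: cip_def op_apply_sum cinner_sum_right op_apply_mult cinner_star_right)

text \<open>A column of operators is a single operator from H to H^n. Here \<open>cip X X\<close> is
  its adjoint composed with itself, so \<open>column_norm\<close> is its operator norm.\<close>

lemma column_norm_le_iff:
  fixes X :: "'h::separable_hilbert_space bounded_op Matrix.vec"
  assumes c: "c \<ge> 0"
  shows "column_norm X \<le> c \<longleftrightarrow> (\<forall>h. (\<Sum>i<dim_vec X. (norm (op_apply (vec_index X i) h))\<^sup>2) \<le> (c * norm h)\<^sup>2)"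
proof (intro iffI allI)
  fix h :: 'h assume "column_norm X \<le> c"
  then have "(column_norm X)\<^sup>2 \<le> c\<^sup>2" by (intro power_mono) auto
  then have nc: "norm (cip X X) \<le> c\<^sup>2" by (simp add: column_norm_power2)
  have "complex_of_real (\<Sum>i<dim_vec X. (norm (op_apply (vec_index X i) h))\<^sup>2) = cinner h (op_apply (cip X X) h)"
    by (simp add: cinner_cip cinner_self)
  then have "(\<Sum>i<dim_vec X. (norm (op_apply (vec_index X i) h))\<^sup>2) \<le> cmod (cinner h (op_apply (cip X X) h))"
    by (metis abs_ge_self norm_of_real)
  also have "\<dots> \<le> c\<^sup>2 * norm h * norm h" using nc norm_op_le_iff[of "c\<^sup>2" "cip X X"] by (meson zero_le_power2)
  finally show "(\<Sum>i<dim_vec X. (norm (op_apply (vec_index X i) h))\<^sup>2) \<le> (c * norm h)\<^sup>2"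
    by (simp add: power_mult_distrib power2_eq_square mult_ac)
next
  assume le: "\<forall>h. (\<Sum>i<dim_vec X. (norm (op_apply (vec_index X i) h))\<^sup>2) \<le> (c * norm h)\<^sup>2"
  have L2: "L2_set (\<lambda>i. norm (op_apply (vec_index X i) h)) {..<dim_vec X} \<le> c * norm h" for h
    unfolding L2_set_def using le c by (intro real_le_lsqrt) (auto intro: sum_nonneg)
  have "norm (cip X X) \<le> c\<^sup>2"
  proof (subst norm_op_le_iff, simp, intro allI)
    fix k h :: 'h
    have "cmod (cinner k (op_apply (cip X X) h)) \<le> (\<Sum>i<dim_vec X. norm (op_apply (vec_index X i) k) * norm (op_apply (vec_index X i) h))"
      unfolding cinner_cip by (intro order_trans[OF norm_sum] sum_mono cmod_cinner_le)
    also have "\<dots> \<le> L2_set (\<lambda>i. norm (op_apply (vec_index X i) k)) {..<dim_vec X} * L2_set (\<lambda>i. norm (op_apply (vec_index X i) h)) {..<dim_vec X}"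
      using L2_set_mult_ineq[of "\<lambda>i. norm (op_apply (vec_index X i) k)" "\<lambda>i. norm (op_apply (vec_index X i) h)"] by simp
    also have "\<dots> \<le> (c * norm k) * (c * norm h)"
      using c by (intro mult_mono L2) (auto simp: L2_set_nonneg)
    finally show "cmod (cinner k (op_apply (cip X X) h)) \<le> c\<^sup>2 * norm k * norm h"
      by (simp add: power2_eq_square mult_ac)
  qed
  then have "(column_norm X)\<^sup>2 \<le> c\<^sup>2" by (simp add: column_norm_power2)
  then show "column_norm X \<le> c" using c by (rule power2_le_imp_le)
qed

lemma rank_one_exists:
  fixes \<xi> \<eta> :: "'h::complex_hilbert_space"
  shows "\<exists>T. \<forall>x. op_apply T x = cinner \<eta> x *\<^sub>C \<xi>"
proof (intro exI allI)
  fix x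
  have "bounded_linear (\<lambda>x. cinner \<eta> x *\<^sub>C \<xi>)"
  proof (rule bounded_linear_intro[of _ "norm \<eta> * norm \<xi>"])
    fix x y :: 'h and r :: real
    show "cinner \<eta> (x + y) *\<^sub>C \<xi> = cinner \<eta> x *\<^sub>C \<xi> + cinner \<eta> y *\<^sub>C \<xi>"
      by (simp add: cinner_add_right scaleC_add_left)
    show "cinner \<eta> (r *\<^sub>R x) *\<^sub>C \<xi> = r *\<^sub>R (cinner \<eta> x *\<^sub>C \<xi>)"
      unfolding cinner_scaleR_right by (simp add: scaleR_scaleC scaleC_scaleC)
    show "norm (cinner \<eta> x *\<^sub>C \<xi>) \<le> norm x * (norm \<eta> * norm \<xi>)"
      using mult_right_mono[OF cmod_cinner_le[of \<eta> x], of "norm \<xi>"] by (simp add: norm_scaleC mult_ac)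
  qed
  then show "op_apply (Op (Blinfun (\<lambda>x. cinner \<eta> x *\<^sub>C \<xi>))) x = cinner \<eta> x *\<^sub>C \<xi>"
    by (subst op_apply_Op) (auto simp: cinner_scaleC_right scaleC_scaleC)
qed

text \<open>Identifies \<open>mat_norm\<close> with the operator norm on H^n. A vector \<xi> of H^n
  becomes the column of rank one operators sending x to <\<eta>, x> \<xi>_j, with \<eta> a fixed
  unit vector; its column norm is at most norm \<xi>, and at \<eta> it returns \<xi>. Conversely, a
  column is evaluated at each h.\<close>

lemma mat_norm_le_iff_hilbert:
  fixes a :: "'h::separable_hilbert_space bounded_op mat"
  assumes a: "a \<in> carrier_mat n n" and r: "r \<ge> 0"
  shows "mat_norm a \<le> r \<longleftrightarrow>
    (\<forall>\<xi>. (\<Sum>i<n. (norm (\<Sum>j<n. op_apply (a $$ (i, j)) (\<xi> j)))\<^sup>2) \<le> r\<^sup>2 * (\<Sum>j<n. (norm (\<xi> j))\<^sup>2))"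
proof -
  have ap: "op_apply (vec_index (a *\<^sub>v X) i) h = (\<Sum>j<n. op_apply (a $$ (i, j)) (op_apply (vec_index X j) h))"
    if "X \<in> carrier_vec n" "i < n" for X i h
    unfolding index_mult_mat_vec_sum[OF a that] by (simp add: op_apply_sum op_apply_mult)
  have dim: "dim_vec (a *\<^sub>v X) = n" for X using a by simp
  show ?thesis
  proof (intro iffI allI)
    fix \<xi> :: "nat \<Rightarrow> 'h" assume le: "mat_norm a \<le> r"
    obtain \<eta>0 :: 'h where "\<eta>0 \<noteq> 0" using separable_hilbert_space_nonzero by blast
    define \<eta> where "\<eta> = inverse (norm \<eta>0) *\<^sub>R \<eta>0"
    have \<eta>: "norm \<eta> = 1" using \<open>\<eta>0 \<noteq> 0\<close> by (simp add: \<eta>_def)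
    have "\<forall>j. \<exists>T. \<forall>x. op_apply T x = cinner \<eta> x *\<^sub>C \<xi> j" using rank_one_exists[of \<eta>] by blast
    then obtain T where T: "\<And>j x. op_apply (T j) x = cinner \<eta> x *\<^sub>C \<xi> j" by metis
    define X where "X = Matrix.vec n T"
    have X: "X \<in> carrier_vec n" by (simp add: X_def)
    define c where "c = sqrt (\<Sum>j<n. (norm (\<xi> j))\<^sup>2)"
    have c: "c \<ge> 0" "c\<^sup>2 = (\<Sum>j<n. (norm (\<xi> j))\<^sup>2)" by (auto simp: c_def sum_nonneg)
    have "column_norm X \<le> c"
    proof (subst column_norm_le_iff[OF c(1)], intro allI)
      fix h :: 'h
      have "(\<Sum>i<dim_vec X. (norm (op_apply (vec_index X i) h))\<^sup>2) = (cmod (cinner \<eta> h))\<^sup>2 * c\<^sup>2"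
        by (simp add: X_def T norm_scaleC power_mult_distrib c sum_distrib_left)
      also have "\<dots> \<le> (norm h)\<^sup>2 * c\<^sup>2"
        using cmod_cinner_le[of \<eta> h] by (intro mult_right_mono power_mono) (auto simp: \<eta>)
      finally show "(\<Sum>i<dim_vec X. (norm (op_apply (vec_index X i) h))\<^sup>2) \<le> (c * norm h)\<^sup>2"
        by (simp add: power_mult_distrib mult.commute)
    qed
    then have "mat_norm a * column_norm X \<le> r * c"
      using le r mat_norm_nonneg[OF a] by (intro mult_mono) auto
    then have "column_norm (a *\<^sub>v X) \<le> r * c" using column_norm_mult_mat_vec[OF a X] by linarith
    moreover have "r * c \<ge> 0" using r c by simp
    ultimately have "(\<Sum>i<n. (norm (op_apply (vec_index (a *\<^sub>v X) i) \<eta>))\<^sup>2) \<le> (r * c * norm \<eta>)\<^sup>2"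
      using column_norm_le_iff[of "r * c" "a *\<^sub>v X"] unfolding dim by blast
    moreover have "op_apply (vec_index X j) \<eta> = \<xi> j" if "j < n" for j
      using that by (simp add: X_def T cinner_self \<eta> scaleC_one)
    ultimately show "(\<Sum>i<n. (norm (\<Sum>j<n. op_apply (a $$ (i, j)) (\<xi> j)))\<^sup>2) \<le> r\<^sup>2 * (\<Sum>j<n. (norm (\<xi> j))\<^sup>2)"
      by (simp add: ap[OF X] \<eta> power_mult_distrib c)
  next
    assume le: "\<forall>\<xi>. (\<Sum>i<n. (norm (\<Sum>j<n. op_apply (a $$ (i, j)) (\<xi> j)))\<^sup>2) \<le> r\<^sup>2 * (\<Sum>j<n. (norm (\<xi> j))\<^sup>2)"
    show "mat_norm a \<le> r"
    proof (rule mat_norm_leI[OF a _ r])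
      fix X :: "'h bounded_op Matrix.vec" assume X: "X \<in> carrier_vec n"
      show "column_norm (a *\<^sub>v X) \<le> r * column_norm X"
      proof (subst column_norm_le_iff, simp add: r, intro allI)
        fix h :: 'h
        have "(\<Sum>i<n. (norm (op_apply (vec_index (a *\<^sub>v X) i) h))\<^sup>2) \<le> r\<^sup>2 * (\<Sum>j<n. (norm (op_apply (vec_index X j) h))\<^sup>2)"
          using le[rule_format, of "\<lambda>j. op_apply (vec_index X j) h"] by (simp add: ap[OF X])
        also have "\<dots> \<le> r\<^sup>2 * (column_norm X * norm h)\<^sup>2"
          using column_norm_le_iff[OF column_norm_nonneg, of X X] X by (intro mult_left_mono) auto
        finally show "(\<Sum>i<dim_vec (a *\<^sub>v X). (norm (op_apply (vec_index (a *\<^sub>v X) i) h))\<^sup>2) \<le> (r * column_norm X * norm h)\<^sup>2"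
          by (simp only: dim) (simp add: power_mult_distrib mult_ac)
      qed
    qed
  qed
qed

section \<open>Weakly measurable families of operators\<close>

definition dense_seq :: "nat \<Rightarrow> 'h::separable_hilbert_space" where
  "dense_seq = (SOME d. \<forall>U. open U \<and> U \<noteq> {} \<longrightarrow> (\<exists>n. d n \<in> U))"

lemma dense_seq: "open U \<Longrightarrow> U \<noteq> {} \<Longrightarrow> \<exists>n. (dense_seq n :: 'h::separable_hilbert_space) \<in> U"
proof -
  obtain D :: "'h set" where D: "countable D" "\<And>U. open U \<Longrightarrow> U \<noteq> {} \<Longrightarrow> \<exists>d\<in>D. d \<in> U"
    using countable_dense_exists by blast
  have "D \<noteq> {}" using D(2)[of UNIV] by auto
  then have "range (from_nat_into D) = D" using D(1) by (rule range_from_nat_into)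
  then have "\<exists>d. \<forall>U. open U \<and> U \<noteq> {} \<longrightarrow> (\<exists>n::nat. (d n :: 'h) \<in> U)"
    using D(2) by (intro exI[of _ "from_nat_into D"]) (metis rangeE)
  then have "\<forall>U. open U \<and> U \<noteq> {} \<longrightarrow> (\<exists>n. (dense_seq n :: 'h) \<in> U)"
    unfolding dense_seq_def by (rule someI_ex)
  then show "open U \<Longrightarrow> U \<noteq> {} \<Longrightarrow> \<exists>n. (dense_seq n :: 'h) \<in> U" by blast
qed

lemma dense_seq_tendsto: "\<exists>k. (\<lambda>t. dense_seq (k t)) \<longlonglongrightarrow> (x :: 'h::separable_hilbert_space)"
proof -
  have "\<exists>k. dist (dense_seq k) x < inverse (real (Suc t))" for t
    using dense_seq[of "ball x (inverse (real (Suc t)))"] by (auto simp: dist_commute)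
  then obtain k where k: "\<And>t. dist (dense_seq (k t)) x < inverse (real (Suc t))" by metis
  have "(\<lambda>t. dist (dense_seq (k t)) x) \<longlonglongrightarrow> 0"
    by (rule Lim_null_comparison[OF _ LIMSEQ_inverse_real_of_nat])
      (use k in \<open>auto intro!: always_eventually less_imp_le simp del: of_nat_Suc\<close>)
  then show ?thesis using tendsto_dist_iff by blast
qed

text \<open>Combinations of words involve sums, scalars and adjoints but no products of operators,
  so this property passes to them directly.\<close>

definition weakly_measurable :: "'b measure \<Rightarrow> ('b \<Rightarrow> 'h::separable_hilbert_space bounded_op) \<Rightarrow> bool" where
  "weakly_measurable M F \<longleftrightarrow> (\<forall>x y. (\<lambda>\<omega>. cinner x (op_apply (F \<omega>) y)) \<in> borel_measurable M)"

lemma weakly_measurable_zero: "weakly_measurable M (\<lambda>_. 0)"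
  by (simp add: weakly_measurable_def cinner_zero_right)

lemma weakly_measurable_one: "weakly_measurable M (\<lambda>_. 1)"
  by (simp add: weakly_measurable_def)

lemma weakly_measurable_sum: "(\<And>i. i \<in> I \<Longrightarrow> weakly_measurable M (F i)) \<Longrightarrow> weakly_measurable M (\<lambda>\<omega>. \<Sum>i\<in>I. F i \<omega>)"
  by (auto simp: weakly_measurable_def op_apply_sum cinner_sum_right intro!: borel_measurable_sum)

lemma weakly_measurable_scaleC: "weakly_measurable M F \<Longrightarrow> weakly_measurable M (\<lambda>\<omega>. c *\<^sub>C F \<omega>)"
  by (auto simp: weakly_measurable_def op_apply_scaleC cinner_scaleC_right intro!: borel_measurable_times)

lemma weakly_measurable_star:
  assumes "weakly_measurable M F"
  shows "weakly_measurable M (\<lambda>\<omega>. star (F \<omega>))"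
proof -
  have "cinner x (op_apply (star (F \<omega>)) y) = cnj (cinner y (op_apply (F \<omega>) x))" for x y \<omega>
    by (metis cinner_star_right cinner_commute)
  moreover have "cnj \<in> borel_measurable borel" by (intro borel_measurable_continuous_onI continuous_intros)
  ultimately show ?thesis using assms unfolding weakly_measurable_def
    by (auto intro: measurable_compose[of _ _ borel cnj])
qed

lemma weakly_measurable_diff: "weakly_measurable M F \<Longrightarrow> weakly_measurable M G \<Longrightarrow> weakly_measurable M (\<lambda>\<omega>. F \<omega> - G \<omega>)"
  by (auto simp: weakly_measurable_def op_apply_minus cinner_diff_right intro!: borel_measurable_diff)

lemma weakly_measurable_word: "(\<And>i. weakly_measurable M (\<lambda>\<omega>. z \<omega> i)) \<Longrightarrow> weakly_measurable M (\<lambda>\<omega>. word (z \<omega>) k)"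
  by (cases k rule: word_cases) (auto intro: weakly_measurable_one weakly_measurable_star)

lemma weakly_measurable_comb: "(\<And>i. weakly_measurable M (\<lambda>\<omega>. z \<omega> i)) \<Longrightarrow> weakly_measurable M (\<lambda>\<omega>. comb N c (z \<omega>))"
  unfolding comb_def by (intro weakly_measurable_sum weakly_measurable_scaleC weakly_measurable_word)

text \<open>By Cauchy-Schwarz and density, norm w <= r amounts to countably many inequalities
  between w and the members of \<open>dense_seq\<close>.\<close>

lemma weakly_measurable_vec_norm:
  fixes v :: "'b \<Rightarrow> 'h::separable_hilbert_space"
  assumes "\<And>x. (\<lambda>\<omega>. cinner x (v \<omega>)) \<in> borel_measurable M"
  shows "(\<lambda>\<omega>. norm (v \<omega>)) \<in> borel_measurable M"
proof (rule borel_measurableI_le)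
  fix r :: real
  show "{\<omega> \<in> space M. norm (v \<omega>) \<le> r} \<in> sets M"
  proof (cases "r \<ge> 0")
    case True
    have iff: "norm w \<le> r \<longleftrightarrow> (\<forall>i. cmod (cinner (dense_seq i) w) \<le> r * norm (dense_seq i :: 'h))" for w :: 'h
    proof (intro iffI allI)
      fix i assume w: "norm w \<le> r"
      have "cmod (cinner (dense_seq i) w) \<le> norm (dense_seq i :: 'h) * norm w" by (rule cmod_cinner_le)
      also have "\<dots> \<le> norm (dense_seq i :: 'h) * r" by (intro mult_left_mono w) simp
      finally show "cmod (cinner (dense_seq i) w) \<le> r * norm (dense_seq i :: 'h)" by (simp add: mult.commute)
    next
      assume le: "\<forall>i. cmod (cinner (dense_seq i) w) \<le> r * norm (dense_seq i :: 'h)"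
      obtain k where k: "(\<lambda>t. dense_seq (k t)) \<longlonglongrightarrow> w" using dense_seq_tendsto by blast
      have "cmod (cinner w w) \<le> r * norm w"
        by (rule LIMSEQ_le[OF tendsto_norm[OF tendsto_cinner[OF k tendsto_const]] tendsto_mult[OF tendsto_const tendsto_norm[OF k]]])
          (use le in auto)
      then have "norm w * norm w \<le> r * norm w" by (simp add: cinner_self norm_mult power2_eq_square)
      then show "norm w \<le> r" using True by (cases "w = 0") auto
    qed
    have "{\<omega> \<in> space M. cmod (cinner (dense_seq i) (v \<omega>)) \<le> r * norm (dense_seq i :: 'h)} \<in> sets M" for i
      by (rule borel_measurable_le[OF measurable_compose[OF assms borel_measurable_norm] borel_measurable_const])
    then have "{\<omega> \<in> space M. \<forall>i. cmod (cinner (dense_seq i) (v \<omega>)) \<le> r * norm (dense_seq i :: 'h)} \<in> sets M"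
      by (rule sets.sets_Collect_countable_All)
    then show ?thesis by (simp add: iff)
  next
    case False
    then have "\<not> norm (v \<omega>) \<le> r" for \<omega> using norm_ge_zero[of "v \<omega>"] by linarith
    then show ?thesis by simp
  qed
qed

lemma weakly_measurable_mat_norm:
  fixes F :: "'b \<Rightarrow> 'h::separable_hilbert_space bounded_op mat"
  assumes F: "\<And>\<omega>. F \<omega> \<in> carrier_mat n n" and meas: "\<And>i j. i < n \<Longrightarrow> j < n \<Longrightarrow> weakly_measurable M (\<lambda>\<omega>. F \<omega> $$ (i, j))"
  shows "(\<lambda>\<omega>. mat_norm (F \<omega>)) \<in> borel_measurable M"
proof (rule borel_measurableI_le)
  fix r :: real
  let ?L = "\<lambda>\<omega> \<xi>. \<Sum>i<n. (norm (\<Sum>j<n. op_apply (F \<omega> $$ (i, j)) (\<xi> j :: 'h)))\<^sup>2"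
  let ?R = "\<lambda>\<xi>. r\<^sup>2 * (\<Sum>j<n. (norm (\<xi> j :: 'h))\<^sup>2)"
  show "{\<omega> \<in> space M. mat_norm (F \<omega>) \<le> r} \<in> sets M"
  proof (cases "r \<ge> 0")
    case True
    \<comment> \<open>Lists of numbers give a countable index set for tuples of dense vectors. A
      list shorter than n still denotes some tuple, so quantifying over all lists asks for nothing
      false.\<close>
    have iff: "mat_norm (F \<omega>) \<le> r \<longleftrightarrow> (\<forall>l::nat list. ?L \<omega> (\<lambda>j. dense_seq (l ! j)) \<le> ?R (\<lambda>j. dense_seq (l ! j)))" for \<omega>
    proof (intro iffI allI)
      fix l :: "nat list" assume "mat_norm (F \<omega>) \<le> r"
      then show "?L \<omega> (\<lambda>j. dense_seq (l ! j)) \<le> ?R (\<lambda>j. dense_seq (l ! j))"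
        by (rule mat_norm_le_iff_hilbert[OF F True, THEN iffD1, rule_format])
    next
      assume le: "\<forall>l::nat list. ?L \<omega> (\<lambda>j. dense_seq (l ! j)) \<le> ?R (\<lambda>j. dense_seq (l ! j))"
      show "mat_norm (F \<omega>) \<le> r"
      proof (subst mat_norm_le_iff_hilbert[OF F True], intro allI)
        fix \<xi> :: "nat \<Rightarrow> 'h"
        have "\<forall>j. \<exists>k. (\<lambda>t. dense_seq (k t)) \<longlonglongrightarrow> \<xi> j" using dense_seq_tendsto by blast
        from choice[OF this] obtain k where k: "\<And>j. (\<lambda>t. dense_seq (k j t)) \<longlonglongrightarrow> \<xi> j" by blast
        have le': "?L \<omega> (\<lambda>j. dense_seq (k j t)) \<le> ?R (\<lambda>j. dense_seq (k j t))" for t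
          using le[rule_format, of "map (\<lambda>j. k j t) [0..<n]"] by simp
        have "(\<lambda>t. ?L \<omega> (\<lambda>j. dense_seq (k j t))) \<longlonglongrightarrow> ?L \<omega> \<xi>"
          by (intro tendsto_sum tendsto_power tendsto_norm tendsto_op_apply k)
        moreover have "(\<lambda>t. ?R (\<lambda>j. dense_seq (k j t))) \<longlonglongrightarrow> ?R \<xi>"
          by (intro tendsto_mult tendsto_const tendsto_sum tendsto_power tendsto_norm k)
        ultimately show "?L \<omega> \<xi> \<le> ?R \<xi>" by (rule LIMSEQ_le) (use le' in blast)
      qed
    qed
    have meas': "(\<lambda>\<omega>. ?L \<omega> \<xi>) \<in> borel_measurable M" for \<xi>
    proof (intro borel_measurable_sum borel_measurable_power weakly_measurable_vec_norm)
      fix i x assume "i \<in> {..<n}"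
      then show "(\<lambda>\<omega>. cinner x (\<Sum>j<n. op_apply (F \<omega> $$ (i, j)) (\<xi> j))) \<in> borel_measurable M"
        using meas unfolding cinner_sum_right weakly_measurable_def by (intro borel_measurable_sum) auto
    qed
    have "{\<omega> \<in> space M. ?L \<omega> (\<lambda>j. dense_seq (l ! j)) \<le> ?R (\<lambda>j. dense_seq (l ! j))} \<in> sets M" for l :: "nat list"
      by (intro borel_measurable_le meas' borel_measurable_const)
    then have "{\<omega> \<in> space M. \<forall>l::nat list. ?L \<omega> (\<lambda>j. dense_seq (l ! j)) \<le> ?R (\<lambda>j. dense_seq (l ! j))} \<in> sets M"
      by (rule sets.sets_Collect_countable_All)
    then show ?thesis by (simp only: iff)
  next
    case False
    then have "\<not> mat_norm (F \<omega>) \<le> r" for \<omega> using mat_norm_nonneg[OF F[of \<omega>]] by linarith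
    then show ?thesis by simp
  qed
qed

lemma weakly_measurable_norm:
  fixes F :: "'b \<Rightarrow> 'h::separable_hilbert_space bounded_op"
  assumes "weakly_measurable M F"
  shows "(\<lambda>\<omega>. norm (F \<omega>)) \<in> borel_measurable M"
proof -
  have "(\<lambda>\<omega>. mat_norm (Matrix.mat 1 1 (\<lambda>_. F \<omega>))) \<in> borel_measurable M"
    by (rule weakly_measurable_mat_norm) (use assms in auto)
  then show ?thesis by (simp add: mat_norm_1x1)
qed

lemma weakly_measurable_defect:
  assumes z: "\<And>i. weakly_measurable M (\<lambda>\<omega>. z \<omega> i)"
  shows "(\<lambda>\<omega>. defect S (z \<omega>)) \<in> borel_measurable M"
proof -
  have "(\<lambda>\<omega>. condition_norm q (z \<omega>)) \<in> borel_measurable M" for q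
  proof -
    obtain n N s r where q: "q = (n, N, s, r)" by (cases q)
    have "(\<lambda>\<omega>. mat_norm (mcomb (Suc n) N (gcoef2 s) (z \<omega>))) \<in> borel_measurable M"
      by (rule weakly_measurable_mat_norm[where n = "Suc n"]) (auto simp: mcomb_def intro!: weakly_measurable_comb z)
    then show ?thesis by (simp add: q condition_norm_def)
  qed
  then show ?thesis unfolding defect_def by (intro borel_measurable_sum borel_measurable_abs borel_measurable_diff borel_measurable_const)
qed

section \<open>The standard Borel structure of \<open>B(H)\<close>\<close>

lemma space_borel_of [simp]: "space (borel_of T) = topspace T"
  by (simp add: borel_of_def openin_subset space_measure_of_conv)

lemma sets_borel_of: "sets (borel_of T) = sigma_sets (topspace T) {U. openin T U}"
  unfolding borel_of_def by (rule sets_measure_of) (auto dest: openin_subset)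

lemma borel_of_euclidean: "borel_of euclidean = (borel :: 'a::topological_space measure)"
  by (simp add: borel_of_def borel_def flip: open_openin)

lemma polish_space_euclidean: "polish_space (euclidean :: (nat \<Rightarrow> real) topology)"
proof -
  obtain D :: "(nat \<Rightarrow> real) set" where D: "countable D" "\<And>U. open U \<Longrightarrow> U \<noteq> {} \<Longrightarrow> \<exists>d\<in>D. d \<in> U"
    using countable_dense_exists by blast
  have "closure D = UNIV"
    using D(2)[of "- closure D"] closure_subset by (auto simp: open_Compl)
  then have "separable_space (euclidean :: (nat \<Rightarrow> real) topology)"
    using D(1) by (auto simp: separable_space_def)
  then show ?thesis by (simp add: polish_space_def completely_metrizable_space_euclidean)
qed

definition cball_op :: "nat \<Rightarrow> 'h::separable_hilbert_space bounded_op set" where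
  "cball_op K = cball 0 (real K)"

text \<open>The sesquilinear form of T. Open sets of the weak operator topology are the preimages
  under this map of open sets in the product topology of all functions on pairs of vectors.\<close>

definition op_form :: "'h::complex_hilbert_space bounded_op \<Rightarrow> 'h \<times> 'h \<Rightarrow> complex" where
  "op_form T = (\<lambda>(x, y). cinner x (op_apply T y))"

lemma UN_cball_op: "(\<Union>K. cball_op K) = UNIV"
  using real_arch_simple by (auto simp: cball_op_def)

definition generating_sets :: "'h::separable_hilbert_space bounded_op set set" where
  "generating_sets = {A. \<forall>n::nat. A \<inter> cball 0 (real n) \<in>
           sets (borel_of (subtopology weak_operator_topology (cball 0 (real n))))}"

lemma borel_bounded_op: "space borel_bounded_op = UNIV" "sets borel_bounded_op = sigma_sets UNIV generating_sets"
  by (simp_all add: borel_bounded_op_def generating_sets_def space_measure_of_conv sets_measure_of)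

lemma openin_weak_operator_topology:
  fixes U :: "'h::separable_hilbert_space bounded_op set"
  shows "openin weak_operator_topology U \<longleftrightarrow> (\<exists>V. open V \<and> U = op_form -` V)"
proof -
  have "(op_form :: 'h bounded_op \<Rightarrow> _) = (\<lambda>T (x, y). cinner x (op_apply T y))" by (simp add: op_form_def fun_eq_iff)
  then show ?thesis by (simp add: weak_operator_topology_def openin_pullback_topology)
qed

lemma openin_ball_topology:
  "openin (subtopology weak_operator_topology (cball_op K)) U \<longleftrightarrow> (\<exists>V. open V \<and> U = op_form -` V \<inter> cball_op K)"
  by (auto simp: openin_subtopology openin_weak_operator_topology)

lemma topspace_ball_topology: "topspace (subtopology weak_operator_topology (cball_op K)) = cball_op K"
  by (simp add: weak_operator_topology_def topspace_pullback_topology)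

lemma weakly_measurable_borel_bounded_op: "weakly_measurable borel_bounded_op (\<lambda>T. T)"
  unfolding weakly_measurable_def
proof (intro allI borel_measurableI)
  fix x y :: 'a and S :: "complex set" assume S: "open S"
  have "open ((\<lambda>\<phi>::'a \<times> 'a \<Rightarrow> complex. \<phi> (x, y)) -` S)"
    by (intro open_vimage S continuous_on_product_coordinates)
  then have "openin (subtopology weak_operator_topology (cball_op K))
     ((\<lambda>T. cinner x (op_apply T y)) -` S \<inter> cball_op K)" for K
    unfolding openin_ball_topology by (auto simp: op_form_def vimage_def intro!: exI)
  then have "(\<lambda>T. cinner x (op_apply T y)) -` S \<in> generating_sets"
    by (auto simp: generating_sets_def sets_borel_of cball_op_def[symmetric])
  then show "(\<lambda>T. cinner x (op_apply T y)) -` S \<inter> space borel_bounded_op \<in> sets borel_bounded_op"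
    by (simp add: borel_bounded_op)
qed

text \<open>Real and imaginary parts of the matrix coefficients along \<open>dense_seq\<close>; all
  nonzero b give the imaginary part again. Being defined on arbitrary functions, it is continuous on
  the whole product space and so carries compact sets of forms to compact sets.\<close>

definition form_code :: "('h::separable_hilbert_space \<times> 'h \<Rightarrow> complex) \<Rightarrow> nat \<Rightarrow> real" where
  "form_code \<phi> m = (case prod_decode m of (b, p) \<Rightarrow> case prod_decode p of (i, j) \<Rightarrow>
     if b = 0 then Re (\<phi> (dense_seq i, dense_seq j)) else Im (\<phi> (dense_seq i, dense_seq j)))"

definition op_code :: "'h::separable_hilbert_space bounded_op \<Rightarrow> nat \<Rightarrow> real" where
  "op_code T = form_code (op_form T)"

lemma continuous_form_code: "continuous_on UNIV form_code"
proof (intro continuous_on_coordinatewise_then_product)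
  fix m
  obtain b p where m: "prod_decode m = (b, p)" by (cases "prod_decode m")
  obtain i j where p: "prod_decode p = (i, j)" by (cases "prod_decode p")
  show "continuous_on UNIV (\<lambda>\<phi>. form_code \<phi> m)"
    unfolding form_code_def
    by (cases "b = 0") (auto simp: m p intro!: continuous_on_Re continuous_on_Im continuous_on_product_coordinates)
qed

lemma inj_op_code: "inj (op_code :: 'h::separable_hilbert_space bounded_op \<Rightarrow> _)"
proof (rule injI)
  fix S T :: "'h bounded_op" assume eq: "op_code S = op_code T"
  have d: "cinner (dense_seq i) (op_apply S (dense_seq j)) = cinner (dense_seq i) (op_apply T (dense_seq j))" for i j
    using fun_cong[OF eq, of "prod_encode (0, prod_encode (i, j))"] fun_cong[OF eq, of "prod_encode (1, prod_encode (i, j))"]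
    by (simp add: op_code_def form_code_def op_form_def complex_eq_iff)
  show "S = T"
  proof (intro op_eqI cinner_eqI)
    fix x z :: 'h
    obtain k where k: "(\<lambda>t. dense_seq (k t)) \<longlonglongrightarrow> z" using dense_seq_tendsto by blast
    obtain l where l: "(\<lambda>t. dense_seq (l t)) \<longlonglongrightarrow> x" using dense_seq_tendsto by blast
    have "(\<lambda>t. cinner (dense_seq (k t)) (op_apply S (dense_seq (l t)))) \<longlonglongrightarrow> cinner z (op_apply S x)"
      by (intro tendsto_cinner tendsto_op_apply k l)
    moreover have "(\<lambda>t. cinner (dense_seq (k t)) (op_apply S (dense_seq (l t)))) \<longlonglongrightarrow> cinner z (op_apply T x)"
      unfolding d by (intro tendsto_cinner tendsto_op_apply k l)
    ultimately show "cinner z (op_apply S x) = cinner z (op_apply T x)" by (rule LIMSEQ_unique)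
  qed
qed

text \<open>Balls of \<open>B(H)\<close> are compact in the weak operator topology: by the Riesz representation theorem they
  are the closed sets of bounded sesquilinear forms in a product of discs.\<close>

lemma form_of_operator:
  fixes \<phi> :: "'h::separable_hilbert_space \<times> 'h \<Rightarrow> complex"
  assumes K: "K \<ge> 0" and bound: "\<And>x y. cmod (\<phi> (x, y)) \<le> K * norm x * norm y"
    and add: "\<And>x y z. \<phi> (x, y + z) = \<phi> (x, y) + \<phi> (x, z)" and scale: "\<And>c x y. \<phi> (x, c *\<^sub>C y) = c * \<phi> (x, y)"
    and add': "\<And>x y z. \<phi> (x + y, z) = \<phi> (x, z) + \<phi> (y, z)" and scale': "\<And>c x y. \<phi> (c *\<^sub>C x, y) = cnj c * \<phi> (x, y)"
  shows "\<exists>T. norm T \<le> K \<and> op_form T = \<phi>"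
proof -
  have "\<exists>v. \<forall>y. \<phi> (x, y) = cinner v y" for x
  proof (rule riesz)
    show "bounded_linear (\<lambda>y. \<phi> (x, y))"
    proof (rule bounded_linear_intro[of _ "K * norm x"])
      show "norm (\<phi> (x, y)) \<le> norm y * (K * norm x)" for y using bound[of x y] by (simp only: mult_ac)
    qed (auto simp: add scaleR_scaleC scale scaleR_conv_of_real)
  qed (rule scale)
  then obtain s where s: "\<And>x y. \<phi> (x, y) = cinner (s x) y" by metis
  have s': "cinner y (s x) = cnj (\<phi> (x, y))" for x y by (metis s cinner_commute)
  have sC: "s (c *\<^sub>C x) = c *\<^sub>C s x" for c x
    by (rule cinner_eqI) (simp add: s' scale' cinner_scaleC_right)
  have norm_s: "norm (s x) \<le> norm x * K" for x
  proof -
    have "norm (s x) * norm (s x) = cmod (\<phi> (x, s x))" by (simp add: s cinner_self norm_mult power2_eq_square)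
    also have "\<dots> \<le> (norm x * K) * norm (s x)" using bound[of x "s x"] by (simp add: mult_ac)
    finally show ?thesis using K by (cases "s x = 0") auto
  qed
  have bl: "bounded_linear s"
  proof (rule bounded_linear_intro[of _ K])
    show "s (x + y) = s x + s y" for x y
      by (rule cinner_eqI) (simp add: s' add' cinner_add_right)
    show "s (r *\<^sub>R x) = r *\<^sub>R s x" for r x
      by (simp add: scaleR_scaleC sC)
  qed (rule norm_s)
  define S where "S = Op (Blinfun s)"
  have S: "op_apply S x = s x" for x unfolding S_def using op_apply_Op[OF bl sC] by simp
  have "norm S \<le> K" using norm_s K by (intro norm_op_bound) (auto simp: S mult.commute)
  \<comment> \<open>The operator s sits in the first slot of the inner product, so the form
    represented is that of the adjoint.\<close>
  moreover have "op_form (star S) = \<phi>"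
    by (auto simp: op_form_def cinner_star_right S s)
  ultimately show ?thesis by (intro exI[of _ "star S"]) simp
qed

lemma continuous_product_coordinate: "continuous_on UNIV (\<lambda>\<phi>::'b \<Rightarrow> complex. \<phi> p)"
  by (rule continuous_on_product_coordinates)

lemma compact_op_form_cball: "compact (op_form ` (cball_op K :: 'h::separable_hilbert_space bounded_op set))"
proof -
  define S where "S = {\<phi> :: 'h \<times> 'h \<Rightarrow> complex. (\<forall>x y. cmod (\<phi> (x, y)) \<le> real K * norm x * norm y) \<and>
    (\<forall>x y z. \<phi> (x, y + z) = \<phi> (x, y) + \<phi> (x, z)) \<and> (\<forall>c x y. \<phi> (x, c *\<^sub>C y) = c * \<phi> (x, y)) \<and>
    (\<forall>x y z. \<phi> (x + y, z) = \<phi> (x, z) + \<phi> (y, z)) \<and> (\<forall>c x y. \<phi> (c *\<^sub>C x, y) = cnj c * \<phi> (x, y))}"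
  have "op_form ` cball_op K = S"
  proof (intro equalityI subsetI)
    fix \<phi> :: "'h \<times> 'h \<Rightarrow> complex" assume "\<phi> \<in> op_form ` cball_op K"
    then obtain T where T: "norm T \<le> real K" "\<phi> = op_form T" by (auto simp: cball_op_def)
    then show "\<phi> \<in> S"
      using norm_op_le_iff[of "real K" T]
      by (simp add: S_def op_form_def op_apply_lin cinner_add_left cinner_add_right cinner_scaleC_left cinner_scaleC_right)
  next
    fix \<phi> assume "\<phi> \<in> S"
    then have "\<exists>T. norm T \<le> real K \<and> op_form T = \<phi>" by (intro form_of_operator) (auto simp: S_def)
    then show "\<phi> \<in> op_form ` cball_op K" by (auto simp: cball_op_def)
  qed
  moreover have "closed S"
    unfolding S_def
    by (intro closed_Collect_conj closed_Collect_all closed_Collect_le closed_Collect_eq continuous_on_add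
        continuous_on_mult continuous_on_const continuous_on_norm continuous_product_coordinate)
  moreover have "compact (PiE UNIV (\<lambda>(x, y). cball 0 (real K * norm x * norm y)) :: ('h \<times> 'h \<Rightarrow> complex) set)"
  proof -
    have "compactin euclidean (PiE UNIV (\<lambda>(x, y). cball 0 (real K * norm x * norm y)) :: ('h \<times> 'h \<Rightarrow> complex) set)"
      unfolding euclidean_product_topology[symmetric] compactin_PiE by auto
    then show ?thesis by simp
  qed
  moreover have "S \<subseteq> PiE UNIV (\<lambda>(x, y). cball 0 (real K * norm x * norm y))"
    by (auto simp: S_def)
  ultimately show ?thesis by (metis compact_Int_closed Int_absorb1 inf_commute)
qed

text \<open>Compactness of the ball makes this image compact. It spares the theorem that injective
  Borel images of Borel sets are Borel.\<close>

lemma op_code_image_closed: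
  assumes "closed C"
  shows "op_code ` (op_form -` C \<inter> cball_op K) \<in> sets borel"
proof -
  have "op_code ` (op_form -` C \<inter> cball_op K) = form_code ` (op_form ` cball_op K \<inter> C)"
    by (auto simp: op_code_def)
  moreover have "compact (form_code ` (op_form ` cball_op K \<inter> C))"
    by (intro compact_continuous_image continuous_on_subset[OF continuous_form_code]
        compact_Int_closed compact_op_form_cball assms) simp
  ultimately show ?thesis by (simp add: compact_imp_closed)
qed

lemma op_code_image_cball: "op_code ` cball_op K \<in> sets borel"
  using op_code_image_closed[of UNIV K] by simp

lemma range_op_code: "range (op_code :: 'h::separable_hilbert_space bounded_op \<Rightarrow> _) \<in> sets borel"
proof -
  have "range (op_code :: 'h bounded_op \<Rightarrow> _) = (\<Union>K. op_code ` (cball_op K :: 'h bounded_op set))"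
    unfolding image_UN[symmetric] UN_cball_op ..
  then show ?thesis using op_code_image_cball by auto
qed

text \<open>Relatively open sets are complements of closed pieces in the ball, and injectivity of
  \<open>op_code\<close> makes images commute with complements.\<close>

lemma op_code_image_ball_borel:
  fixes A :: "'h::separable_hilbert_space bounded_op set"
  assumes "A \<in> sets (borel_of (subtopology weak_operator_topology (cball_op K)))"
  shows "op_code ` A \<in> sets borel"
  using assms unfolding sets_borel_of topspace_ball_topology
proof (induction rule: sigma_sets.induct)
  case (Basic U)
  then obtain V where V: "open V" "U = op_form -` V \<inter> cball_op K" by (auto simp: openin_ball_topology)
  have "U = cball_op K - (op_form -` (- V) \<inter> cball_op K)" unfolding V by auto
  then have "op_code ` U = op_code ` (cball_op K :: 'h bounded_op set) - op_code ` (op_form -` (- V) \<inter> cball_op K)"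
    using image_set_diff[OF inj_op_code] by metis
  moreover have "closed (- V)" using V(1) by auto
  ultimately show ?case using sets.Diff[OF op_code_image_cball op_code_image_closed] by metis
next
  case (Compl A)
  have "op_code ` (cball_op K - A) = op_code ` (cball_op K :: 'h bounded_op set) - op_code ` A"
    by (intro image_set_diff inj_op_code)
  then show ?case using sets.Diff[OF op_code_image_cball Compl.IH] by simp
next
  case (Union A)
  then show ?case by (auto simp: image_UN)
qed simp

definition op_decode :: "(nat \<Rightarrow> real) \<Rightarrow> 'h::separable_hilbert_space bounded_op" where
  "op_decode = inv_into UNIV op_code"

lemma op_decode_code [simp]: "op_decode (op_code T) = T"
  unfolding op_decode_def using inj_op_code by (rule inv_f_f)

lemma op_code_measurable: "op_code \<in> measurable borel_bounded_op borel"
proof (rule measurable_coordinatewise_then_product)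
  fix m
  obtain b p where m: "prod_decode m = (b, p)" by (cases "prod_decode m")
  obtain i j where p: "prod_decode p = (i, j)" by (cases "prod_decode p")
  have "(\<lambda>T. cinner (dense_seq i) (op_apply T (dense_seq j))) \<in> borel_measurable borel_bounded_op"
    using weakly_measurable_borel_bounded_op by (auto simp: weakly_measurable_def)
  note c = this
  have "Re \<in> borel_measurable borel" "Im \<in> borel_measurable borel"
    by (intro borel_measurable_continuous_onI continuous_intros)+
  note measurable_compose[OF c this(1)] measurable_compose[OF c this(2)]
  then show "(\<lambda>T. op_code T m) \<in> borel_measurable borel_bounded_op"
    unfolding op_code_def form_code_def op_form_def by (cases "b = 0") (simp_all add: m p)
qed

lemma op_decode_measurable:
  "op_decode \<in> measurable (restrict_space borel (range (op_code :: 'h::separable_hilbert_space bounded_op \<Rightarrow> _)))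
     (borel_bounded_op :: 'h bounded_op measure)"
proof (rule measurable_sigma_sets[OF borel_bounded_op(2)])
  let ?R = "range (op_code :: 'h bounded_op \<Rightarrow> _)"
  fix A :: "'h bounded_op set" assume A: "A \<in> generating_sets"
  have "op_decode -` A \<inter> space (restrict_space borel ?R) = op_code ` A"
    by (auto simp: space_restrict_space)
  \<comment> \<open>Membership in \<open>generating_sets\<close> is a condition on each ball
    separately, so A is exhausted by its intersections with balls.\<close>
  also have "\<dots> = (\<Union>K. op_code ` (A \<inter> cball_op K))"
    unfolding image_UN[symmetric] Int_UN_distrib[symmetric] UN_cball_op by simp
  also have "\<dots> \<in> sets borel"
    using A by (intro sets.countable_UN subsetI, elim rangeE)
      (auto simp: generating_sets_def cball_op_def[symmetric] intro!: op_code_image_ball_borel)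
  finally show "op_decode -` A \<inter> space (restrict_space borel ?R) \<in> sets (restrict_space borel ?R)"
    using range_op_code by (subst sets_restrict_space_iff) (auto simp: space_restrict_space)
qed auto

definition seq_code :: "(nat \<Rightarrow> 'h::separable_hilbert_space bounded_op) \<Rightarrow> nat \<Rightarrow> real" where
  "seq_code \<gamma> m = (case prod_decode m of (n, k) \<Rightarrow> op_code (\<gamma> n) k)"

definition slice :: "nat \<Rightarrow> (nat \<Rightarrow> real) \<Rightarrow> nat \<Rightarrow> real" where
  "slice n z k = z (prod_encode (n, k))"

definition seq_decode :: "(nat \<Rightarrow> real) \<Rightarrow> nat \<Rightarrow> 'h::separable_hilbert_space bounded_op" where
  "seq_decode z n = op_decode (slice n z)"

definition code_sequences :: "'h::separable_hilbert_space itself \<Rightarrow> (nat \<Rightarrow> real) set" where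
  "code_sequences (h :: 'h itself) = {z. \<forall>n. slice n z \<in> range (op_code :: 'h bounded_op \<Rightarrow> _)}"

lemma slice_seq_code [simp]: "slice n (seq_code \<gamma>) = op_code (\<gamma> n)"
  by (simp add: slice_def seq_code_def fun_eq_iff)

lemma seq_decode_code [simp]: "seq_decode (seq_code \<gamma>) = \<gamma>"
  by (simp add: seq_decode_def fun_eq_iff)

lemma seq_code_decode: "z \<in> code_sequences TYPE('h) \<Longrightarrow> seq_code (seq_decode z :: nat \<Rightarrow> 'h::separable_hilbert_space bounded_op) = z"
proof (rule ext)
  fix m assume z: "z \<in> code_sequences TYPE('h)"
  obtain n k where m: "m = prod_encode (n, k)" by (metis prod_decode_inverse surj_pair)
  obtain T :: "'h bounded_op" where "slice n z = op_code T" using z by (auto simp: code_sequences_def)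
  then show "seq_code (seq_decode z :: nat \<Rightarrow> 'h bounded_op) m = z m"
    unfolding m seq_code_def seq_decode_def by (simp, metis slice_def)
qed

lemma seq_code_in: "seq_code (\<gamma> :: nat \<Rightarrow> 'h::separable_hilbert_space bounded_op) \<in> code_sequences TYPE('h)"
  by (simp add: code_sequences_def)

lemma slice_measurable: "slice n \<in> measurable borel borel"
  unfolding slice_def by (rule measurable_coordinatewise_then_product) (rule measurable_product_coordinates)

lemma code_sequences_borel: "code_sequences TYPE('h::separable_hilbert_space) \<in> sets borel"
proof -
  have "code_sequences TYPE('h) = (\<Inter>n. slice n -` range (op_code :: 'h bounded_op \<Rightarrow> _))"
    by (auto simp: code_sequences_def)
  moreover have "slice n -` range (op_code :: 'h bounded_op \<Rightarrow> _) \<in> sets borel" for n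
    using measurable_sets[OF slice_measurable range_op_code, of n] by simp
  ultimately show ?thesis by auto
qed

lemma seq_code_measurable: "seq_code \<in> measurable (PiM UNIV (\<lambda>_. borel_bounded_op)) borel"
proof (rule measurable_coordinatewise_then_product)
  fix m
  obtain n k where m: "prod_decode m = (n, k)" by (cases "prod_decode m")
  have "(\<lambda>\<gamma>. op_code (\<gamma> n)) \<in> measurable (PiM UNIV (\<lambda>_. borel_bounded_op)) borel"
    by (rule measurable_compose[OF measurable_component_singleton[of n UNIV "\<lambda>_. borel_bounded_op"] op_code_measurable]) simp
  then have "(\<lambda>\<gamma>. op_code (\<gamma> n) k) \<in> measurable (PiM UNIV (\<lambda>_. borel_bounded_op)) borel"
    by (rule measurable_compose) (rule measurable_product_coordinates)
  then show "(\<lambda>\<gamma>. seq_code \<gamma> m) \<in> measurable (PiM UNIV (\<lambda>_. borel_bounded_op)) borel"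
    unfolding seq_code_def m by simp
qed

lemma seq_decode_measurable:
  "seq_decode \<in> measurable (restrict_space borel (code_sequences TYPE('h)))
     (PiM UNIV (\<lambda>_. borel_bounded_op :: 'h::separable_hilbert_space bounded_op measure))"
proof -
  have "(\<lambda>z n. op_decode (slice n z) :: 'h bounded_op) \<in> measurable (restrict_space borel (code_sequences TYPE('h))) (PiM UNIV (\<lambda>_. borel_bounded_op))"
  proof (rule measurable_PiM_single')
    fix n
    have "slice n \<in> measurable (restrict_space borel (code_sequences TYPE('h))) (restrict_space borel (range (op_code :: 'h bounded_op \<Rightarrow> _)))"
      by (rule measurable_restrict_space2[OF _ measurable_restrict_space1[OF slice_measurable]])
        (auto simp: space_restrict_space code_sequences_def)
    then show "(\<lambda>z. op_decode (slice n z) :: 'h bounded_op) \<in> measurable (restrict_space borel (code_sequences TYPE('h))) borel_bounded_op"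
      by (rule measurable_compose) (rule op_decode_measurable)
  qed (simp add: borel_bounded_op)
  then show ?thesis by (simp add: seq_decode_def[abs_def])
qed

lemma standard_borel_restrict:
  fixes W :: "(nat \<Rightarrow> 'h::separable_hilbert_space bounded_op) set"
  assumes W: "W \<in> sets (PiM UNIV (\<lambda>_. borel_bounded_op))"
  shows "standard_borel (restrict_space (PiM UNIV (\<lambda>_. borel_bounded_op)) W)"
proof -
  let ?M = "PiM UNIV (\<lambda>_. borel_bounded_op) :: (nat \<Rightarrow> 'h bounded_op) measure"
  let ?C = "code_sequences TYPE('h)"
  define B where "B = {z \<in> ?C. (seq_decode z :: nat \<Rightarrow> 'h bounded_op) \<in> W}"
  have "B = seq_decode -` W \<inter> space (restrict_space borel ?C)" by (auto simp: B_def space_restrict_space)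
  then have "B \<in> sets (restrict_space borel ?C)" using measurable_sets[OF seq_decode_measurable W] by simp
  then have B: "B \<in> sets borel" using code_sequences_borel[where 'h = 'h] by (simp add: sets_restrict_space_iff)
  have "seq_code \<in> measurable (restrict_space ?M W) (restrict_space borel B)"
    by (rule measurable_restrict_space2[OF _ measurable_restrict_space1[OF seq_code_measurable]])
      (auto simp: B_def space_restrict_space seq_code_in)
  moreover have "seq_decode \<in> measurable (restrict_space borel B) (restrict_space ?M W)"
  proof (rule measurable_restrict_space2)
    have "restrict_space borel B = restrict_space (restrict_space borel ?C) B"
    proof -
      have "?C \<inter> B = B" by (auto simp: B_def)
      then show ?thesis using restrict_restrict_space[of ?C borel B] code_sequences_borel[where 'h = 'h] B by simp
    qed
    then show "seq_decode \<in> measurable (restrict_space borel B) ?M"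
      using measurable_restrict_space1[OF seq_decode_measurable] by metis
  qed (auto simp: B_def space_restrict_space)
  moreover have "\<forall>p\<in>B. seq_code (seq_decode p :: nat \<Rightarrow> 'h bounded_op) = p" by (auto simp: B_def seq_code_decode)
  ultimately show ?thesis
    unfolding standard_borel_def
    by (intro exI[of _ euclidean] exI[of _ B] exI[of _ seq_code] exI[of _ seq_decode])
      (use B in \<open>auto simp: polish_space_euclidean borel_of_euclidean\<close>)
qed

section \<open>Smoothness\<close>

abbreviation operator_sequences :: "(nat \<Rightarrow> 'h::separable_hilbert_space bounded_op) measure" where
  "operator_sequences \<equiv> PiM UNIV (\<lambda>_. borel_bounded_op)"

lemma space_operator_sequences [simp]: "space operator_sequences = UNIV"
  by (simp add: space_PiM borel_bounded_op PiE_UNIV_domain)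

lemma weakly_measurable_coordinate: "weakly_measurable operator_sequences (\<lambda>\<gamma>. \<gamma> i)"
  unfolding weakly_measurable_def
proof (intro allI)
  fix x y :: 'a
  have "(\<lambda>T. cinner x (op_apply T y)) \<in> borel_measurable borel_bounded_op"
    using weakly_measurable_borel_bounded_op by (auto simp: weakly_measurable_def)
  then show "(\<lambda>\<gamma>. cinner x (op_apply (\<gamma> i) y)) \<in> borel_measurable operator_sequences"
    by (rule measurable_compose[rotated]) (rule measurable_component_singleton, simp)
qed

lemma OSy_eq_closure_words: "OSy (range \<gamma>) = closure (complex_vector.span (range (word \<gamma>)))"
  by (simp add: OSy_def range_word)

lemma span_words_comb:
  assumes "x \<in> complex_vector.span (range (word y))"
  shows "\<exists>N c. x = comb N c y"
  using assms
proof (induction rule: complex_vector.span_induct_alt)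
  case base
  show ?case by (rule exI[of _ 0]) (simp add: comb_def)
next
  case (step a x z)
  then obtain k N c where k: "x = word y k" and z: "z = comb N c y" by blast
  define M where "M = max N (Suc k)"
  have "z = comb M (\<lambda>i. if i < N then c i else 0) y"
    unfolding z comb_def by (rule sum.mono_neutral_cong_left) (auto simp: M_def)
  moreover have "a *\<^sub>C x = comb M (\<lambda>i. if i = k then a else 0) y"
    unfolding k by (rule comb_single[symmetric]) (simp add: M_def)
  ultimately have "a *\<^sub>C x + z = comb M (\<lambda>i. (if i = k then a else 0) + (if i < N then c i else 0)) y"
    by (simp only: comb_add)
  then show ?case by blast
qed

lemma comb_in_span: "comb N c y \<in> complex_vector.span (word y ` {..<N})"
  using span_words by blast

text \<open>A maximal independent set of words inside a finite-dimensional space is finite, hence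
  contained among the first N words for some N.\<close>

lemma finite_dimensional_OSy_iff:
  "finite_dimensional (OSy (range \<gamma>)) \<longleftrightarrow> (\<exists>N. \<forall>k. word \<gamma> k \<in> complex_vector.span (word \<gamma> ` {..<N}))"
proof
  assume "finite_dimensional (OSy (range \<gamma>))"
  then obtain B where B: "finite B" "OSy (range \<gamma>) = complex_vector.span B" by (auto simp: finite_dimensional_def)
  have sub: "range (word \<gamma>) \<subseteq> complex_vector.span B"
    unfolding B(2)[symmetric] OSy_eq_closure_words
    by (rule order_trans[OF complex_vector.span_superset closure_subset])
  obtain C where C: "C \<subseteq> range (word \<gamma>)" "complex_vector.independent C" "range (word \<gamma>) \<subseteq> complex_vector.span C"
    by (rule complex_vector.maximal_independent_subset[of "range (word \<gamma>)"])
  have "finite C" using complex_vector.independent_span_bound[OF B(1) C(2) order_trans[OF C(1) sub]] ..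
  then obtain K where K: "finite K" "C = word \<gamma> ` K" using C(1) by (meson finite_subset_image)
  then obtain N where "K \<subseteq> {..<N}" using finite_nat_iff_bounded by blast
  then have "complex_vector.span C \<subseteq> complex_vector.span (word \<gamma> ` {..<N})"
    unfolding K(2) by (intro complex_vector.span_mono image_mono)
  then show "\<exists>N. \<forall>k. word \<gamma> k \<in> complex_vector.span (word \<gamma> ` {..<N})" using C(3) by blast
next
  assume "\<exists>N. \<forall>k. word \<gamma> k \<in> complex_vector.span (word \<gamma> ` {..<N})"
  then obtain N where N: "\<And>k. word \<gamma> k \<in> complex_vector.span (word \<gamma> ` {..<N})" by blast
  have "complex_vector.span (range (word \<gamma>)) = complex_vector.span (word \<gamma> ` {..<N})"
  proof (rule antisym)
    show "complex_vector.span (range (word \<gamma>)) \<subseteq> complex_vector.span (word \<gamma> ` {..<N})"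
      by (rule complex_vector.span_minimal) (use N in auto)
    show "complex_vector.span (word \<gamma> ` {..<N}) \<subseteq> complex_vector.span (range (word \<gamma>))"
      by (rule complex_vector.span_mono) auto
  qed
  then have "OSy (range \<gamma>) = complex_vector.span (word \<gamma> ` {..<N})"
    unfolding OSy_eq_closure_words by (simp add: closure_closed closed_span_finite)
  then show "finite_dimensional (OSy (range \<gamma>))" unfolding finite_dimensional_def by blast
qed

lemma finite_dimensional_OSy_eq:
  fixes \<gamma> :: "nat \<Rightarrow> 'a::cstar_algebra"
  assumes "finite_dimensional (OSy (range \<gamma>))"
  shows "OSy (range \<gamma>) = complex_vector.span (range (word \<gamma>))"
proof (rule antisym)
  obtain N where N: "\<And>k. word \<gamma> k \<in> complex_vector.span (word \<gamma> ` {..<N})"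
    using assms finite_dimensional_OSy_iff by blast
  have "complex_vector.span (range (word \<gamma>)) \<subseteq> complex_vector.span (word \<gamma> ` {..<N})"
    by (rule complex_vector.span_minimal) (use N in auto)
  then have "OSy (range \<gamma>) \<subseteq> complex_vector.span (word \<gamma> ` {..<N})"
    unfolding OSy_eq_closure_words by (intro closure_minimal closed_span_finite) auto
  also have "\<dots> \<subseteq> complex_vector.span (range (word \<gamma>))"
    by (rule complex_vector.span_mono) auto
  finally show "OSy (range \<gamma>) \<subseteq> complex_vector.span (range (word \<gamma>))" .
  show "complex_vector.span (range (word \<gamma>)) \<subseteq> OSy (range \<gamma>)"
    unfolding OSy_eq_closure_words by (rule closure_subset)
qed

lemma operator_system_OSy:
  fixes \<gamma> :: "nat \<Rightarrow> 'a::cstar_algebra"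
  assumes fin: "finite_dimensional (OSy (range \<gamma>))"
  shows "operator_system (OSy (range \<gamma>))"
  unfolding operator_system_def
proof (intro conjI ballI)
  let ?S = "complex_vector.span (range (word \<gamma>))"
  show "complex_vector.subspace (OSy (range \<gamma>))"
    unfolding finite_dimensional_OSy_eq[OF fin] by (rule complex_vector.subspace_span)
  show "closed (OSy (range \<gamma>))" unfolding OSy_def by simp
  have "word \<gamma> 0 \<in> ?S" by (rule complex_vector.span_base) blast
  then show "1 \<in> OSy (range \<gamma>)" unfolding finite_dimensional_OSy_eq[OF fin] by simp
  fix x assume "x \<in> OSy (range \<gamma>)"
  then have "x \<in> ?S" unfolding finite_dimensional_OSy_eq[OF fin] .
  then have "star x \<in> ?S"
  proof (induction rule: complex_vector.span_induct_alt)
    case (step c x y)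
    then obtain k where "x = word \<gamma> k" by blast
    then have "star x \<in> ?S" by (auto simp: star_word intro: complex_vector.span_base)
    then show ?case
      using step.IH by (auto simp: star_add star_scaleC intro!: complex_vector.span_add complex_vector.span_scale)
  qed (simp add: complex_vector.span_zero)
  then show "star x \<in> OSy (range \<gamma>)" unfolding finite_dimensional_OSy_eq[OF fin] .
qed

text \<open>Finite spans are closed, so membership in them can be tested by approximation with
  rational coefficients. What remains are countable quantifiers over strict norm inequalities, a
  Borel condition.\<close>

lemma finite_dimensional_OSy_approx:
  "finite_dimensional (OSy (range \<gamma>)) \<longleftrightarrow>
     (\<exists>N. \<forall>k m. \<exists>s. norm (word \<gamma> k - comb N (gcoef s) \<gamma>) < inverse (real (Suc m)))"
  unfolding finite_dimensional_OSy_iff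
proof (intro ex_cong1 iffI allI)
  fix N k m assume "\<forall>k. word \<gamma> k \<in> complex_vector.span (word \<gamma> ` {..<N})"
  then obtain c where c: "word \<gamma> k = comb N c \<gamma>" unfolding span_words by blast
  obtain s where "\<And>p. (\<lambda>t. gcoef (s t) p) \<longlonglongrightarrow> c p" using gcoef_dense_seq by metis
  then have "(\<lambda>t. comb N (gcoef (s t)) \<gamma>) \<longlonglongrightarrow> word \<gamma> k" unfolding c by (intro tendsto_comb tendsto_const)
  then have "\<forall>\<^sub>F t in sequentially. dist (comb N (gcoef (s t)) \<gamma>) (word \<gamma> k) < inverse (real (Suc m))"
    by (rule tendstoD) simp
  then have "\<exists>t. dist (comb N (gcoef (s t)) \<gamma>) (word \<gamma> k) < inverse (real (Suc m))"
    by (rule eventually_happens'[OF sequentially_bot])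
  then show "\<exists>s. norm (word \<gamma> k - comb N (gcoef s) \<gamma>) < inverse (real (Suc m))"
    by (auto simp: dist_norm norm_minus_commute)
next
  fix N k assume *: "\<forall>k m. \<exists>s. norm (word \<gamma> k - comb N (gcoef s) \<gamma>) < inverse (real (Suc m))"
  let ?S = "complex_vector.span (word \<gamma> ` {..<N})"
  have "word \<gamma> k \<in> closure ?S"
    unfolding closure_approachable
  proof (intro allI impI)
    fix e :: real assume "e > 0"
    then obtain m where m: "inverse (real (Suc m)) < e" using reals_Archimedean by blast
    obtain s where "norm (word \<gamma> k - comb N (gcoef s) \<gamma>) < inverse (real (Suc m))" using * by blast
    then have "dist (comb N (gcoef s) \<gamma>) (word \<gamma> k) < e" using m by (simp only: dist_norm norm_minus_commute)
    then show "\<exists>y\<in>?S. dist y (word \<gamma> k) < e" using comb_in_span by blast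
  qed
  then show "word \<gamma> k \<in> ?S" by (simp add: closure_closed closed_span_finite)
qed

lemma finite_dimensional_OSy_measurable:
  "{\<gamma> :: nat \<Rightarrow> 'h::separable_hilbert_space bounded_op. finite_dimensional (OSy (range \<gamma>))} \<in> sets operator_sequences"
proof -
  have "(\<lambda>\<gamma> :: nat \<Rightarrow> 'h bounded_op. norm (word \<gamma> k - comb N (gcoef s) \<gamma>)) \<in> borel_measurable operator_sequences" for k N s
    by (intro weakly_measurable_norm weakly_measurable_diff weakly_measurable_word weakly_measurable_comb weakly_measurable_coordinate)
  then have "{\<gamma> \<in> space operator_sequences. norm (word \<gamma> k - comb N (gcoef s) \<gamma>) < inverse (real (Suc m))}
      \<in> sets (operator_sequences :: (nat \<Rightarrow> 'h bounded_op) measure)" for k N s m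
    by (intro borel_measurable_less borel_measurable_const)
  then have "{\<gamma> \<in> space operator_sequences. \<exists>N. \<forall>k m. \<exists>s. norm (word \<gamma> k - comb N (gcoef s) \<gamma>) < inverse (real (Suc m))}
      \<in> sets (operator_sequences :: (nat \<Rightarrow> 'h bounded_op) measure)"
    by (intro sets.sets_Collect_countable_Ex sets.sets_Collect_countable_All)
  then show ?thesis by (simp add: finite_dimensional_OSy_approx)
qed

text \<open>The elements of \<open>OSy (range \<gamma>)\<close> are approximated by countably many combinations of words in \<open>\<gamma>\<close>,
  indexed by pairs of numbers; finite lists of such pairs index sequences of elements.\<close>

definition rational_seq :: "(nat \<times> nat) list \<Rightarrow> (nat \<Rightarrow> 'a::cstar_algebra) \<Rightarrow> nat \<Rightarrow> 'a" where
  "rational_seq l \<gamma> i = (if i < length l then comb (fst (l ! i)) (gcoef (snd (l ! i))) \<gamma> else 0)"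

text \<open>Only the first \<open>defect_bound S\<close> entries affect the defect; the others are
  replaced by 0. The finitely many strict inequalities left hold for all sufficiently close rational
  combinations.\<close>

lemma realizes_open_rational:
  fixes \<gamma> :: "nat \<Rightarrow> 'a::cstar_algebra"
  assumes fin: "finite_dimensional (OSy (range \<gamma>))"
  shows "realizes_open (OSy (range \<gamma>)) S a \<longleftrightarrow>
    (\<exists>l. (\<forall>i. norm (rational_seq l \<gamma> i) < 1) \<and> defect S (rational_seq l \<gamma>) < inverse (real (Suc a)))"
proof
  let ?X = "OSy (range \<gamma>)"
  assume "realizes_open ?X S a"
  then obtain y where y: "\<And>i. y i \<in> ?X" "\<And>i. norm (y i) < 1" "defect S y < inverse (real (Suc a))"
    by (auto simp: realizes_open_def)
  define m where "m = defect_bound S"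
  define y' where "y' i = (if i < m then y i else 0)" for i
  have y': "defect S y' < inverse (real (Suc a))"
    using defect_cong[of S y y'] y(3) by (simp add: y'_def m_def defect_bound_def)
  have "\<exists>N s. (\<lambda>t::nat. comb N (gcoef (s t)) \<gamma>) \<longlonglongrightarrow> y i" for i
  proof -
    obtain N c where c: "y i = comb N c \<gamma>"
      using y(1)[of i] span_words_comb unfolding finite_dimensional_OSy_eq[OF fin] by blast
    obtain s where "\<And>p. (\<lambda>t. gcoef (s t) p) \<longlonglongrightarrow> c p" using gcoef_dense_seq by metis
    then have "(\<lambda>t. comb N (gcoef (s t)) \<gamma>) \<longlonglongrightarrow> y i" unfolding c by (intro tendsto_comb tendsto_const)
    then show ?thesis by blast
  qed
  then have "\<forall>i. \<exists>p :: nat \<times> (nat \<Rightarrow> nat). (\<lambda>t. comb (fst p) (gcoef (snd p t)) \<gamma>) \<longlonglongrightarrow> y i" by simp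
  from choice[OF this] obtain p :: "nat \<Rightarrow> nat \<times> (nat \<Rightarrow> nat)"
    where p: "\<And>i. (\<lambda>t. comb (fst (p i)) (gcoef (snd (p i) t)) \<gamma>) \<longlonglongrightarrow> y i" by blast
  define l where "l t = map (\<lambda>i. (fst (p i), snd (p i) t)) [0..<m]" for t
  have lim: "(\<lambda>t. rational_seq (l t) \<gamma> i) \<longlonglongrightarrow> y' i" for i
    using p[of i] by (simp add: rational_seq_def l_def y'_def)
  have ev: "\<forall>\<^sub>F t in sequentially. norm (rational_seq (l t) \<gamma> i) < 1" for i
    by (rule order_tendstoD(2)[OF tendsto_norm[OF lim]]) (simp add: y'_def y(2))
  have "\<forall>\<^sub>F t in sequentially. \<forall>i\<in>{..<m}. norm (rational_seq (l t) \<gamma> i) < 1"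
    by (intro eventually_ball_finite ballI ev) simp
  moreover have "\<forall>\<^sub>F t in sequentially. defect S (rational_seq (l t) \<gamma>) < inverse (real (Suc a))"
    by (rule order_tendstoD(2)[OF tendsto_defect[OF lim] y'])
  ultimately have "\<forall>\<^sub>F t in sequentially. (\<forall>i\<in>{..<m}. norm (rational_seq (l t) \<gamma> i) < 1) \<and>
      defect S (rational_seq (l t) \<gamma>) < inverse (real (Suc a))"
    by (rule eventually_conj)
  then obtain t where t: "\<forall>i\<in>{..<m}. norm (rational_seq (l t) \<gamma> i) < 1" "defect S (rational_seq (l t) \<gamma>) < inverse (real (Suc a))"
    using eventually_happens'[OF sequentially_bot] by blast
  have "norm (rational_seq (l t) \<gamma> i) < 1" for i
  proof (cases "i < m")
    case False
    then show ?thesis by (simp add: rational_seq_def l_def)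
  qed (use t in auto)
  then show "\<exists>l. (\<forall>i. norm (rational_seq l \<gamma> i) < 1) \<and> defect S (rational_seq l \<gamma>) < inverse (real (Suc a))"
    using t(2) by blast
next
  note X = operator_system_OSy[OF fin]
  assume "\<exists>l. (\<forall>i. norm (rational_seq l \<gamma> i) < 1) \<and> defect S (rational_seq l \<gamma>) < inverse (real (Suc a))"
  then obtain l where l: "\<forall>i. norm (rational_seq l \<gamma> i) < 1" "defect S (rational_seq l \<gamma>) < inverse (real (Suc a))" by blast
  have "\<gamma> i \<in> OSy (range \<gamma>)" for i
    unfolding finite_dimensional_OSy_eq[OF fin]
    by (metis complex_vector.span_base rangeI word_simps(2))
  then have "rational_seq l \<gamma> i \<in> OSy (range \<gamma>)" for i
    unfolding rational_seq_def using comb_in[OF X] operator_systemD(2)[OF X] by auto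
  then show "realizes_open (OSy (range \<gamma>)) S a" unfolding realizes_open_def using l by blast
qed

lemma realizes_open_measurable:
  "{\<gamma> \<in> space operator_sequences. \<exists>l. (\<forall>i. norm (rational_seq l \<gamma> i) < 1) \<and> defect S (rational_seq l \<gamma>) < inverse (real (Suc a))}
     \<in> sets (operator_sequences :: (nat \<Rightarrow> 'h::separable_hilbert_space bounded_op) measure)"
proof -
  let ?M = "operator_sequences :: (nat \<Rightarrow> 'h bounded_op) measure"
  have w: "weakly_measurable ?M (\<lambda>\<gamma>. rational_seq l \<gamma> i)" for l i
    by (cases "i < length l")
      (auto simp: rational_seq_def intro!: weakly_measurable_comb weakly_measurable_coordinate weakly_measurable_zero)
  have "{\<gamma> \<in> space ?M. norm (rational_seq l \<gamma> i) < 1} \<in> sets ?M" for l i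
    by (intro borel_measurable_less weakly_measurable_norm w borel_measurable_const)
  moreover have "{\<gamma> \<in> space ?M. defect S (rational_seq l \<gamma>) < inverse (real (Suc a))} \<in> sets ?M" for l
    by (intro borel_measurable_less weakly_measurable_defect w borel_measurable_const)
  ultimately show ?thesis
    by (intro sets.sets_Collect_countable_Ex sets.sets_Collect_conj sets.sets_Collect_countable_All)
qed

definition realization_code :: "(nat \<Rightarrow> 'h::separable_hilbert_space bounded_op) \<Rightarrow> nat \<Rightarrow> real" where
  "realization_code \<gamma> j = (case from_nat j of (S, a) \<Rightarrow> of_bool (realizes_open (OSy (range \<gamma>)) S a))"

lemma space_OSy_parameters: "space OSy_parameters = {\<gamma>. finite_dimensional (OSy (range \<gamma>))}"
  by (simp add: OSy_parameters_def space_restrict_space)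

lemma realization_code_measurable: "realization_code \<in> measurable OSy_parameters borel"
proof (rule measurable_coordinatewise_then_product)
  fix j
  obtain S a where j: "(from_nat j :: norm_conditions \<times> nat) = (S, a)" by (cases "from_nat j :: norm_conditions \<times> nat")
  let ?P = "\<lambda>\<gamma> :: nat \<Rightarrow> 'a bounded_op. \<exists>l. (\<forall>i. norm (rational_seq l \<gamma> i) < 1) \<and> defect S (rational_seq l \<gamma>) < inverse (real (Suc a))"
  have "(\<lambda>\<gamma>. of_bool (?P \<gamma>) :: real) \<in> borel_measurable operator_sequences"
  proof -
    have "(\<lambda>\<gamma>. of_bool (?P \<gamma>) :: real) = indicator {\<gamma> \<in> space operator_sequences. ?P \<gamma>}"
      by (simp add: fun_eq_iff indicator_def)
    then show ?thesis by (simp only: borel_measurable_indicator[OF realizes_open_measurable])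
  qed
  then have "(\<lambda>\<gamma>. of_bool (?P \<gamma>) :: real) \<in> borel_measurable OSy_parameters"
    unfolding OSy_parameters_def by (rule measurable_restrict_space1)
  \<comment> \<open>\<open>realizes_open_rational\<close> assumes finite dimension, so the rational
    test is identified with the code only after restriction to the parameter space.\<close>
  moreover have "realization_code \<gamma> j = of_bool (?P \<gamma>)" if "\<gamma> \<in> space OSy_parameters" for \<gamma>
    using that realizes_open_rational[of \<gamma> S a] by (simp add: realization_code_def j space_OSy_parameters)
  ultimately show "(\<lambda>\<gamma> :: nat \<Rightarrow> 'a bounded_op. realization_code \<gamma> j) \<in> borel_measurable OSy_parameters"
    by (subst measurable_cong)
qed

lemma realization_code_eq_iff:
  "realization_code \<gamma> = realization_code \<gamma>' \<longleftrightarrow>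
    (\<forall>S a. realizes_open (OSy (range \<gamma>)) S a \<longleftrightarrow> realizes_open (OSy (range \<gamma>')) S a)"
proof
  assume eq: "realization_code \<gamma> = realization_code \<gamma>'"
  have "realizes_open (OSy (range \<gamma>)) S a \<longleftrightarrow> realizes_open (OSy (range \<gamma>')) S a" for S a
    using fun_cong[OF eq, of "to_nat (S, a)"] by (simp add: realization_code_def of_bool_eq_iff)
  then show "\<forall>S a. realizes_open (OSy (range \<gamma>)) S a \<longleftrightarrow> realizes_open (OSy (range \<gamma>')) S a" by blast
qed (auto simp: realization_code_def fun_eq_iff split: prod.split)

lemma smooth_OSy_isomorphism_relation:
  "smooth_equivalence (OSy_parameters :: (nat \<Rightarrow> 'h::separable_hilbert_space bounded_op) measure) OSy_isomorphism_relation"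
proof -
  let ?M = "OSy_parameters :: (nat \<Rightarrow> 'h bounded_op) measure"
  have sys: "operator_system (OSy (range \<gamma>)) \<and> finite_dimensional (OSy (range \<gamma>))" if "\<gamma> \<in> space ?M" for \<gamma>
    using that operator_system_OSy by (auto simp: space_OSy_parameters)
  have rel: "(\<gamma>, \<gamma>') \<in> OSy_isomorphism_relation \<longleftrightarrow> realization_code \<gamma> = realization_code \<gamma>'"
    if "\<gamma> \<in> space ?M" "\<gamma>' \<in> space ?M" for \<gamma> \<gamma>'
    using that completely_order_isomorphic_iff_realizes[of "OSy (range \<gamma>)" "OSy (range \<gamma>')"] sys[OF that(1)] sys[OF that(2)]
    by (simp add: OSy_isomorphism_relation_def realization_code_eq_iff)
  have sub: "(OSy_isomorphism_relation :: ((nat \<Rightarrow> 'h bounded_op) \<times> _) set) \<subseteq> space ?M \<times> space ?M"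
    by (auto simp: OSy_isomorphism_relation_def)
  have "equiv (space ?M) OSy_isomorphism_relation"
  proof (rule equivI)
    show "refl_on (space ?M) OSy_isomorphism_relation" using rel by (auto simp: refl_on_def)
    show "sym (OSy_isomorphism_relation :: ((nat \<Rightarrow> 'h bounded_op) \<times> _) set)"
      by (rule symI) (metis mem_Sigma_iff rel sub subsetD)
    show "trans (OSy_isomorphism_relation :: ((nat \<Rightarrow> 'h bounded_op) \<times> _) set)"
      by (rule transI) (metis mem_Sigma_iff rel sub subsetD)
  qed (rule sub)
  moreover have "standard_borel ?M"
    unfolding OSy_parameters_def by (rule standard_borel_restrict[OF finite_dimensional_OSy_measurable])
  ultimately show ?thesis
    unfolding smooth_equivalence_def using rel realization_code_measurable
    by (intro conjI exI[of _ euclidean] exI[of _ realization_code]) (auto simp: polish_space_euclidean borel_of_euclidean)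
qed

theorem corollary5p5:
  shows "(\<forall>(X :: 'a::cstar_algebra set) (Y :: 'b::cstar_algebra set).
            operator_system X \<and> finitely_generated X \<and>
            operator_system Y \<and> finitely_generated Y \<longrightarrow>
              (completely_order_isomorphic X Y \<longleftrightarrow>
                (\<forall>\<phi>. sentence \<phi> \<and> universal \<phi> \<longrightarrow> sentence_value X \<phi> = sentence_value Y \<phi>)) \<and>
              (completely_order_isomorphic X Y \<longleftrightarrow>
                (\<forall>\<phi>. sentence \<phi> \<and> prenex_universal \<phi> \<longrightarrow>
                   sentence_value X \<phi> = sentence_value Y \<phi>))) \<and>
         smooth_equivalence
           (OSy_parameters :: (nat \<Rightarrow> 'h::separable_hilbert_space bounded_op) measure)
           OSy_isomorphism_relation"
proof (intro conjI allI impI)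
  fix X :: "'a set" and Y :: "'b set"
  assume XY: "operator_system X \<and> finitely_generated X \<and> operator_system Y \<and> finitely_generated Y"
  then have "finite_dimensional X" "finite_dimensional Y"
    by (auto intro: finitely_generated_imp_finite_dimensional)
  then show "completely_order_isomorphic X Y \<longleftrightarrow>
      (\<forall>\<phi>. sentence \<phi> \<and> universal \<phi> \<longrightarrow> sentence_value X \<phi> = sentence_value Y \<phi>)"
    and "completely_order_isomorphic X Y \<longleftrightarrow>
      (\<forall>\<phi>. sentence \<phi> \<and> prenex_universal \<phi> \<longrightarrow> sentence_value X \<phi> = sentence_value Y \<phi>)"
    using XY completely_order_isomorphic_iff_sentences[of X Y] by blast+
qed (rule smooth_OSy_isomorphism_relation)

end
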